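(* Let $\mathcal{C}_f$ be a plane branch with value semigroup $\Gamma_f=\langle v_0,v_1\rangle$ and value set of $1$-forms $\Lambda_f$. For every $\lambda\in\Lambda_f\setminus\Gamma_f$ we have $-\frac{\lambda}{v_0v_1}\in\mathcal{R}_f$.
   Context: Plane branch: $f\in\mathcal{O}_2=\mathbb{C}\{X_1,X_2\}$ is irreducible with multiplicity $\mathrm{mult}(f)>1$, and $\mathcal{C}_f$ is the germ of plane curve $f=0$ at the origin. Up to analytic change of coordinates, $\mathcal{C}_f$ has a primitive parameterization $\varphi(T)=(T^{v_0},T^{v_1}+\sum_{i>v_1}a_iT^i)$ with $v_1>v_0=\mathrm{mult}(f)$, $v_0\nmid v_1$ (primitive: the exponents occurring have no common divisor greater than $1$). Value semigroup: $\nu_f(h)=\mathrm{ord}_T\,h(\varphi(T))$ and $\Gamma_f=\{\nu_f(h):h\in\mathcal{O}_2\setminus(f)\}\subset\mathbb{N}$. Writing $\Gamma_f=\langle v_0,v_1\rangle$ means that $v_0<v_1$ is the minimal set of generators of $\Gamma_f$, with $\gcd(v_0,v_1)=1$ and $1<v_0$. Values of differentials: $\Omega_f=\Omega^1/(f\Omega^1+\mathcal{O}_2\,df)$, where $\Omega^1$ is the module of germs of holomorphic $1$-forms on $(\mathbb{C}^2,0)$. For $\omega=A\,dx_1+B\,dx_2\in\Omega_f$, put $\varphi^*(\omega)=A(\varphi(T))\varphi_1'(T)+B(\varphi(T))\varphi_2'(T)$, $\nu_f(\omega)=\mathrm{ord}_T(\varphi^*(\omega))+1$, and $\Lambda_f=\{\nu_f(\omega):\omega\in\Omega_f,\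 \varphi^*(\omega)\ne 0\}$. (One has $\Gamma_f\setminus\{0\}\subseteq\Lambda_f$; $\Lambda_f$ is an analytic invariant.) Bernstein polynomial: $b_f(s)$ is the monic generator of the ideal of all $b(s)\in\mathbb{C}[s]$ for which there is $P(s)\in\mathcal{D}_X[s]$ (differential operators with coefficients in $\mathcal{O}_2$, polynomial in $s$) with $P(s)f^{s+1}=b(s)f^s$; $\widetilde b_f(s)=b_f(s)/(s+1)$ is the reduced Bernstein polynomial and $\mathcal{R}_f$ is its set of roots. *)

theory Defs
  imports "HOL-Analysis.Analysis" "HOL-Computational_Algebra.Polynomial_Factorial"
    "HOL-Library.Poly_Mapping"
begin

unbundle no vec_syntax
unbundle fps_syntax

section \<open>Convergent power series in two variables\<close>

text \<open>
  A series in \<open>X\<^sub>1, X\<^sub>2\<close> is a power series in \<open>X\<^sub>2\<close> whose coefficients are power series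
  in \<open>X\<^sub>1\<close>: the coefficient of \<open>X\<^sub>1 ^ i * X\<^sub>2 ^ j\<close> in \<open>F\<close> is \<open>F $ j $ i\<close>.
\<close>

definition convergent2 :: "complex fps fps \<Rightarrow> bool" where
  "convergent2 F \<longleftrightarrow>
     (\<exists>r>0::real. (\<lambda>(i, j). norm (F $ j $ i) * r ^ (i + j)) summable_on (UNIV :: (nat \<times> nat) set))"

lemma convergent2_iff_bound:
  "convergent2 F \<longleftrightarrow> (\<exists>C R. C \<ge> 0 \<and> R > 0 \<and> (\<forall>i j. norm (F $ j $ i) \<le> C * R ^ (i + j)))"
proof
  assume "convergent2 F"
  then obtain r :: real where r: "r > 0"
    and s: "(\<lambda>(i, j). norm (F $ j $ i) * r ^ (i + j)) summable_on (UNIV :: (nat \<times> nat) set)"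
    unfolding convergent2_def by auto
  let ?g = "\<lambda>p::nat \<times> nat. (case p of (i, j) \<Rightarrow> norm (F $ j $ i) * r ^ (i + j))"
  define C where "C = infsum ?g UNIV"
  have le: "?g p \<le> C" for p
  proof -
    have "sum ?g {p} \<le> infsum ?g UNIV"
      by (rule finite_sum_le_infsum) (use s r in auto)
    then show ?thesis by (simp add: C_def)
  qed
  have "C \<ge> 0" using order.trans[OF norm_ge_zero le[of "(0, 0)", simplified]] .
  moreover have "norm (F $ j $ i) \<le> C * (1 / r) ^ (i + j)" for i j
    using le[of "(i, j)"] r by (simp add: power_one_over field_simps)
  ultimately show "\<exists>C R. C \<ge> 0 \<and> R > 0 \<and> (\<forall>i j. norm (F $ j $ i) \<le> C * R ^ (i + j))"
    using r by (intro exI[of _ C] exI[of _ "1 / r"]) auto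
next
  assume "\<exists>C R. C \<ge> 0 \<and> R > 0 \<and> (\<forall>i j. norm (F $ j $ i) \<le> C * R ^ (i + j))"
  then obtain C R :: real where C: "C \<ge> 0" and R: "R > 0"
    and b: "norm (F $ j $ i) \<le> C * R ^ (i + j)" for i j
    by blast
  define r where "r = 1 / (2 * R)"
  have r: "r > 0" using R by (simp add: r_def)
  have geo: "((\<lambda>n. (1 / 2) ^ n) has_sum (2::real)) (UNIV :: nat set)"
    using geometric_sums[of "1 / 2 :: real"]
    by (intro norm_summable_imp_has_sum) (auto simp: norm_power)
  have dom: "(\<lambda>(i, j). C * (1 / 2) ^ (i + j)) summable_on (UNIV :: (nat \<times> nat) set)"
  proof -
    have "(\<lambda>(i, j). C * (1 / 2) ^ (i + j)) summable_on
            (SIGMA i:(UNIV::nat set). (UNIV::nat set))"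
    proof (rule summable_on_SigmaI)
      show "((\<lambda>j. case (i, j) of (i, j) \<Rightarrow> C * (1 / 2) ^ (i + j)) has_sum
              (C * (1 / 2) ^ i * 2)) UNIV" for i
        using has_sum_cmult_right[OF geo, of "C * (1 / 2) ^ i"]
        by (simp add: power_add mult_ac)
      show "(\<lambda>i. C * (1 / 2) ^ i * 2) summable_on (UNIV :: nat set)"
        using has_sum_cmult_right[OF geo, of "2 * C"]
        by (auto simp: summable_on_def mult_ac)
    qed (use C in auto)
    then show ?thesis by simp
  qed
  have "(\<lambda>(i, j). norm (F $ j $ i) * r ^ (i + j)) summable_on (UNIV :: (nat \<times> nat) set)"
  proof (rule summable_on_comparison_test[OF dom])
    fix p :: "nat \<times> nat"
    obtain i j where p: "p = (i, j)" by force
    have "norm (F $ j $ i) * r ^ (i + j) \<le> C * R ^ (i + j) * r ^ (i + j)"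
      using b r by (intro mult_right_mono) auto
    also have "\<dots> = C * (1 / 2) ^ (i + j)"
      using R by (simp add: mult.assoc power_mult_distrib[symmetric] r_def del: power_mult_distrib)
    finally show "(case p of (i, j) \<Rightarrow> norm (F $ j $ i) * r ^ (i + j))
        \<le> (case p of (i, j) \<Rightarrow> C * (1 / 2) ^ (i + j))"
      by (simp add: p)
  qed (use r in auto)
  with r show "convergent2 F" unfolding convergent2_def by auto
qed

lemma convergent2_const: "convergent2 (fps_const (fps_const c))"
  unfolding convergent2_iff_bound
  by (rule exI[of _ "norm c"], rule exI[of _ 1]) auto

lemma convergent2_uminus: "convergent2 F \<Longrightarrow> convergent2 (- F)"
  by (simp add: convergent2_def)

lemma convergent2_add:
  assumes "convergent2 F" "convergent2 G"
  shows "convergent2 (F + G)"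
proof -
  obtain C R where F: "C \<ge> 0" "R > 0" "\<And>i j. norm (F $ j $ i) \<le> C * R ^ (i + j)"
    using assms(1) unfolding convergent2_iff_bound by blast
  obtain C' R' where G: "C' \<ge> 0" "R' > 0" "\<And>i j. norm (G $ j $ i) \<le> C' * R' ^ (i + j)"
    using assms(2) unfolding convergent2_iff_bound by blast
  have "norm ((F + G) $ j $ i) \<le> (C + C') * (max R R') ^ (i + j)" for i j
  proof -
    have "norm ((F + G) $ j $ i) \<le> C * R ^ (i + j) + C' * R' ^ (i + j)"
      using norm_triangle_ineq[of "F $ j $ i" "G $ j $ i"] F(3)[of j i] G(3)[of j i] by simp
    also have "\<dots> \<le> C * (max R R') ^ (i + j) + C' * (max R R') ^ (i + j)"
      using F G by (intro add_mono mult_left_mono power_mono) auto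
    finally show ?thesis by (simp add: algebra_simps)
  qed
  then show ?thesis unfolding convergent2_iff_bound using F G
    by (intro exI[of _ "C + C'"] exI[of _ "max R R'"]) auto
qed

lemma convergent2_mult:
  assumes "convergent2 F" "convergent2 G"
  shows "convergent2 (F * G)"
proof -
  obtain C R where F: "C \<ge> 0" "R > 0" "\<And>i j. norm (F $ j $ i) \<le> C * R ^ (i + j)"
    using assms(1) unfolding convergent2_iff_bound by blast
  obtain C' R' where G: "C' \<ge> 0" "R' > 0" "\<And>i j. norm (G $ j $ i) \<le> C' * R' ^ (i + j)"
    using assms(2) unfolding convergent2_iff_bound by blast
  define M where "M = max R R'"
  have M: "M > 0" using F by (simp add: M_def)
  have FM: "norm (F $ j $ i) \<le> C * M ^ (i + j)" for i j
    using F(3)[of j i] mult_left_mono[OF power_mono[of R M "i + j"] F(1)] F(2) by (simp add: M_def)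
  have GM: "norm (G $ j $ i) \<le> C' * M ^ (i + j)" for i j
    using G(3)[of j i] mult_left_mono[OF power_mono[of R' M "i + j"] G(1)] G(2) by (simp add: M_def)
  have "norm ((F * G) $ j $ i) \<le> (C * C') * (2 * M) ^ (i + j)" for i j
  proof -
    have eq: "(F * G) $ j $ i = (\<Sum>k=0..j. \<Sum>l=0..i. F $ k $ l * G $ (j - k) $ (i - l))"
      by (simp add: fps_mult_nth fps_sum_nth)
    have "norm ((F * G) $ j $ i) \<le> (\<Sum>k=0..j. \<Sum>l=0..i. norm (F $ k $ l * G $ (j - k) $ (i - l)))"
      unfolding eq by (intro order.trans[OF norm_sum] sum_mono) auto
    also have "\<dots> \<le> (\<Sum>k=0..j. \<Sum>l=0..i. C * C' * M ^ (i + j))"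
    proof (intro sum_mono)
      fix k l assume kl: "k \<in> {0..j}" "l \<in> {0..i}"
      have "norm (F $ k $ l * G $ (j - k) $ (i - l))
          \<le> (C * M ^ (l + k)) * (C' * M ^ ((i - l) + (j - k)))"
        unfolding norm_mult using FM GM F G M by (intro mult_mono) auto
      also have "\<dots> = C * C' * (M ^ (l + k) * M ^ ((i - l) + (j - k)))" by (simp add: mult_ac)
      also have "M ^ (l + k) * M ^ ((i - l) + (j - k)) = M ^ (i + j)"
        unfolding power_add[symmetric] using kl by (intro arg_cong[of _ _ "\<lambda>n. M ^ n"]) auto
      finally show "norm (F $ k $ l * G $ (j - k) $ (i - l)) \<le> C * C' * M ^ (i + j)" .
    qed
    also have "\<dots> = real (Suc j) * real (Suc i) * (C * C' * M ^ (i + j))" by simp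
    also have "\<dots> \<le> 2 ^ j * 2 ^ i * (C * C' * M ^ (i + j))"
    proof (intro mult_right_mono mult_mono)
      have "Suc n \<le> 2 ^ n" for n :: nat by (rule Suc_leI[OF less_exp])
      then show "real (Suc j) \<le> 2 ^ j" "real (Suc i) \<le> 2 ^ i"
        by (metis of_nat_le_iff of_nat_power of_nat_numeral)+
    qed (use F G M in auto)
    also have "\<dots> = (C * C') * (2 * M) ^ (i + j)" by (simp add: power_add power_mult_distrib mult_ac)
    finally show ?thesis .
  qed
  then show ?thesis unfolding convergent2_iff_bound using F G M
    by (intro exI[of _ "C * C'"] exI[of _ "2 * M"]) auto
qed

lemma convergent2_shift:
  assumes "convergent2 F"
    and "\<And>i j. norm (G $ j $ i) \<le> real (Suc (i + j)) * norm (F $ (j + b) $ (i + a))"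
  shows "convergent2 G"
proof -
  obtain C R where F: "C \<ge> 0" "R > 0" "\<And>i j. norm (F $ j $ i) \<le> C * R ^ (i + j)"
    using assms(1) unfolding convergent2_iff_bound by blast
  have "norm (G $ j $ i) \<le> (C * R ^ (a + b)) * (2 * R) ^ (i + j)" for i j
  proof -
    have "norm (G $ j $ i) \<le> real (Suc (i + j)) * (C * R ^ ((i + a) + (j + b)))"
      using F(3)[of "j + b" "i + a"]
      by (intro order.trans[OF assms(2)] mult_left_mono) (auto simp: add_ac)
    also have "\<dots> \<le> 2 ^ (i + j) * (C * R ^ ((i + a) + (j + b)))"
    proof (intro mult_right_mono)
      have "Suc (i + j) \<le> 2 ^ (i + j)" by (rule Suc_leI[OF less_exp])
      then show "real (Suc (i + j)) \<le> 2 ^ (i + j)"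
        by (metis of_nat_le_iff of_nat_power of_nat_numeral)
    qed (use F in auto)
    also have "\<dots> = (C * R ^ (a + b)) * (2 * R) ^ (i + j)"
      by (simp add: power_add power_mult_distrib mult_ac)
    finally show ?thesis .
  qed
  then show ?thesis unfolding convergent2_iff_bound using F
    by (intro exI[of _ "C * R ^ (a + b)"] exI[of _ "2 * R"]) auto
qed

typedef cps2 = "{F. convergent2 F}"
  morphisms fps_of_cps2 Abs_cps2
  using convergent2_const[of 0] by blast

setup_lifting type_definition_cps2

instantiation cps2 :: idom
begin

lift_definition zero_cps2 :: cps2 is 0
  using convergent2_const[of 0] by simp
lift_definition one_cps2 :: cps2 is 1
  using convergent2_const[of 1] by simp
lift_definition plus_cps2 :: "cps2 \<Rightarrow> cps2 \<Rightarrow> cps2" is "(+)"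
  by (rule convergent2_add)
lift_definition uminus_cps2 :: "cps2 \<Rightarrow> cps2" is uminus
  by (rule convergent2_uminus)
lift_definition minus_cps2 :: "cps2 \<Rightarrow> cps2 \<Rightarrow> cps2" is "(-)"
  unfolding diff_conv_add_uminus by (intro convergent2_add convergent2_uminus)
lift_definition times_cps2 :: "cps2 \<Rightarrow> cps2 \<Rightarrow> cps2" is "(*)"
  by (rule convergent2_mult)

instance
  by standard (transfer; simp add: algebra_simps)+

end

definition cps2_coeff :: "cps2 \<Rightarrow> nat \<Rightarrow> nat \<Rightarrow> complex" where
  "cps2_coeff f i j = fps_of_cps2 f $ j $ i"

lift_definition cps2_const :: "complex \<Rightarrow> cps2" is "\<lambda>c. fps_const (fps_const c)"
  by (rule convergent2_const)

lift_definition pd1 :: "cps2 \<Rightarrow> cps2" is "\<lambda>F. Abs_fps (\<lambda>j. fps_deriv (F $ j))"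
  by (erule convergent2_shift[where a = 1 and b = 0])
     (auto simp: norm_mult simp flip: of_nat_Suc intro!: mult_right_mono)

lift_definition pd2 :: "cps2 \<Rightarrow> cps2" is fps_deriv
proof (erule convergent2_shift[where a = 0 and b = 1])
  fix F :: "complex fps fps" and i j
  have "(of_nat n * G) $ i = of_nat n * G $ i" for n and G :: "complex fps"
    by (simp flip: fps_of_nat)
  then have "fps_deriv F $ j $ i = of_nat (j + 1) * F $ (j + 1) $ i"
    by (simp only: fps_deriv_nth)
  then show "norm (fps_deriv F $ j $ i) \<le> real (Suc (i + j)) * norm (F $ (j + 1) $ (i + 0))"
    by (simp add: norm_mult mult_right_mono del: of_nat_add of_nat_Suc)
qed

lemma pd1_coeff: "cps2_coeff (pd1 f) i j = of_nat (Suc i) * cps2_coeff f (Suc i) j"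
  unfolding cps2_coeff_def by transfer simp

lemma pd2_coeff: "cps2_coeff (pd2 f) i j = of_nat (Suc j) * cps2_coeff f i (Suc j)"
proof -
  have "(of_nat n * G) $ i = of_nat n * G $ i" for n and G :: "complex fps"
    by (simp flip: fps_of_nat)
  then show ?thesis
    unfolding cps2_coeff_def by transfer (simp only: fps_deriv_nth Suc_eq_plus1)
qed

lemma cps2_eq_iff: "f = g \<longleftrightarrow> (\<forall>i j. cps2_coeff f i j = cps2_coeff g i j)"
  unfolding cps2_coeff_def by transfer (auto simp: fps_eq_iff)

lemma pd_add: "pd1 (f + g) = pd1 f + pd1 g" "pd2 (f + g) = pd2 f + pd2 g"
  by (transfer; simp add: fps_eq_iff ring_distribs)+

lemma pd_mult: "pd1 (f * g) = f * pd1 g + pd1 f * g" "pd2 (f * g) = f * pd2 g + pd2 f * g"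
proof -
  show "pd1 (f * g) = f * pd1 g + pd1 f * g"
  proof (transfer, rule fps_ext)
    fix F G :: "complex fps fps" and n
    have "fps_deriv ((F * G) $ n) = (\<Sum>i=0..n. fps_deriv (F $ i * G $ (n - i)))"
      by (simp only: fps_mult_nth fps_deriv_sum)
    also have "\<dots> = (\<Sum>i=0..n. F $ i * fps_deriv (G $ (n - i))) +
                      (\<Sum>i=0..n. fps_deriv (F $ i) * G $ (n - i))"
      by (simp only: fps_deriv_mult sum.distrib)
    finally show "Abs_fps (\<lambda>j. fps_deriv ((F * G) $ j)) $ n =
        (F * Abs_fps (\<lambda>j. fps_deriv (G $ j)) + Abs_fps (\<lambda>j. fps_deriv (F $ j)) * G) $ n"
      by (simp add: fps_mult_nth)
  qed
  show "pd2 (f * g) = f * pd2 g + pd2 f * g"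
    by transfer (rule fps_deriv_mult)
qed

definition cps2_mult :: "cps2 \<Rightarrow> nat" where
  "cps2_mult f = (LEAST n. \<exists>i j. i + j = n \<and> cps2_coeff f i j \<noteq> 0)"

definition plane_branch :: "cps2 \<Rightarrow> bool" where
  "plane_branch f \<longleftrightarrow> irreducible f \<and> cps2_mult f > 1"

section \<open>Parameterizations and values\<close>

type_synonym curve = "complex fps \<times> complex fps"

text \<open>
  \<open>cps2_comp h \<gamma>\<close> is \<open>h(\<gamma>\<^sub>1(T), \<gamma>\<^sub>2(T))\<close> for \<open>\<gamma>\<close> with zero constant terms; then \<open>\<gamma>\<^sub>1 ^ i * \<gamma>\<^sub>2 ^ j\<close>
  has order at least \<open>i + j\<close>, so the truncated sum is the full one.
\<close>

definition cps2_comp :: "cps2 \<Rightarrow> curve \<Rightarrow> complex fps" where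
  "cps2_comp h \<gamma> =
     Abs_fps (\<lambda>n. \<Sum>i\<le>n. \<Sum>j\<le>n. cps2_coeff h i j * (fst \<gamma> ^ i * snd \<gamma> ^ j) $ n)"

definition coordinate_change :: "cps2 \<Rightarrow> cps2 \<Rightarrow> bool" where
  "coordinate_change \<Phi>1 \<Phi>2 \<longleftrightarrow>
     cps2_coeff \<Phi>1 0 0 = 0 \<and> cps2_coeff \<Phi>2 0 0 = 0 \<and>
     cps2_coeff \<Phi>1 1 0 * cps2_coeff \<Phi>2 0 1 - cps2_coeff \<Phi>1 0 1 * cps2_coeff \<Phi>2 1 0 \<noteq> 0"

definition normal_param :: "nat \<Rightarrow> nat \<Rightarrow> curve \<Rightarrow> bool" where
  "normal_param n m \<phi> \<longleftrightarrow>
     1 < n \<and> n < m \<and> \<not> n dvd m \<and>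
     fst \<phi> = fps_X ^ n \<and>
     subdegree (snd \<phi>) = m \<and> snd \<phi> $ m = 1 \<and> fps_conv_radius (snd \<phi>) > 0 \<and>
     Gcd (insert n {i. snd \<phi> $ i \<noteq> 0}) = 1"

text \<open>
  Parameterizations of \<open>f = 0\<close> that become primitive and of the form
  \<open>(T ^ n, T ^ m + \<dots>)\<close> with \<open>n = mult f\<close> after an analytic change of coordinates;
  the original coordinates are expressed by \<open>(\<Phi>\<^sub>1, \<Phi>\<^sub>2)\<close> in terms of the new ones.
\<close>

definition branch_param :: "cps2 \<Rightarrow> curve \<Rightarrow> bool" where
  "branch_param f \<gamma> \<longleftrightarrow>
     (\<exists>\<Phi>1 \<Phi>2 m \<phi>. coordinate_change \<Phi>1 \<Phi>2 \<and> normal_param (cps2_mult f) m \<phi> \<and>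
        \<gamma> = (cps2_comp \<Phi>1 \<phi>, cps2_comp \<Phi>2 \<phi>)) \<and>
     cps2_comp f \<gamma> = 0"

text \<open>
  The values and value sets below depend on \<open>f\<close> only, since any two parameterizations
  satisfying \<open>branch_param f\<close> differ by an invertible change of the parameter.
\<close>

definition value_semigroup :: "cps2 \<Rightarrow> curve \<Rightarrow> nat set" where
  "value_semigroup f \<gamma> = {subdegree (cps2_comp h \<gamma>) |h. \<not> f dvd h}"

text \<open>The pair \<open>(A, B)\<close> stands for the form \<open>A dx\<^sub>1 + B dx\<^sub>2\<close>.\<close>

type_synonym form = "cps2 \<times> cps2"

definition kaehler_rel :: "cps2 \<Rightarrow> (form \<times> form) set" where
  "kaehler_rel f = {((A, B), (A', B')) |A B A' B'.
     \<exists>a b g. A - A' = f * a + g * pd1 f \<and> B - B' = f * b + g * pd2 f}"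

definition kaehler_forms :: "cps2 \<Rightarrow> form set set" where
  "kaehler_forms f = UNIV // kaehler_rel f"

definition form_pullback :: "curve \<Rightarrow> form \<Rightarrow> complex fps" where
  "form_pullback \<gamma> \<omega> = cps2_comp (fst \<omega>) \<gamma> * fps_deriv (fst \<gamma>)
                     + cps2_comp (snd \<omega>) \<gamma> * fps_deriv (snd \<gamma>)"

text \<open>
  For a parameterization of \<open>f = 0\<close> the pullback does not depend on the representative
  \<open>\<omega>\<close> of the class \<open>W\<close>.
\<close>

definition form_values :: "cps2 \<Rightarrow> curve \<Rightarrow> nat set" where
  "form_values f \<gamma> = {subdegree (form_pullback \<gamma> \<omega>) + 1 |W \<omega>.
     W \<in> kaehler_forms f \<and> \<omega> \<in> W \<and> form_pullback \<gamma> \<omega> \<noteq> 0}"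

inductive_set submonoid_gen :: "nat set \<Rightarrow> nat set" for S where
  zero: "0 \<in> submonoid_gen S"
| gen: "x \<in> S \<Longrightarrow> x \<in> submonoid_gen S"
| add: "x \<in> submonoid_gen S \<Longrightarrow> y \<in> submonoid_gen S \<Longrightarrow> x + y \<in> submonoid_gen S"

definition minimally_generated_by :: "nat set \<Rightarrow> nat \<Rightarrow> nat \<Rightarrow> bool" where
  "minimally_generated_by \<Gamma> v0 v1 \<longleftrightarrow>
     1 < v0 \<and> v0 < v1 \<and> coprime v0 v1 \<and>
     \<Gamma> = submonoid_gen {v0, v1} \<and> (\<forall>S. S \<subset> {v0, v1} \<longrightarrow> submonoid_gen S \<noteq> \<Gamma>)"

section \<open>The Bernstein polynomial\<close>

text \<open>The extension of a derivation \<open>d\<close> to the field of fractions (quotient rule).\<close>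

definition fract_deriv :: "('a::idom \<Rightarrow> 'a) \<Rightarrow> 'a fract \<Rightarrow> 'a fract" where
  "fract_deriv d q =
     (THE r. \<forall>a b. b \<noteq> 0 \<longrightarrow> q = Fract a b \<longrightarrow> r = Fract (d a * b - a * d b) (b * b))"

lemma fract_deriv_Fract:
  fixes d :: "'a::idom \<Rightarrow> 'a"
  assumes d: "\<And>x y. d (x * y) = x * d y + d x * y" and b: "b \<noteq> 0"
  shows "fract_deriv d (Fract a b) = Fract (d a * b - a * d b) (b * b)"
proof -
  have "Fract (d a * b - a * d b) (b * b) = Fract (d a' * b' - a' * d b') (b' * b')"
    if b': "b' \<noteq> 0" and eq: "Fract a b = Fract a' b'" for a' b'
  proof -
    have e: "a * b' = a' * b" using eq b b' by (simp add: eq_fract)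
    have "d (a * b') = d (a' * b)" using e by simp
    then have e': "a * d b' + d a * b' = a' * d b + d a' * b" by (simp add: d)
    have "(d a * b - a * d b) * (b' * b') - (d a' * b' - a' * d b') * (b * b)
        = b * b' * ((a * d b' + d a * b') - (a' * d b + d a' * b))
          - (b' * d b + b * d b') * (a * b' - a' * b)"
      by (simp add: algebra_simps)
    also have "\<dots> = 0" using e e' by simp
    finally show ?thesis using b b' by (simp add: eq_fract)
  qed
  then have "\<forall>a' b'. b' \<noteq> 0 \<longrightarrow> Fract a b = Fract a' b' \<longrightarrow>
      Fract (d a * b - a * d b) (b * b) = Fract (d a' * b' - a' * d b') (b' * b')"
    by blast
  then show ?thesis unfolding fract_deriv_def
    by (rule the_equality) (use b in blast)
qed

text \<open>
  A polynomial \<open>u\<close> in \<open>s\<close> over the field of fractions of \<open>\<O>\<^sub>2\<close> stands for the element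
  \<open>u(s) f\<^sup>s\<close>; the module \<open>\<O>\<^sub>2[1/f, s] f\<^sup>s\<close> is thus embedded in a free module of rank one over
  a larger ring. On it \<open>s\<close> and \<open>\<O>\<^sub>2\<close> act by multiplication, and a partial derivative \<open>d\<close> by
  \<open>d (u f\<^sup>s) = (d u + s u (d f) / f) f\<^sup>s\<close>.
\<close>

definition twisted_deriv :: "(cps2 \<Rightarrow> cps2) \<Rightarrow> cps2 \<Rightarrow> cps2 fract poly \<Rightarrow> cps2 fract poly" where
  "twisted_deriv d f u = map_poly (fract_deriv d) u + [:0, to_fract (d f) / to_fract f:] * u"

lemma to_fract_hom: "to_fract 0 = 0" "to_fract 1 = 1" "to_fract (a + b) = to_fract a + to_fract b" "to_fract (a * b) = to_fract a * to_fract b"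
  by (auto simp: to_fract_def Zero_fract_def One_fract_def)

lemma map_poly_add_hom:
  assumes "h 0 = 0" "\<And>x y. h (x + y) = h x + h y"
  shows "map_poly h (p + q) = map_poly h p + map_poly h q"
  by (rule poly_eqI) (simp add: coeff_map_poly assms)

lemma map_poly_mult_hom:
  fixes h :: "'a::comm_ring_1 \<Rightarrow> 'b::comm_ring_1"
  assumes "h 0 = 0" "\<And>x y. h (x + y) = h x + h y" "\<And>x y. h (x * y) = h x * h y"
  shows "map_poly h (p * q) = map_poly h p * map_poly h q"
proof (rule poly_eqI)
  fix n
  have s: "h (sum g A) = (\<Sum>x\<in>A. h (g x))" for g and A :: "nat set"
    by (induction A rule: infinite_finite_induct) (auto simp: assms)
  show "coeff (map_poly h (p * q)) n = coeff (map_poly h p * map_poly h q) n"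
    by (simp add: coeff_map_poly assms coeff_mult s)
qed

lemma cps2_const_hom: "cps2_const 0 = 0" "cps2_const 1 = 1" "cps2_const (a + b) = cps2_const a + cps2_const b" "cps2_const (a * b) = cps2_const a * cps2_const b"
  by (transfer; simp)+

lemma twisted_deriv_f:
  assumes "f \<noteq> 0" "d = pd1 \<or> d = pd2"
  shows "twisted_deriv d f [:to_fract f:] = [:to_fract (d f), to_fract (d f):]"
proof -
  have d: "d (x * y) = x * d y + d x * y" for x y using assms(2) pd_mult by auto
  have "d 1 = 0" using d[of 1 1] by (simp only: mult_1_left mult_1_right add_cancel_right_right)
  then have "fract_deriv d (to_fract f) = to_fract (d f)"
    using fract_deriv_Fract[of d 1 f] d by (simp add: to_fract_def)
  moreover have "to_fract f \<noteq> 0" using assms by (simp add: to_fract_def Zero_fract_def eq_fract)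
  moreover have "fract_deriv d 0 = 0"
    using fract_deriv_Fract[of d 1 0] d \<open>d 1 = 0\<close> d[of 0 0]
    by (simp add: Zero_fract_def eq_fract)
  moreover have "map_poly (fract_deriv d) [:to_fract f:] = [:fract_deriv d (to_fract f):]"
    using \<open>fract_deriv d 0 = 0\<close>
    by (intro poly_eqI) (simp add: coeff_map_poly coeff_pCons split: nat.split)
  ultimately show ?thesis by (simp add: twisted_deriv_def)
qed

text \<open>
  An element \<open>\<Sum> c\<^sub>a\<^sub>b(s) \<partial>\<^sub>1\<^sup>a \<partial>\<^sub>2\<^sup>b\<close> of \<open>\<D>[s]\<close> in normal form is given by its finitely supported
  family of coefficients \<open>c\<^sub>a\<^sub>b\<close> in \<open>\<O>\<^sub>2[s]\<close>. The (commutative) product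
  of \<open>poly_mapping\<close> is not the composition of operators and is not used.
\<close>

type_synonym diffop = "(nat \<times> nat) \<Rightarrow>\<^sub>0 cps2 poly"

definition diffop_act :: "cps2 \<Rightarrow> diffop \<Rightarrow> cps2 fract poly \<Rightarrow> cps2 fract poly" where
  "diffop_act f P u = (\<Sum>(a, b)\<in>Poly_Mapping.keys P. map_poly to_fract (Poly_Mapping.lookup P (a, b)) *
     (twisted_deriv pd1 f ^^ a) ((twisted_deriv pd2 f ^^ b) u))"

lemma diffop_act_superset:
  assumes "finite S" "Poly_Mapping.keys P \<subseteq> S"
  shows "diffop_act f P u = (\<Sum>(a, b)\<in>S. map_poly to_fract (Poly_Mapping.lookup P (a, b)) *
     (twisted_deriv pd1 f ^^ a) ((twisted_deriv pd2 f ^^ b) u))"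
  unfolding diffop_act_def
  by (rule sum.mono_neutral_left) (use assms in \<open>auto simp: in_keys_iff\<close>)

lemma diffop_act_add: "diffop_act f (P + Q) u = diffop_act f P u + diffop_act f Q u"
proof -
  let ?S = "Poly_Mapping.keys P \<union> Poly_Mapping.keys Q"
  have "Poly_Mapping.keys (P + Q) \<subseteq> ?S" by (rule Poly_Mapping.keys_add)
  then show ?thesis
    by (simp add: diffop_act_superset[of ?S] sum.distrib[symmetric] lookup_add
        map_poly_add_hom to_fract_hom ring_distribs case_prod_unfold)
qed

lemma diffop_act_smult:
  "diffop_act f (Poly_Mapping.map (\<lambda>x. c * x) P) u = map_poly to_fract c * diffop_act f P u"
proof -
  have "Poly_Mapping.keys (Poly_Mapping.map (\<lambda>x. c * x) P) \<subseteq> Poly_Mapping.keys P"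
    by (auto simp: in_keys_iff Poly_Mapping.map.rep_eq when_def)
  then show ?thesis
    by (simp add: diffop_act_superset[of "Poly_Mapping.keys P"] sum_distrib_left
        map_poly_mult_hom to_fract_hom Poly_Mapping.map.rep_eq when_def case_prod_unfold mult.assoc)
       (auto intro!: sum.cong simp: in_keys_iff)
qed

text \<open>\<open>[:to_fract f:]\<close> represents \<open>f\<^sup>s\<^sup>+\<^sup>1 = f \<cdot> f\<^sup>s\<close>.\<close>

definition bernstein_ideal :: "cps2 \<Rightarrow> complex poly set" where
  "bernstein_ideal f =
     {b. \<exists>P. diffop_act f P [:to_fract f:] = map_poly (\<lambda>c. to_fract (cps2_const c)) b}"

lemma bernstein_ideal_add:
  assumes "p \<in> bernstein_ideal f" "q \<in> bernstein_ideal f"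
  shows "p + q \<in> bernstein_ideal f"
proof -
  have h: "map_poly (\<lambda>c. to_fract (cps2_const c)) (p + q) =
      map_poly (\<lambda>c. to_fract (cps2_const c)) p + map_poly (\<lambda>c. to_fract (cps2_const c)) q"
    by (rule map_poly_add_hom) (auto simp: to_fract_hom cps2_const_hom)
  from assms show ?thesis
    unfolding bernstein_ideal_def h mem_Collect_eq by (metis diffop_act_add)
qed

lemma bernstein_ideal_mult:
  assumes "p \<in> bernstein_ideal f"
  shows "c * p \<in> bernstein_ideal f"
proof -
  obtain P where P: "diffop_act f P [:to_fract f:] = map_poly (\<lambda>c. to_fract (cps2_const c)) p"
    using assms by (auto simp: bernstein_ideal_def)
  have m: "map_poly to_fract (map_poly cps2_const c) = map_poly (\<lambda>c. to_fract (cps2_const c)) c"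
    by (subst map_poly_map_poly) (auto simp: to_fract_hom cps2_const_hom o_def)
  have "diffop_act f (Poly_Mapping.map (\<lambda>x. map_poly cps2_const c * x) P) [:to_fract f:]
      = map_poly (\<lambda>c. to_fract (cps2_const c)) (c * p)"
    unfolding diffop_act_smult P m
    by (rule map_poly_mult_hom[symmetric]) (auto simp: to_fract_hom cps2_const_hom)
  then show ?thesis by (auto simp: bernstein_ideal_def)
qed

lemma bernstein_ideal_zero: "0 \<in> bernstein_ideal f"
  by (auto simp: bernstein_ideal_def diffop_act_def intro!: exI[of _ 0])

lemma bernstein_poly_unique:
  "\<exists>!b. (b = 0 \<or> lead_coeff b = 1) \<and> bernstein_ideal f = {q. b dvd q}"
proof -
  have ex: "\<exists>b. (b = 0 \<or> lead_coeff b = 1) \<and> bernstein_ideal f = {q. b dvd q}"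
  proof (cases "bernstein_ideal f = {0}")
    case True
    then show ?thesis by (intro exI[of _ 0]) auto
  next
    case False
    then obtain p where "p \<in> bernstein_ideal f" "p \<noteq> 0"
      using bernstein_ideal_zero[of f] by auto
    define g where "g = arg_min degree (\<lambda>p. p \<in> bernstein_ideal f \<and> p \<noteq> 0)"
    have g: "g \<in> bernstein_ideal f" "g \<noteq> 0"
      and min: "\<And>q. q \<in> bernstein_ideal f \<Longrightarrow> q \<noteq> 0 \<Longrightarrow> degree g \<le> degree q"
      using arg_min_nat_lemma[of "\<lambda>p. p \<in> bernstein_ideal f \<and> p \<noteq> 0" p degree]
        \<open>p \<in> bernstein_ideal f\<close> \<open>p \<noteq> 0\<close> unfolding g_def by auto
    have "g dvd q" if q: "q \<in> bernstein_ideal f" for q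
    proof -
      have "q mod g = q + (- (q div g)) * g" by (simp add: minus_div_mult_eq_mod[symmetric])
      then have "q mod g \<in> bernstein_ideal f"
        using bernstein_ideal_add[OF q bernstein_ideal_mult[OF g(1)]] by metis
      then have "q mod g = 0"
        using min[of "q mod g"] degree_mod_less[of g q] g(2) by force
      then show ?thesis by (simp add: mod_eq_0_iff_dvd)
    qed
    then have "bernstein_ideal f = {q. g dvd q}"
      using bernstein_ideal_mult[OF g(1)] by (auto elim!: dvdE simp: mult.commute)
    then show ?thesis using g(2)
      by (intro exI[of _ "smult (inverse (lead_coeff g)) g"]) (auto simp: smult_dvd_iff)
  qed
  moreover have "b = b'" if "(b = 0 \<or> lead_coeff b = 1) \<and> bernstein_ideal f = {q. b dvd q}"
     "(b' = 0 \<or> lead_coeff b' = 1) \<and> bernstein_ideal f = {q. b' dvd q}" for b b' :: "complex poly"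
  proof -
    have eq: "{q. b dvd q} = {q. b' dvd q}" using that by (metis (no_types))
    have "b dvd b'" "b' dvd b"
      using eqset_imp_iff[OF eq, of b] eqset_imp_iff[OF eq, of b'] by simp_all
    then obtain k l where kl: "b' = b * k" "b = b' * l" unfolding dvd_def by blast
    show ?thesis
    proof (cases "b = 0")
      case False
      then have b': "b' \<noteq> 0" using kl(2) by (metis mult_zero_left)
      have k: "k \<noteq> 0" "l \<noteq> 0" using kl(1) kl(2) False b' by (metis mult_zero_right)+
      have "degree b' = degree b + degree k"
        unfolding kl(1) using False k by (simp add: degree_mult_eq)
      moreover have "degree b = degree b' + degree l"
        by (subst kl(2)) (use b' k in \<open>simp add: degree_mult_eq\<close>)
      ultimately have "degree k = 0" by linarith
      then obtain c where "k = [:c:]" by (metis degree_eq_zeroE)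
      moreover have "lead_coeff b = 1" "lead_coeff b' = 1" using that False b' by blast+
      ultimately have "c = 1" using kl(1) by (simp split: if_splits)
      with \<open>k = [:c:]\<close> kl(1) show ?thesis by simp
    qed (use kl(1) in \<open>metis mult_zero_left\<close>)
  qed
  ultimately show ?thesis by (intro ex_ex1I)
qed

text \<open>
  The alternative \<open>b = 0\<close> only gives the generator of a zero ideal, so that the description is
  total; by Bernstein's theorem the ideal is not zero.
\<close>

definition bernstein_poly :: "cps2 \<Rightarrow> complex poly" where
  "bernstein_poly f =
     (THE b. (b = 0 \<or> lead_coeff b = 1) \<and> bernstein_ideal f = {q. b dvd q})"

definition reduced_bernstein_poly :: "cps2 \<Rightarrow> complex poly" where
  "reduced_bernstein_poly f = bernstein_poly f div [:1, 1:]"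

definition bernstein_roots :: "cps2 \<Rightarrow> complex set" where
  "bernstein_roots f = {z. poly (reduced_bernstein_poly f) z = 0}"

end

theory Submission
  imports Defs
begin

text \<open>
  Write \<open>n = v0\<close> and \<open>m = v1\<close>, let \<open>l\<close> be a value of a differential form outside the semigroup,
  and put \<open>\<sigma> = - l / (n m)\<close>. The root is detected by a linear functional on \<open>\<O>\<^sub>2[1/f] f\<^sup>\<sigma>\<close> that
  annihilates all partial derivatives, that is, by a period of the local system of \<open>f\<^sup>\<sigma>\<close> on the
  rupture divisor of the minimal resolution. Everything is done with formal power series.

  \<^emph>\<open>The functional.\<close> In coordinates \<open>x\<close>, \<open>y\<close> adapted to the branch the initial form of \<open>f\<close> for the
  weights \<open>(n, m)\<close> is \<open>c (y\<^sup>n - x\<^sup>m)\<close>. The substitution \<open>x = t\<^sup>n\<close>, \<open>y = z t\<^sup>m\<close> turns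
  \<open>h f\<^sup>\<sigma>\<^sup>-\<^sup>k dx\<^sub>1 dx\<^sub>2\<close> into a power series in \<open>t\<close>, multiplied by \<open>t\<close> to the exponent \<open>- l - n m k\<close>,
  by \<open>dt / t\<close> and by \<open>dz\<close>, whose coefficients are sums of terms \<open>p(z) (c (z\<^sup>n - 1))\<^sup>\<sigma>\<^sup>-\<^sup>k\<^sup>-\<^sup>r\<close> with polynomials \<open>p\<close>. Since
  \<open>n m \<sigma>\<close> is an integer, the residue at \<open>t = 0\<close> makes sense. Integrating it over \<open>z\<close> from \<open>0\<close> to \<open>1\<close>
  gives a number \<open>\<Lambda>\<^sub>k(h)\<close>; the integrals are Beta integrals, regularised at \<open>z = 1\<close> by the Gamma
  function (\<open>period\<close>, \<open>res\<close>). Terms \<open>z\<^sup>j dz\<close> with \<open>n\<close> dividing \<open>j + 1\<close> are sent to \<open>0\<close>, and this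
  removes the boundary terms at \<open>z = 0\<close>. The functional satisfies \<open>\<Lambda>\<^sub>k\<^sub>+\<^sub>1(f h) = \<Lambda>\<^sub>k(h)\<close>
  (\<open>res_mult_F\<close>), it kills derivatives (\<open>res_stokes\<close>), and \<open>\<Lambda>\<^sub>0(f h) = 0\<close> because \<open>l < n m\<close> leaves
  only positive powers of \<open>t\<close>.

  \<^emph>\<open>Consequence for \<open>b\<close>.\<close> Let \<open>P f\<^sup>s\<^sup>+\<^sup>1 = b(s) f\<^sup>s\<close>. Specialising at \<open>s = \<sigma>\<close>, multiplying by \<open>h\<close> and
  integrating by parts gives \<open>b(\<sigma>) \<Lambda>\<^sub>0(h) = \<Lambda>\<^sub>0(f Q h)\<close> for the adjoint \<open>Q\<close> of \<open>P\<close>, hence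
  \<open>b(\<sigma>) \<Lambda>\<^sub>0 = 0\<close> (\<open>specialised_ideal\<close> and \<open>bernstein_root\<close>). So it suffices that \<open>\<Lambda>\<^sub>0 \<noteq> 0\<close>.

  \<^emph>\<open>Nonvanishing.\<close> Let \<open>\<omega> = A dx\<^sub>1 + B dx\<^sub>2\<close> have value \<open>l\<close> and let \<open>df \<and> \<omega> = g dx\<^sub>1 \<and> dx\<^sub>2\<close>. If
  \<open>\<Lambda>\<^sub>0 = 0\<close>, then \<open>\<Lambda>\<^sub>1(f h) = 0\<close> for all \<open>h\<close>, and Stokes' formula for \<open>d(f\<^sup>\<sigma> \<omega>)\<close> gives \<open>\<Lambda>\<^sub>1(g) = 0\<close>.
  On the other hand \<open>g\<close> has value \<open>l + n m - n - m\<close> along the branch (\<open>value_wedge\<close>). As \<open>l\<close> is a gap,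
  this number is \<open>n (a - 1) + m (b - 1)\<close> with \<open>0 < a < m\<close> and \<open>0 < b < n\<close>, so modulo a multiple of \<open>f\<close>
  the initial form of \<open>g\<close> is a nonzero multiple of \<open>x\<^sup>a\<^sup>-\<^sup>1 y\<^sup>b\<^sup>-\<^sup>1\<close> (\<open>reduce\<close>). Hence \<open>\<Lambda>\<^sub>1(g)\<close> is a nonzero
  multiple of the Beta integral of \<open>z\<^sup>b\<^sup>-\<^sup>1 (1 - z\<^sup>n)\<^sup>\<sigma>\<^sup>-\<^sup>1\<close>, which does not vanish since none of \<open>b / n\<close>,
  \<open>\<sigma>\<close> and \<open>b / n + \<sigma> = 1 - a / m\<close> is an integer. This is a contradiction.

  The factor \<open>s + 1\<close> can be split off because \<open>f\<close> is not a unit (\<open>bernstein_root_minus_1\<close>), and it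
  does not account for the root \<open>\<sigma>\<close> because \<open>l \<noteq> n m\<close>.
\<close>

section \<open>Evaluation of formal power series\<close>

definition fps_map :: "('a::zero \<Rightarrow> 'b::zero) \<Rightarrow> 'a fps \<Rightarrow> 'b fps" where
  "fps_map e A = Abs_fps (\<lambda>k. e (A $ k))"

lemma fps_map_nth [simp]: "fps_map e A $ k = e (A $ k)"
  by (simp add: fps_map_def)

text \<open>
  The value at \<open>G\<close> of a series with coefficients in the ring that contains \<open>G\<close>. For \<open>G\<close> without
  constant term the sum converges \<open>t\<close>-adically, and the coefficient of \<open>t\<^sup>k\<close> only sees \<open>i \<le> k\<close>.
\<close>

definition fps_eval :: "'a::comm_ring_1 fps \<Rightarrow> 'a fps fps \<Rightarrow> 'a fps" where
  "fps_eval G A = Abs_fps (\<lambda>k. \<Sum>i\<le>k. (A $ i * G ^ i) $ k)"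

text \<open>
  Homomorphisms and derivations are predicates here since several maps between the same
  rings are used side by side.
\<close>

definition ring_homo :: "('a::comm_ring_1 \<Rightarrow> 'b::comm_ring_1) \<Rightarrow> bool" where
  "ring_homo e \<longleftrightarrow> e 1 = 1 \<and> (\<forall>x y. e (x + y) = e x + e y) \<and> (\<forall>x y. e (x * y) = e x * e y)"

definition derivation :: "('a::comm_ring_1 \<Rightarrow> 'a) \<Rightarrow> bool" where
  "derivation d \<longleftrightarrow> (\<forall>x y. d (x + y) = d x + d y) \<and> (\<forall>x y. d (x * y) = d x * y + x * d y)"

lemma ring_homoD:
  assumes "ring_homo e"
  shows "e 1 = 1" "e (x + y) = e x + e y" "e (x * y) = e x * e y" "e 0 = 0"
    "e (- x) = - e x" "e (x - y) = e x - e y" "e (x ^ n) = e x ^ n" "e (sum g S) = (\<Sum>i\<in>S. e (g i))"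
proof -
  show *: "e 1 = 1" "e (x + y) = e x + e y" "e (x * y) = e x * e y" for x y
    using assms by (auto simp: ring_homo_def)
  show z: "e 0 = 0" using *(2)[of 0 0] by (simp del: *)
  show m: "e (- x) = - e x" for x using *(2)[of x "- x"] z by (simp add: eq_neg_iff_add_eq_0 add.commute)
  show "e (x - y) = e x - e y" using *(2)[of x "- y"] m by simp
  show "e (x ^ n) = e x ^ n" by (induction n) (auto simp: *)
  show "e (sum g S) = (\<Sum>i\<in>S. e (g i))"
    by (induction S rule: infinite_finite_induct) (auto simp: * z)
qed

lemma derivationD:
  assumes "derivation d"
  shows "d (x + y) = d x + d y" "d (x * y) = d x * y + x * d y" "d 0 = 0" "d 1 = 0"
    "d (- x) = - d x" "d (x - y) = d x - d y" "d (sum g S) = (\<Sum>i\<in>S. d (g i))"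
    "d (x ^ Suc n) = of_nat (Suc n) * x ^ n * d x"
proof -
  show *: "d (x + y) = d x + d y" "d (x * y) = d x * y + x * d y" for x y
    using assms by (auto simp: derivation_def)
  show z: "d 0 = 0" using *(1)[of 0 0] by (simp del: *)
  show "d 1 = 0" using *(2)[of 1 1] by (simp del: *)
  show m: "d (- x) = - d x" for x using *(1)[of x "- x"] z by (simp add: eq_neg_iff_add_eq_0 add.commute)
  show "d (x - y) = d x - d y" using *(1)[of x "- y"] m by simp
  show "d (sum g S) = (\<Sum>i\<in>S. d (g i))"
    by (induction S rule: infinite_finite_induct) (auto simp: * z)
  show "d (x ^ Suc n) = of_nat (Suc n) * x ^ n * d x"
    by (induction n) (auto simp: * algebra_simps)
qed

lemma ring_homo_comp: "ring_homo e \<Longrightarrow> ring_homo e' \<Longrightarrow> ring_homo (\<lambda>x. e (e' x))"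
  by (auto simp: ring_homo_def)

lemma ring_homo_fps_map:
  assumes "ring_homo e" shows "ring_homo (fps_map e)"
proof -
  note e = ring_homoD[OF assms]
  have "fps_map e 1 = 1" by (rule fps_ext) (simp add: e)
  moreover have "fps_map e (A + B) = fps_map e A + fps_map e B" for A B
    by (rule fps_ext) (simp add: e)
  moreover have "fps_map e (A * B) = fps_map e A * fps_map e B" for A B
    by (rule fps_ext) (simp add: e fps_mult_nth)
  ultimately show ?thesis by (auto simp: ring_homo_def)
qed

lemma derivation_fps_map:
  assumes "derivation d" shows "derivation (fps_map d)"
proof -
  note d = derivationD[OF assms]
  have "fps_map d (A + B) = fps_map d A + fps_map d B" for A B
    by (rule fps_ext) (simp add: d)
  moreover have "fps_map d (A * B) = fps_map d A * B + A * fps_map d B" for A B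
    by (rule fps_ext) (simp add: d fps_mult_nth sum.distrib)
  ultimately show ?thesis by (auto simp: derivation_def)
qed

lemma mult_nth_cong:
  fixes G :: "'a::comm_ring_1 fps"
  assumes "G $ 0 = 0" "\<And>j. j < k \<Longrightarrow> A $ j = B $ j"
  shows "(G * A) $ k = (G * B) $ k"
  unfolding fps_mult_nth
proof (rule sum.cong)
  fix i assume "i \<in> {0..k}"
  then show "G $ i * A $ (k - i) = G $ i * B $ (k - i)"
    using assms by (cases "i = 0") auto
qed simp

lemma power_nth_eq_0:
  fixes G :: "'a::comm_ring_1 fps"
  assumes "\<And>k. k < d \<Longrightarrow> G $ k = 0" "k < d * i"
  shows "(G ^ i) $ k = 0"
  using assms(2)
proof (induction i arbitrary: k)
  case (Suc i)
  have "G $ j * (G ^ i) $ (k - j) = 0" if "j \<le> k" for j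
  proof (cases "j < d")
    case False
    then have "k - j < d * i" using Suc.prems that by auto
    then show ?thesis using Suc.IH by simp
  qed (use assms in simp)
  then show ?case by (simp add: fps_mult_nth)
qed simp

text \<open>
  Horner's rule. It determines \<open>fps_eval\<close>: as \<open>G\<close> has no constant term, an identity that is
  compatible with this recursion holds modulo every power of the variable. Multiplicativity, the chain
  rule and naturality of \<open>fps_eval\<close> are proved by this principle.
\<close>

lemma fps_eval_unroll:
  fixes G :: "'a::comm_ring_1 fps"
  assumes "G $ 0 = 0"
  shows "fps_eval G A = A $ 0 + G * fps_eval G (fps_shift 1 A)"
proof (rule fps_ext)
  fix k
  have pw: "(B * G ^ i) $ j = 0" if "j < i" for B i j
  proof -
    have "(G ^ i) $ l = 0" if "l \<le> j" for l
      by (rule power_nth_eq_0[of 1]) (use assms \<open>j < i\<close> that in auto)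
    then show ?thesis by (auto simp: fps_mult_nth intro!: sum.neutral)
  qed
  have N: "fps_eval G B $ j = (\<Sum>i\<le>N. B $ i * G ^ i) $ j" if "j \<le> N" for N B j
    unfolding fps_eval_def fps_nth_Abs_fps fps_sum_nth
    by (rule sum.mono_neutral_left) (use that pw in auto)
  have "(G * fps_eval G (fps_shift 1 A)) $ k = (G * (\<Sum>i\<le>k. A $ Suc i * G ^ i)) $ k"
    by (rule mult_nth_cong[OF assms]) (subst N[of _ k], auto)
  also have "\<dots> = (\<Sum>i\<le>k. A $ Suc i * G ^ Suc i) $ k"
    by (simp add: sum_distrib_left mult_ac)
  finally show "fps_eval G A $ k = (A $ 0 + G * fps_eval G (fps_shift 1 A)) $ k"
    by (subst N[of _ "Suc k"], simp, subst sum.atMost_Suc_shift) simp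
qed

lemma fps_eval_add: "fps_eval G (A + B) = fps_eval G A + fps_eval G B"
  by (rule fps_ext) (simp add: fps_eval_def ring_distribs sum.distrib)

lemma fps_eval_const [simp]: "fps_eval G (fps_const a) = a"
proof (rule fps_ext)
  fix k
  have "(fps_const a $ i * G ^ i) $ k = (if i = 0 then a $ k else 0)" for i
    by (cases i) auto
  then show "fps_eval G (fps_const a) $ k = a $ k" by (simp add: fps_eval_def)
qed

lemma fps_split: "A = fps_const (A $ 0) + fps_X * fps_shift 1 (A :: 'a::comm_ring_1 fps)"
  by (rule fps_ext) (simp add: fps_X_mult_nth)

lemma fps_eval_mult:
  fixes G :: "'a::comm_ring_1 fps"
  assumes "G $ 0 = 0"
  shows "fps_eval G (A * B) = fps_eval G A * fps_eval G B"
proof (rule fps_ext)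
  have "\<forall>A B::'a fps fps. \<forall>k<N. fps_eval G (A * B) $ k = (fps_eval G A * fps_eval G B) $ k" for N
  proof (induction N)
    case (Suc N)
    show ?case
    proof (intro allI impI)
      fix A B :: "'a fps fps" and k assume k: "k < Suc N"
      define A' where "A' = fps_shift 1 A"
      define B' where "B' = fps_shift 1 B"
      let ?c = "fps_const (A $ 0)"
      have eA: "fps_eval G A = A $ 0 + G * fps_eval G A'"
        unfolding A'_def by (rule fps_eval_unroll[OF assms])
      have sh: "fps_shift 1 (A * B) = ?c * B' + A' * B"
      proof -
        have "A * B = (?c + fps_X * A') * B" using fps_split[of A] by (simp add: A'_def)
        also have "\<dots> = ?c * B + fps_X * (A' * B)" by (simp add: algebra_simps)
        also have "?c * B = ?c * fps_const (B $ 0) + fps_X * (?c * B')"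
          by (subst fps_split[of B]) (simp add: algebra_simps B'_def del: fps_const_mult)
        finally have "A * B = fps_const (A $ 0 * B $ 0) + fps_X * (?c * B' + A' * B)"
          by (simp add: algebra_simps)
        then show ?thesis
          by (intro fps_ext) (simp only: fps_shift_nth fps_add_nth fps_X_mult_nth, simp)
      qed
      have "fps_eval G (A * B) $ k = (A $ 0 * B $ 0) $ k + (G * fps_eval G (?c * B' + A' * B)) $ k"
        by (subst fps_eval_unroll[OF assms], subst sh) simp
      also have "(G * fps_eval G (?c * B' + A' * B)) $ k
          = (G * (fps_eval G ?c * fps_eval G B' + fps_eval G A' * fps_eval G B)) $ k"
        by (rule mult_nth_cong[OF assms]) (use Suc.IH k in \<open>simp add: fps_eval_add\<close>)
      also have "(A $ 0 * B $ 0) $ k + \<dots> =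
          (A $ 0 * B $ 0 + G * (A $ 0 * fps_eval G B' + fps_eval G A' * fps_eval G B)) $ k" by simp
      also have "A $ 0 * B $ 0 + G * (A $ 0 * fps_eval G B' + fps_eval G A' * fps_eval G B)
          = A $ 0 * (B $ 0 + G * fps_eval G B') + G * fps_eval G A' * fps_eval G B"
        by (simp add: algebra_simps)
      also have "B $ 0 + G * fps_eval G B' = fps_eval G B"
        using fps_eval_unroll[OF assms, of B] by (simp add: B'_def)
      also have "A $ 0 * fps_eval G B + G * fps_eval G A' * fps_eval G B = fps_eval G A * fps_eval G B"
        unfolding eA by (simp add: algebra_simps)
      finally show "fps_eval G (A * B) $ k = (fps_eval G A * fps_eval G B) $ k" .
    qed
  qed simp
  then show "fps_eval G (A * B) $ k = (fps_eval G A * fps_eval G B) $ k" for k by blast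
qed

lemma ring_homo_fps_eval:
  "(G :: 'a::comm_ring_1 fps) $ 0 = 0 \<Longrightarrow> ring_homo (fps_eval G)"
  using fps_eval_const[of G 1] by (auto simp: ring_homo_def fps_eval_add fps_eval_mult simp del: fps_eval_const)

text \<open>
  The total derivative of \<open>\<Sum> A\<^sub>i G\<^sup>i\<close>: the derivation acts on the coefficients and on \<open>G\<close>. The
  condition on \<open>d G\<close> makes the formula compatible with Horner's rule modulo powers of the variable.
\<close>

lemma fps_eval_chain:
  fixes G :: "'a::comm_ring_1 fps"
  assumes "G $ 0 = 0" "d G $ 0 = 0" "derivation d"
  shows "fps_eval G (fps_map d A) + fps_eval G (fps_deriv A) * d G = d (fps_eval G A)"
proof (rule fps_ext)
  note d = derivationD[OF assms(3)]
  have "\<forall>A::'a fps fps. \<forall>k<N. (fps_eval G (fps_map d A) + fps_eval G (fps_deriv A) * d G) $ k = d (fps_eval G A) $ k" for N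
  proof (induction N)
    case (Suc N)
    show ?case
    proof (intro allI impI)
      fix A :: "'a fps fps" and k assume k: "k < Suc N"
      define A' where "A' = fps_shift 1 A"
      have sh: "fps_shift 1 (fps_map d A) = fps_map d A'" unfolding A'_def
        by (rule fps_ext) simp
      have dA: "fps_deriv A = A' + fps_X * fps_deriv A'"
        by (subst fps_split[of A]) (simp add: A'_def)
      have eX: "fps_eval G (fps_X * B) = G * fps_eval G B" for B :: "'a fps fps"
      proof -
        have "fps_shift 1 (fps_X * B) = B" by (rule fps_ext) simp
        then show ?thesis by (subst fps_eval_unroll[OF assms(1)]) simp
      qed
      have "(fps_eval G (fps_map d A) + fps_eval G (fps_deriv A) * d G)
        = d (A $ 0) + G * fps_eval G (fps_map d A') + (fps_eval G A' + G * fps_eval G (fps_deriv A')) * d G"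
        by (subst fps_eval_unroll[OF assms(1)], subst sh) (simp add: dA fps_eval_add eX)
      also have "\<dots> = d (A $ 0) + fps_eval G A' * d G + G * (fps_eval G (fps_map d A') + fps_eval G (fps_deriv A') * d G)"
        by (simp add: algebra_simps)
      finally have "(fps_eval G (fps_map d A) + fps_eval G (fps_deriv A) * d G) $ k =
        (d (A $ 0) + fps_eval G A' * d G) $ k + (G * (fps_eval G (fps_map d A') + fps_eval G (fps_deriv A') * d G)) $ k"
        by simp
      also have "(G * (fps_eval G (fps_map d A') + fps_eval G (fps_deriv A') * d G)) $ k = (G * d (fps_eval G A')) $ k"
        by (rule mult_nth_cong[OF assms(1)]) (use Suc.IH k in simp)
      also have "(d (A $ 0) + fps_eval G A' * d G) $ k + \<dots> = d (A $ 0 + G * fps_eval G A') $ k"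
        by (simp add: d mult.commute)
      also have "A $ 0 + G * fps_eval G A' = fps_eval G A"
        using fps_eval_unroll[OF assms(1), of A] by (simp add: A'_def)
      finally show "(fps_eval G (fps_map d A) + fps_eval G (fps_deriv A) * d G) $ k = d (fps_eval G A) $ k" .
    qed
  qed simp
  then show "(fps_eval G (fps_map d A) + fps_eval G (fps_deriv A) * d G) $ k = d (fps_eval G A) $ k" for k
    by blast
qed

lemma fps_eval_commute:
  fixes G :: "'a::comm_ring_1 fps" and e :: "'a fps \<Rightarrow> 'b::comm_ring_1 fps"
  assumes "G $ 0 = 0" "e G $ 0 = 0" "ring_homo e"
  shows "e (fps_eval G A) = fps_eval (e G) (fps_map e A)"
proof (rule fps_ext)
  note e = ring_homoD[OF assms(3)]
  have "\<forall>A::'a fps fps. \<forall>k<N. e (fps_eval G A) $ k = fps_eval (e G) (fps_map e A) $ k" for N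
  proof (induction N)
    case (Suc N)
    show ?case
    proof (intro allI impI)
      fix A :: "'a fps fps" and k assume k: "k < Suc N"
      define A' where "A' = fps_shift 1 A"
      have "e (fps_eval G A) $ k = (e (A $ 0) + e G * e (fps_eval G A')) $ k"
        by (subst fps_eval_unroll[OF assms(1)]) (simp add: A'_def e)
      also have "\<dots> = e (A $ 0) $ k + (e G * e (fps_eval G A')) $ k" by simp
      also have "(e G * e (fps_eval G A')) $ k = (e G * fps_eval (e G) (fps_map e A')) $ k"
        by (rule mult_nth_cong[OF assms(2)]) (use Suc.IH k in simp)
      also have "e (A $ 0) $ k + (e G * fps_eval (e G) (fps_map e A')) $ k
          = (fps_map e A $ 0 + e G * fps_eval (e G) (fps_shift 1 (fps_map e A))) $ k"
      proof -
        have "fps_shift 1 (fps_map e A) = fps_map e A'" unfolding A'_def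
          by (rule fps_ext) simp
        then show ?thesis by simp
      qed
      finally show "e (fps_eval G A) $ k = fps_eval (e G) (fps_map e A) $ k"
        using fps_eval_unroll[OF assms(2), of "fps_map e A"] by simp
    qed
  qed simp
  then show "e (fps_eval G A) $ k = fps_eval (e G) (fps_map e A) $ k" for k by blast
qed


section \<open>Substitution into convergent power series\<close>

lemma ring_homo_fps_of_cps2: "ring_homo fps_of_cps2"
  unfolding ring_homo_def by (simp add: one_cps2.rep_eq plus_cps2.rep_eq times_cps2.rep_eq)

lemma ring_homo_fps_const: "ring_homo c \<Longrightarrow> ring_homo (\<lambda>x. fps_const (c x))"
  by (auto simp: ring_homo_def)

text \<open>
  \<open>h(G\<^sub>1, G\<^sub>2)\<close> with complex coefficients read in the ring \<open>'a\<close> by \<open>c\<close>. Written as an iterated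
  evaluation it inherits multiplicativity, naturality and the chain rule from \<open>fps_eval\<close>.
\<close>

definition psubst :: "(complex \<Rightarrow> 'a::comm_ring_1) \<Rightarrow> 'a fps \<Rightarrow> 'a fps \<Rightarrow> cps2 \<Rightarrow> 'a fps" where
  "psubst c G1 G2 h =
     fps_eval G2 (fps_map (\<lambda>a. fps_eval G1 (fps_map (\<lambda>x. fps_const (c x)) a)) (fps_of_cps2 h))"

lemma ring_homo_psubst:
  assumes "ring_homo c" "G1 $ 0 = 0" "G2 $ 0 = 0"
  shows "ring_homo (psubst c G1 G2)"
  unfolding psubst_def
  by (intro ring_homo_comp[OF ring_homo_fps_eval] ring_homo_comp[OF ring_homo_fps_map]
      ring_homo_fps_of_cps2 ring_homo_fps_map ring_homo_fps_const assms)

lemma psubst_nth: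
  assumes c: "ring_homo c" and G: "G1 $ 0 = 0" "G2 $ 0 = 0"
  shows "psubst c G1 G2 h $ n = (\<Sum>i\<le>n. \<Sum>j\<le>n. c (cps2_coeff h i j) * (G1 ^ i * G2 ^ j) $ n)"
proof -
  let ?E = "\<lambda>a. fps_eval G1 (fps_map (\<lambda>x. fps_const (c x)) a)"
  have E: "?E a $ k = (\<Sum>i\<le>n. fps_const (c (a $ i)) * G1 ^ i) $ k" if "k \<le> n" for a k
    unfolding fps_eval_def fps_nth_Abs_fps fps_map_nth fps_sum_nth
    by (rule sum.mono_neutral_left) (use that G power_nth_eq_0[of 1 G1] in auto)
  have "psubst c G1 G2 h $ n = (\<Sum>j\<le>n. (?E (fps_of_cps2 h $ j) * G2 ^ j) $ n)"
    by (simp add: psubst_def fps_eval_def)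
  also have "\<dots> = (\<Sum>j\<le>n. ((\<Sum>i\<le>n. fps_const (c (cps2_coeff h i j)) * G1 ^ i) * G2 ^ j) $ n)"
    unfolding cps2_coeff_def by (intro sum.cong refl, subst (1 2) fps_mult_nth) (auto intro!: sum.cong simp: E)
  also have "\<dots> = (\<Sum>j\<le>n. \<Sum>i\<le>n. c (cps2_coeff h i j) * (G1 ^ i * G2 ^ j) $ n)"
    by (simp add: sum_distrib_right fps_sum_nth mult.assoc)
  finally show ?thesis by (subst sum.swap)
qed

lemma cps2_comp_eq_psubst:
  assumes "fst \<gamma> $ 0 = 0" "snd \<gamma> $ 0 = 0"
  shows "cps2_comp h \<gamma> = psubst (\<lambda>x. x) (fst \<gamma>) (snd \<gamma>) h"
proof (rule fps_ext)
  have "ring_homo (\<lambda>x::complex. x)" by (simp add: ring_homo_def)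
  then show "cps2_comp h \<gamma> $ n = psubst (\<lambda>x. x) (fst \<gamma>) (snd \<gamma>) h $ n" for n
    by (subst psubst_nth) (use assms in \<open>auto simp: cps2_comp_def\<close>)
qed

lemma psubst_commute:
  fixes e :: "'a::comm_ring_1 fps \<Rightarrow> 'b::comm_ring_1 fps"
  assumes "G1 $ 0 = 0" "G2 $ 0 = 0" "e G1 $ 0 = 0" "e G2 $ 0 = 0" "ring_homo e"
    and "\<And>x. e (fps_const (c x)) = fps_const (c' x)"
  shows "e (psubst c G1 G2 h) = psubst c' (e G1) (e G2) h"
proof -
  have "e (psubst c G1 G2 h) =
      fps_eval (e G2) (fps_map e (fps_map (\<lambda>a. fps_eval G1 (fps_map (\<lambda>x. fps_const (c x)) a)) (fps_of_cps2 h)))"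
    unfolding psubst_def by (rule fps_eval_commute) (use assms in auto)
  also have "fps_map e (fps_map (\<lambda>a. fps_eval G1 (fps_map (\<lambda>x. fps_const (c x)) a)) (fps_of_cps2 h))
     = fps_map (\<lambda>a. fps_eval (e G1) (fps_map (\<lambda>x. fps_const (c' x)) a)) (fps_of_cps2 h)"
  proof (rule fps_ext)
    fix k
    have "e (fps_eval G1 (fps_map (\<lambda>x. fps_const (c x)) a)) = fps_eval (e G1) (fps_map e (fps_map (\<lambda>x. fps_const (c x)) a))" for a
      by (rule fps_eval_commute) (use assms in auto)
    moreover have "fps_map e (fps_map (\<lambda>x. fps_const (c x)) a) = fps_map (\<lambda>x. fps_const (c' x)) a" for a
      by (rule fps_ext) (simp add: assms)
    ultimately show "fps_map e (fps_map (\<lambda>a. fps_eval G1 (fps_map (\<lambda>x. fps_const (c x)) a)) (fps_of_cps2 h)) $ k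
     = fps_map (\<lambda>a. fps_eval (e G1) (fps_map (\<lambda>x. fps_const (c' x)) a)) (fps_of_cps2 h) $ k" by simp
  qed
  finally show ?thesis by (simp add: psubst_def)
qed

lemma fps_deriv_fps_map:
  assumes "ring_homo e" shows "fps_deriv (fps_map e A) = fps_map e (fps_deriv A)"
proof (rule fps_ext)
  fix k
  note e = ring_homoD[OF assms]
  have "e (of_nat n) = of_nat n" for n by (induction n) (auto simp: e)
  then show "fps_deriv (fps_map e A) $ k = fps_map e (fps_deriv A) $ k"
    by (simp only: fps_deriv_nth fps_map_nth e)
qed

lemma psubst_chain:
  assumes c: "ring_homo c" and G: "G1 $ 0 = 0" "G2 $ 0 = 0" "d G1 $ 0 = 0" "d G2 $ 0 = 0"
    and d: "derivation d" "\<And>x. d (fps_const (c x)) = 0"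
  shows "d (psubst c G1 G2 h) = psubst c G1 G2 (pd1 h) * d G1 + psubst c G1 G2 (pd2 h) * d G2"
proof -
  define E where "E = (\<lambda>a. fps_eval G1 (fps_map (\<lambda>x. fps_const (c x)) a))"
  have E: "ring_homo E" unfolding E_def
    by (intro ring_homo_comp[OF ring_homo_fps_eval] ring_homo_fps_map ring_homo_fps_const G c)
  have dE: "d (E a) = E (fps_deriv a) * d G1" for a
  proof -
    have "fps_map d (fps_map (\<lambda>x. fps_const (c x)) a) = 0"
      by (rule fps_ext) (simp add: d)
    moreover have "fps_eval G1 0 = 0" using fps_eval_const[of G1 0] by simp
    ultimately show ?thesis
      using fps_eval_chain[of G1 d "fps_map (\<lambda>x. fps_const (c x)) a"] G d
      by (simp add: E_def fps_deriv_fps_map[OF ring_homo_fps_const[OF c]])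
  qed
  have ps: "psubst c G1 G2 h = fps_eval G2 (fps_map E (fps_of_cps2 h))" for h
    by (simp add: psubst_def E_def)
  have "fps_map d (fps_map E (fps_of_cps2 h)) = fps_map E (fps_of_cps2 (pd1 h)) * fps_const (d G1)"
    by (rule fps_ext) (simp add: dE pd1.rep_eq)
  moreover have "fps_deriv (fps_map E (fps_of_cps2 h)) = fps_map E (fps_of_cps2 (pd2 h))"
    by (simp add: fps_deriv_fps_map[OF E] pd2.rep_eq)
  ultimately have "d (psubst c G1 G2 h) = fps_eval G2 (fps_map E (fps_of_cps2 (pd1 h)) * fps_const (d G1))
      + fps_eval G2 (fps_map E (fps_of_cps2 (pd2 h))) * d G2"
    using fps_eval_chain[of G2 d "fps_map E (fps_of_cps2 h)"] G d unfolding ps by simp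
  then show ?thesis by (simp add: ps fps_eval_mult[OF G(2)])
qed

lift_definition cps2_x1 :: cps2 is "fps_const fps_X"
  unfolding convergent2_iff_bound by (rule exI[of _ 1], rule exI[of _ 1]) (auto simp: fps_X_nth)

lift_definition cps2_x2 :: cps2 is "fps_X"
  unfolding convergent2_iff_bound by (rule exI[of _ 1], rule exI[of _ 1]) (auto simp: fps_X_nth)

lemma cps2_x_coeff:
  "cps2_coeff cps2_x1 i j = (if i = 1 \<and> j = 0 then 1 else 0)"
  "cps2_coeff cps2_x2 i j = (if i = 0 \<and> j = 1 then 1 else 0)"
  by (auto simp: cps2_coeff_def cps2_x1.rep_eq cps2_x2.rep_eq fps_X_nth)

lemma cps2_coeff_simps:
  "cps2_coeff (f + g) i j = cps2_coeff f i j + cps2_coeff g i j"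
  "cps2_coeff (f - g) i j = cps2_coeff f i j - cps2_coeff g i j"
  "cps2_coeff (cps2_const a) i j = (if i = 0 \<and> j = 0 then a else 0)"
  "cps2_coeff 0 i j = 0"
  "cps2_coeff (cps2_const a * f) i j = a * cps2_coeff f i j"
  by (auto simp: cps2_coeff_def plus_cps2.rep_eq minus_cps2.rep_eq cps2_const.rep_eq zero_cps2.rep_eq times_cps2.rep_eq)

lemma cps2_coeff_mult:
  "cps2_coeff (f * g) i j = (\<Sum>b\<le>j. \<Sum>a\<le>i. cps2_coeff f a b * cps2_coeff g (i - a) (j - b))"
  by (simp add: cps2_coeff_def times_cps2.rep_eq fps_mult_nth fps_sum_nth atMost_atLeast0)

lemma ring_homo_cps2_const: "ring_homo cps2_const"
  by (simp add: ring_homo_def cps2_const_hom)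

lemma psubst_x:
  assumes c: "ring_homo c" and G: "G1 $ 0 = 0" "G2 $ 0 = 0"
  shows "psubst c G1 G2 cps2_x1 = G1" "psubst c G1 G2 cps2_x2 = G2"
    "psubst c G1 G2 (cps2_const a) = fps_const (c a)"
proof -
  note cc = ring_homoD[OF c]
  show "psubst c G1 G2 (cps2_const a) = fps_const (c a)"
  proof (rule fps_ext)
    fix n
    have "psubst c G1 G2 (cps2_const a) $ n = (\<Sum>i\<le>n. \<Sum>j\<le>n. if i = 0 then if j = 0 then c a * (1::'a fps) $ n else 0 else 0)"
      by (subst psubst_nth[OF c G]) (auto simp: cps2_coeff_simps cc intro!: sum.cong)
    also have "\<dots> = fps_const (c a) $ n" by (simp add: sum.delta if_distrib cong: if_cong)
    finally show "psubst c G1 G2 (cps2_const a) $ n = fps_const (c a) $ n" .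
  qed
  have *: "(\<Sum>i\<le>n. \<Sum>j\<le>n. if i = p \<and> j = q then x else 0) = (if p \<le> n \<and> q \<le> n then x else 0)" for p q n :: nat and x :: 'a
  proof -
    have "(\<Sum>j\<le>n. if i = p \<and> j = q then x else 0) = (if i = p then if q \<le> n then x else 0 else 0)" for i
      by (cases "i = p") (simp_all add: sum.delta)
    then show ?thesis by (simp add: sum.delta)
  qed
  show "psubst c G1 G2 cps2_x1 = G1"
  proof (rule fps_ext)
    fix n
    have "psubst c G1 G2 cps2_x1 $ n = (\<Sum>i\<le>n. \<Sum>j\<le>n. if i = 1 \<and> j = 0 then G1 $ n else 0)"
      by (subst psubst_nth[OF c G]) (auto simp: cps2_x_coeff cc intro!: sum.cong)
    then show "psubst c G1 G2 cps2_x1 $ n = G1 $ n"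
      unfolding * using G by (cases n) auto
  qed
  show "psubst c G1 G2 cps2_x2 = G2"
  proof (rule fps_ext)
    fix n
    have "psubst c G1 G2 cps2_x2 $ n = (\<Sum>i\<le>n. \<Sum>j\<le>n. if i = 0 \<and> j = 1 then G2 $ n else 0)"
      by (subst psubst_nth[OF c G]) (auto simp: cps2_x_coeff cc intro!: sum.cong)
    then show "psubst c G1 G2 cps2_x2 $ n = G2 $ n"
      unfolding * using G by (cases n) auto
  qed
qed

section \<open>Orders of series in one and two variables\<close>

definition order_ge :: "nat \<Rightarrow> 'a::zero fps \<Rightarrow> bool" where
  "order_ge k G \<longleftrightarrow> (\<forall>d<k. G $ d = 0)"

lemma order_ge_mono: "order_ge k G \<Longrightarrow> l \<le> k \<Longrightarrow> order_ge l G"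
  by (auto simp: order_ge_def)

text \<open>
  The coefficient formula says that leading coefficients multiply; it is also meaningful when they
  vanish.
\<close>

lemma order_ge_mult:
  fixes A B :: "'a::comm_ring_1 fps"
  assumes "order_ge a A" "order_ge b B"
  shows "order_ge (a + b) (A * B)" "(A * B) $ (a + b) = A $ a * B $ b"
proof -
  show "order_ge (a + b) (A * B)"
    unfolding order_ge_def
  proof (intro allI impI)
    fix d assume d: "d < a + b"
    have "A $ i * B $ (d - i) = 0" if "i \<in> {0..d}" for i
    proof (cases "i < a")
      case False
      then have "d - i < b" using d that by auto
      then show ?thesis using assms by (simp add: order_ge_def)
    qed (use assms in \<open>simp add: order_ge_def\<close>)
    then show "(A * B) $ d = 0" by (simp add: fps_mult_nth)
  qed
  have "A $ i * B $ (a + b - i) = (if i = a then A $ a * B $ b else 0)" if "i \<in> {0..a + b}" for i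
  proof -
    consider "i < a" | "i = a" | "i > a" by linarith
    then show ?thesis
    proof cases
      case 3
      then have "a + b - i < b" using that by auto
      then show ?thesis using assms 3 by (simp add: order_ge_def)
    qed (use assms in \<open>auto simp: order_ge_def\<close>)
  qed
  then have "(A * B) $ (a + b) = (\<Sum>i\<in>{0..a + b}. if i = a then A $ a * B $ b else 0)"
    unfolding fps_mult_nth by (intro sum.cong) auto
  then show "(A * B) $ (a + b) = A $ a * B $ b" by simp
qed

lemma order_ge_power:
  fixes A :: "'a::comm_ring_1 fps"
  assumes "order_ge a A"
  shows "order_ge (a * i) (A ^ i)" "(A ^ i) $ (a * i) = (A $ a) ^ i"
proof -
  have "order_ge (a * i) (A ^ i) \<and> (A ^ i) $ (a * i) = (A $ a) ^ i"
  proof (induction i)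
    case 0 then show ?case by (simp add: order_ge_def)
  next
    case (Suc i)
    then show ?case using order_ge_mult[OF assms, of "a * i" "A ^ i"] by simp
  qed
  then show "order_ge (a * i) (A ^ i)" "(A ^ i) $ (a * i) = (A $ a) ^ i" by auto
qed

lemma subdegree_order_ge:
  assumes "w \<noteq> 0" shows "order_ge (subdegree w) w" "w $ subdegree w \<noteq> 0"
  using assms by (auto simp: order_ge_def)

lemma order_ge_subdegree: "order_ge k w \<Longrightarrow> w $ k \<noteq> 0 \<Longrightarrow> subdegree w = k"
  by (intro subdegreeI) (auto simp: order_ge_def)

text \<open>
  Membership in the power \<open>k\<close> of the maximal ideal of \<open>\<O>\<^sub>2\<close>.
\<close>

definition vanishes_to :: "nat \<Rightarrow> cps2 \<Rightarrow> bool" where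
  "vanishes_to k h \<longleftrightarrow> (\<forall>i j. i + j < k \<longrightarrow> cps2_coeff h i j = 0)"

lemma vanishes_to_mono: "vanishes_to k h \<Longrightarrow> l \<le> k \<Longrightarrow> vanishes_to l h"
  by (auto simp: vanishes_to_def)

lemma vanishes_to_add: "vanishes_to k g \<Longrightarrow> vanishes_to k h \<Longrightarrow> vanishes_to k (g + h)"
  by (simp add: vanishes_to_def cps2_coeff_simps)

lemma vanishes_to_diff: "vanishes_to k g \<Longrightarrow> vanishes_to k h \<Longrightarrow> vanishes_to k (g - h)"
  by (simp add: vanishes_to_def cps2_coeff_simps)

lemma vanishes_to_0: "vanishes_to k 0"
  by (simp add: vanishes_to_def cps2_coeff_simps)

lemma vanishes_to_sum: "(\<And>i. i \<in> S \<Longrightarrow> vanishes_to k (g i)) \<Longrightarrow> vanishes_to k (sum g S)"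
  by (induction S rule: infinite_finite_induct) (auto intro: vanishes_to_add vanishes_to_0)

lemma vanishes_to_mult:
  assumes "vanishes_to k g" "vanishes_to l h" shows "vanishes_to (k + l) (g * h)"
  unfolding vanishes_to_def
proof (intro allI impI)
  fix i j assume ij: "i + j < k + l"
  have "cps2_coeff g a b * cps2_coeff h (i - a) (j - b) = 0" if "a \<le> i" "b \<le> j" for a b
  proof (cases "a + b < k")
    case False
    then have "i - a + (j - b) < l" using ij that by auto
    then show ?thesis using assms by (simp add: vanishes_to_def)
  qed (use assms in \<open>simp add: vanishes_to_def\<close>)
  then show "cps2_coeff (g * h) i j = 0" unfolding cps2_coeff_mult by (intro sum.neutral ballI) auto
qed

lemma vanishes_to_zero: "vanishes_to 0 h" by (simp add: vanishes_to_def)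

lemma vanishes_to_mult_left: "vanishes_to k h \<Longrightarrow> vanishes_to k (g * h)"
  using vanishes_to_mult[OF vanishes_to_zero, of k h g] by simp

lemma vanishes_to_mult_right: "vanishes_to k h \<Longrightarrow> vanishes_to k (h * g)"
  using vanishes_to_mult[OF _ vanishes_to_zero, of k h g] by simp

lemma vanishes_to_power: "vanishes_to 1 h \<Longrightarrow> vanishes_to i (h ^ i)"
  by (induction i) (use vanishes_to_mult[of 1 h] in \<open>auto simp: vanishes_to_zero\<close>)

section \<open>The weighted blow-up chart\<close>

text \<open>
  The coefficient of \<open>t\<^sup>d\<close> only contains \<open>z\<^sup>j\<close> with \<open>d = n i + m j\<close>. These are the series that come
  from power series in \<open>x = t\<^sup>n\<close> and \<open>y = z t\<^sup>m\<close>.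
\<close>

definition graded :: "nat \<Rightarrow> nat \<Rightarrow> complex poly fps \<Rightarrow> bool" where
  "graded n m G \<longleftrightarrow> (\<forall>d j. coeff (G $ d) j \<noteq> 0 \<longrightarrow> (\<exists>i. d = n * i + m * j))"

lemma graded_mult:
  assumes "graded n m A" "graded n m B" shows "graded n m (A * B)"
  unfolding graded_def
proof (intro allI impI)
  fix d j assume "coeff ((A * B) $ d) j \<noteq> 0"
  then have "(\<Sum>a=0..d. \<Sum>k\<le>j. coeff (A $ a) k * coeff (B $ (d - a)) (j - k)) \<noteq> 0"
    by (simp add: fps_mult_nth coeff_sum coeff_mult)
  then obtain a k where ak: "a \<le> d" "k \<le> j" "coeff (A $ a) k \<noteq> 0" "coeff (B $ (d - a)) (j - k) \<noteq> 0"
    by (metis (no_types, lifting) sum.not_neutral_contains_not_neutral mult_eq_0_iff atLeastAtMost_iff atMost_iff)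
  then obtain i1 i2 where i: "a = n * i1 + m * k" "d - a = n * i2 + m * (j - k)"
    using assms unfolding graded_def by meson
  have "d = a + (d - a)" using ak by simp
  also have "\<dots> = n * (i1 + i2) + m * (k + (j - k))"
    unfolding i(1)[symmetric] i(2) by (subst i(1)) (simp add: distrib_left)
  then show "\<exists>i. d = n * i + m * j" using ak by auto
qed

lemma graded_1: "graded n m 1"
  unfolding graded_def by (auto simp: coeff_1 split: if_splits)

lemma graded_power: "graded n m A \<Longrightarrow> graded n m (A ^ i)"
  by (induction i) (auto intro: graded_1 graded_mult)

abbreviation pconst :: "complex \<Rightarrow> complex poly" where "pconst \<equiv> (\<lambda>x. [:x:])"

lemma ring_homo_pconst: "ring_homo pconst"
  by (simp add: ring_homo_def one_pCons)

lemma graded_psubst: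
  assumes "graded n m A" "graded n m B" "A $ 0 = 0" "B $ 0 = 0"
  shows "graded n m (psubst pconst A B h)"
  unfolding graded_def
proof (intro allI impI)
  fix d j assume "coeff (psubst pconst A B h $ d) j \<noteq> 0"
  then have "(\<Sum>i\<le>d. \<Sum>k\<le>d. cps2_coeff h i k * coeff ((A ^ i * B ^ k) $ d) j) \<noteq> 0"
    by (simp add: psubst_nth[OF ring_homo_pconst assms(3,4)] coeff_sum)
  then obtain i k where "coeff ((A ^ i * B ^ k) $ d) j \<noteq> 0"
    by (metis (no_types, lifting) sum.not_neutral_contains_not_neutral mult_eq_0_iff)
  moreover have "graded n m (A ^ i * B ^ k)" by (intro graded_mult graded_power assms)
  ultimately show "\<exists>i. d = n * i + m * j" by (auto simp: graded_def)
qed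

text \<open>
  The pair \<open>(\<Phi>1, \<Phi>2)\<close> expresses the given coordinates by coordinates \<open>x\<close>, \<open>y\<close> in which the branch
  is parameterized by \<open>x = T\<^sup>n\<close>, \<open>y = T\<^sup>m + \<dots>\<close>.
\<close>

locale chart =
  fixes n m :: nat and \<Phi>1 \<Phi>2 :: cps2
  assumes coord: "coordinate_change \<Phi>1 \<Phi>2"
    and n1: "1 < n" and nm: "n < m" and ndvd: "\<not> n dvd m"
begin

text \<open>
  The weighted blow-up \<open>x = t\<^sup>n\<close>, \<open>y = z t\<^sup>m\<close> of a series in the new coordinates.
\<close>

definition wsub :: "cps2 \<Rightarrow> complex poly fps" where
  "wsub = psubst pconst (fps_X ^ n) (fps_const [:0, 1:] * fps_X ^ m)"

abbreviation "P1 \<equiv> wsub \<Phi>1"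
abbreviation "P2 \<equiv> wsub \<Phi>2"

text \<open>
  The pull-back to the blow-up chart of a series in the given coordinates.
\<close>

definition \<Psi> :: "cps2 \<Rightarrow> complex poly fps" where
  "\<Psi> = psubst pconst P1 P2"

lemma wbase: "(fps_X ^ n :: complex poly fps) $ 0 = 0" "(fps_const [:0, 1:] * fps_X ^ m :: complex poly fps) $ 0 = 0"
  using n1 nm by (auto simp: fps_X_power_nth)

lemma wsub_hom: "ring_homo wsub"
  unfolding wsub_def by (rule ring_homo_psubst[OF ring_homo_pconst wbase])

lemma coeff_wsub: "coeff (wsub h $ d) j = (\<Sum>a\<le>d. \<Sum>b\<le>d. if d = n * a + m * b \<and> b = j then cps2_coeff h a b else 0)"
proof -
  have pw: "(fps_X ^ n) ^ a * (fps_const [:0, 1:] * fps_X ^ m) ^ b = fps_const (monom 1 b) * (fps_X ^ (n * a + m * b) :: complex poly fps)" for a b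
  proof -
    have "[:0, 1:] ^ b = (monom 1 b :: complex poly)" by (simp add: monom_altdef)
    have "(fps_const [:0, 1:] * fps_X ^ m) ^ b = fps_const ([:0, 1:] ^ b) * (fps_X ^ (m * b) :: complex poly fps)"
      by (simp only: power_mult_distrib fps_const_power power_mult)
    moreover have "(fps_X ^ n) ^ a = (fps_X ^ (n * a) :: complex poly fps)" by (simp only: power_mult)
    ultimately show ?thesis
      by (simp only: \<open>[:0, 1:] ^ b = monom 1 b\<close> power_add mult.left_commute)
  qed
  then have e: "((fps_X ^ n) ^ a * (fps_const [:0, 1:] * fps_X ^ m) ^ b) $ d = (if d = n * a + m * b then monom (1::complex) b else 0)" for a b
    unfolding pw fps_mult_left_const_nth fps_X_power_nth by simp
  show ?thesis
    unfolding wsub_def psubst_nth[OF ring_homo_pconst wbase] e coeff_sum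
    by (intro sum.cong refl) auto
qed

lemma coeff_wsub_eq: "coeff (wsub h $ (n * i + m * j)) j = cps2_coeff h i j"
proof -
  let ?d = "n * i + m * j"
  have "coeff (wsub h $ ?d) j = (\<Sum>a\<le>?d. \<Sum>b\<le>?d. if b = j then if a = i then cps2_coeff h i j else 0 else 0)"
    unfolding coeff_wsub by (intro sum.cong refl) (use n1 in auto)
  also have "\<dots> = (\<Sum>a\<le>?d. if a = i then cps2_coeff h i j else 0)"
  proof (intro sum.cong refl)
    have "j \<le> ?d" using n1 nm by (simp add: trans_le_add2)
    then show "(\<Sum>b\<le>?d. if b = j then if a = i then cps2_coeff h i j else 0 else 0)
      = (if a = i then cps2_coeff h i j else 0)" for a by (simp add: sum.delta)
  qed
  also have "\<dots> = cps2_coeff h i j"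
  proof -
    have "i \<le> ?d" using n1 by (simp add: trans_le_add1)
    then show ?thesis by (simp add: sum.delta)
  qed
  finally show ?thesis .
qed

lemma graded_wsub: "graded n m (wsub h)"
  unfolding graded_def
proof (intro allI impI)
  fix d j assume "coeff (wsub h $ d) j \<noteq> 0"
  then have "\<exists>a b. (if d = n * a + m * b \<and> b = j then cps2_coeff h a b else 0) \<noteq> 0"
    unfolding coeff_wsub by (elim sum.not_neutral_contains_not_neutral) blast
  then show "\<exists>i. d = n * i + m * j" by (metis (full_types))
qed

lemma graded_low:
  assumes "graded n m G" "d < m"
  shows "G $ d = [:coeff (G $ d) 0:]" "\<not> n dvd d \<Longrightarrow> G $ d = 0"
proof -
  have "j = 0 \<and> n dvd d" if nz: "coeff (G $ d) j \<noteq> 0" for j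
  proof -
    obtain i where "d = n * i + m * j" using assms nz unfolding graded_def by blast
    with \<open>d < m\<close> show ?thesis by (cases j) auto
  qed
  then show "G $ d = [:coeff (G $ d) 0:]" "\<not> n dvd d \<Longrightarrow> G $ d = 0"
    by (auto simp: poly_eq_iff coeff_pCons split: nat.splits)
qed

lemma graded_at_m:
  assumes "graded n m G"
  shows "G $ m = [:0, coeff (G $ m) 1:]"
proof -
  have "j = 1" if nz: "coeff (G $ m) j \<noteq> 0" for j
  proof -
    obtain i where i: "m = n * i + m * j" using assms nz unfolding graded_def by blast
    have "j \<noteq> 0" using i ndvd by (metis add.right_neutral dvd_triv_left mult_0_right)
    moreover have "j < 2"
    proof (rule ccontr)
      assume "\<not> j < 2"
      then have "m * 2 \<le> m * j" by (intro mult_le_mono2) simp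
      then show False using i nm n1 by linarith
    qed
    ultimately show ?thesis by simp
  qed
  then show ?thesis
    by (auto simp: poly_eq_iff coeff_pCons split: nat.splits)
qed

lemma coord00: "cps2_coeff \<Phi>1 0 0 = 0" "cps2_coeff \<Phi>2 0 0 = 0"
  using coord by (auto simp: coordinate_change_def)

lemma wsub_order: "cps2_coeff h 0 0 = 0 \<Longrightarrow> order_ge n (wsub h)"
  unfolding order_ge_def
proof (intro allI impI)
  fix d assume h: "cps2_coeff h 0 0 = 0" and d: "d < n"
  have "coeff (wsub h $ d) j = 0" for j
  proof (rule ccontr)
    assume a: "coeff (wsub h $ d) j \<noteq> 0"
    then obtain i where i: "d = n * i + m * j" using graded_wsub[of h] unfolding graded_def by blast
    with d nm have "i = 0 \<and> j = 0" by (cases i; cases j) auto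
    with coeff_wsub_eq[of h i j] h a i show False by simp
  qed
  then show "wsub h $ d = 0" by (simp add: poly_eq_iff)
qed

lemma P_order: "order_ge n P1" "order_ge n P2"
  using wsub_order coord00 by auto

lemma P_0: "P1 $ 0 = 0" "P2 $ 0 = 0"
  using P_order n1 by (auto simp: order_ge_def)

lemma \<Psi>_hom: "ring_homo \<Psi>"
  unfolding \<Psi>_def by (rule ring_homo_psubst[OF ring_homo_pconst P_0])

lemmas \<Psi>_simps = ring_homoD[OF \<Psi>_hom]

lemma \<Psi>_const: "\<Psi> (cps2_const a) = fps_const [:a:]"
  unfolding \<Psi>_def by (rule psubst_x[OF ring_homo_pconst P_0])

lemma \<Psi>_x: "\<Psi> cps2_x1 = P1" "\<Psi> cps2_x2 = P2"
  unfolding \<Psi>_def by (rule psubst_x[OF ring_homo_pconst P_0])+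

lemma wsub_const: "wsub (cps2_const a) = fps_const [:a:]"
  unfolding wsub_def by (rule psubst_x[OF ring_homo_pconst wbase])

lemma \<Psi>_nth: "\<Psi> h $ d = (\<Sum>i\<le>d. \<Sum>j\<le>d. [:cps2_coeff h i j:] * (P1 ^ i * P2 ^ j) $ d)"
  unfolding \<Psi>_def by (rule psubst_nth[OF ring_homo_pconst P_0])

lemma graded_\<Psi>: "graded n m (\<Psi> h)"
  unfolding \<Psi>_def by (intro graded_psubst graded_wsub P_0)

lemma \<Psi>_order:
  assumes "vanishes_to k h" shows "order_ge (n * k) (\<Psi> h)"
  unfolding order_ge_def \<Psi>_nth
proof (intro allI impI sum.neutral ballI)
  fix d i j assume d: "d < n * k"
  show "[:cps2_coeff h i j:] * (P1 ^ i * P2 ^ j) $ d = 0"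
  proof (cases "i + j < k")
    case False
    then have "n * k \<le> n * i + n * j" by (metis add_mult_distrib2 mult_le_mono2 not_less)
    then have "(P1 ^ i * P2 ^ j) $ d = 0"
      using order_ge_mult(1)[OF order_ge_power(1)[OF P_order(1), of i] order_ge_power(1)[OF P_order(2), of j]] d
      unfolding order_ge_def by auto
    then show ?thesis by simp
  qed (use assms in \<open>simp add: vanishes_to_def\<close>)
qed

text \<open>
  Below \<open>t\<^sup>m\<close> a graded series has constant coefficients, whereas its coefficient at \<open>t\<^sup>m\<close> is a multiple of
  \<open>z\<close>. Without constant terms the product at \<open>t\<^sup>m\<close> only involves the former, so both conditions apply.
\<close>

lemma graded_mult_at_m:
  assumes "graded n m A" "graded n m B" "A $ 0 = 0" "B $ 0 = 0"
  shows "(A * B) $ m = 0"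
proof -
  have "coeff (A $ i * B $ (m - i)) 1 = 0" if im: "i \<in> {0..m}" for i
  proof -
    consider "i = 0" | "i = m" | "i < m" "m - i < m" using im by fastforce
    then show ?thesis
    proof cases
      case 3
      then show ?thesis
        by (subst graded_low(1)[OF assms(1), of i], simp, subst graded_low(1)[OF assms(2), of "m - i"]) auto
    qed (use assms in auto)
  qed
  then have "coeff ((A * B) $ m) 1 = 0" unfolding fps_mult_nth coeff_sum by (intro sum.neutral) auto
  then show ?thesis using graded_at_m[OF graded_mult[OF assms(1,2)]] by simp
qed

lemma \<Psi>_at_m:
  assumes "vanishes_to 2 h" shows "\<Psi> h $ m = 0"
  unfolding \<Psi>_nth
proof (intro sum.neutral ballI)
  fix i j
  have pw: "(A ^ k) $ 0 = 0" if "A $ 0 = 0" "k > 0" for A :: "complex poly fps" and k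
    using that by (simp add: fps_power_zeroth)
  consider "i + j < 2" | i' where "i = Suc i'" "i' + j > 0" | j' where "j = Suc j'" "i + j' > 0"
    by (cases i; cases j) auto
  then have "cps2_coeff h i j = 0 \<or> (P1 ^ i * P2 ^ j) $ m = 0"
  proof cases
    case 1
    then show ?thesis using assms by (simp add: vanishes_to_def)
  next
    case 2
    have "(P1 * (P1 ^ i' * P2 ^ j)) $ m = 0"
      by (rule graded_mult_at_m) (use 2 in \<open>auto intro!: graded_wsub graded_mult graded_power simp: P_0 pw\<close>)
    then show ?thesis using 2 by (simp add: mult.assoc)
  next
    case 3
    have "(P2 * (P1 ^ i * P2 ^ j')) $ m = 0"
      by (rule graded_mult_at_m) (use 3 in \<open>auto intro!: graded_wsub graded_mult graded_power simp: P_0 pw\<close>)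
    then show ?thesis using 3 by (simp add: mult_ac)
  qed
  then show "[:cps2_coeff h i j:] * (P1 ^ i * P2 ^ j) $ m = 0" by auto
qed

text \<open>
  The Jacobian determinant of the coordinate change at the origin.
\<close>

definition jac :: complex where
  "jac = cps2_coeff \<Phi>1 1 0 * cps2_coeff \<Phi>2 0 1 - cps2_coeff \<Phi>1 0 1 * cps2_coeff \<Phi>2 1 0"

lemma jac_nz: "jac \<noteq> 0" using coord by (simp add: jac_def coordinate_change_def)

text \<open>
  The linear form that becomes \<open>x\<close> up to terms of order two in the new coordinates.
\<close>

definition X :: cps2 where
  "X = cps2_const (cps2_coeff \<Phi>2 0 1 / jac) * cps2_x1 - cps2_const (cps2_coeff \<Phi>1 0 1 / jac) * cps2_x2"

lemma \<Psi>_linear: "\<Psi> (cps2_const a * cps2_x1 - cps2_const b * cps2_x2) = wsub (cps2_const a * \<Phi>1 - cps2_const b * \<Phi>2)"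
  by (simp add: \<Psi>_simps \<Psi>_const \<Psi>_x ring_homoD[OF wsub_hom] wsub_const)

lemma X_vanishes: "vanishes_to 1 X"
  by (simp add: vanishes_to_def X_def cps2_coeff_simps cps2_x_coeff)

lemma X_props: "order_ge n (\<Psi> X)" "\<Psi> X $ n = 1" "\<Psi> X $ m = 0"
proof -
  let ?h = "cps2_const (cps2_coeff \<Phi>2 0 1 / jac) * \<Phi>1 - cps2_const (cps2_coeff \<Phi>1 0 1 / jac) * \<Phi>2"
  have P: "\<Psi> X = wsub ?h" unfolding X_def by (rule \<Psi>_linear)
  show "order_ge n (\<Psi> X)" unfolding P by (rule wsub_order) (simp add: cps2_coeff_simps coord00)
  have "cps2_coeff ?h 1 0 = (cps2_coeff \<Phi>1 1 0 * cps2_coeff \<Phi>2 0 1 - cps2_coeff \<Phi>1 0 1 * cps2_coeff \<Phi>2 1 0) / jac"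
    unfolding cps2_coeff_simps by (simp add: diff_divide_distrib mult.commute)
  also have "\<dots> = 1" using jac_nz by (simp add: jac_def)
  finally have "coeff (\<Psi> X $ n) 0 = 1" using coeff_wsub_eq[of ?h 1 0] by (simp add: P)
  then show "\<Psi> X $ n = 1" using graded_low(1)[OF graded_\<Psi>[of X] nm] by (simp add: one_pCons)
  have "coeff (\<Psi> X $ m) 1 = 0" using coeff_wsub_eq[of ?h 0 1] by (simp add: P cps2_coeff_simps)
  then show "\<Psi> X $ m = 0" using graded_at_m[OF graded_\<Psi>[of X]] by simp
qed

lemma X_power_at_m: "\<Psi> (X ^ i) $ m = 0"
proof -
  consider "i = 0" | "i = 1" | "i \<ge> 2" by linarith
  then show ?thesis
  proof cases
    case 3
    then show ?thesis by (intro \<Psi>_at_m vanishes_to_mono[OF vanishes_to_power[OF X_vanishes]])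
  qed (use nm X_props in \<open>auto simp: \<Psi>_simps\<close>)
qed

text \<open>
  The linear form that becomes \<open>y\<close> up to order two may contain powers of \<open>x\<close> of weight below \<open>m\<close>.
  They are removed one after the other by subtracting powers of \<open>X\<close>, which have no term in \<open>z t\<^sup>m\<close>.
\<close>

lemma ex_Y: "\<exists>Y. order_ge m (\<Psi> Y) \<and> \<Psi> Y $ m = [:0, 1:]"
proof -
  have "k \<le> m \<Longrightarrow> \<exists>Y. order_ge k (\<Psi> Y) \<and> \<Psi> Y $ m = [:0, 1:]" for k
  proof (induction k)
    case 0
    let ?Y = "cps2_const (- cps2_coeff \<Phi>2 1 0 / jac) * cps2_x1 - cps2_const (- cps2_coeff \<Phi>1 1 0 / jac) * cps2_x2"
    let ?h = "cps2_const (- cps2_coeff \<Phi>2 1 0 / jac) * \<Phi>1 - cps2_const (- cps2_coeff \<Phi>1 1 0 / jac) * \<Phi>2"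
    have P: "\<Psi> ?Y = wsub ?h" by (rule \<Psi>_linear)
    have "cps2_coeff ?h 0 1 = (cps2_coeff \<Phi>1 1 0 * cps2_coeff \<Phi>2 0 1 - cps2_coeff \<Phi>1 0 1 * cps2_coeff \<Phi>2 1 0) / jac"
      unfolding cps2_coeff_simps by (simp add: diff_divide_distrib mult.commute)
    also have "\<dots> = 1" using jac_nz by (simp add: jac_def)
    finally have "coeff (\<Psi> ?Y $ m) 1 = 1" using coeff_wsub_eq[of ?h 0 1] unfolding P by simp
    then have "\<Psi> ?Y $ m = [:0, 1:]" using graded_at_m[OF graded_\<Psi>[of ?Y]] by simp
    then show ?case by (intro exI[of _ ?Y]) (simp add: order_ge_def)
  next
    case (Suc k)
    then obtain Y where Y: "order_ge k (\<Psi> Y)" "\<Psi> Y $ m = [:0, 1:]" by auto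
    show ?case
    proof (cases "\<Psi> Y $ k = 0")
      case True
      then show ?thesis using Y by (intro exI[of _ Y]) (auto simp: order_ge_def less_Suc_eq)
    next
      case False
      have k: "k < m" using Suc.prems by simp
      then obtain i where i: "k = n * i" using False graded_low(2)[OF graded_\<Psi>[of Y]] by blast
      define c where "c = coeff (\<Psi> Y $ k) 0"
      have c: "\<Psi> Y $ k = [:c:]" unfolding c_def by (rule graded_low(1)[OF graded_\<Psi> k])
      have P: "\<Psi> (Y - cps2_const c * X ^ i) = \<Psi> Y - fps_const [:c:] * \<Psi> (X ^ i)"
        by (simp add: \<Psi>_simps \<Psi>_const)
      have "order_ge k (\<Psi> (X ^ i))" "\<Psi> (X ^ i) $ k = 1"
        using order_ge_power[OF X_props(1), of i] X_props(2) i by (auto simp: \<Psi>_simps)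
      then have "order_ge (Suc k) (\<Psi> (Y - cps2_const c * X ^ i))"
        unfolding P using Y c by (auto simp: order_ge_def less_Suc_eq)
      moreover have "\<Psi> (Y - cps2_const c * X ^ i) $ m = [:0, 1:]"
        unfolding P using Y X_power_at_m by simp
      ultimately show ?thesis by blast
    qed
  qed
  then show ?thesis by blast
qed

text \<open>
  Together with \<open>X\<close> this gives elements of \<open>\<O>\<^sub>2\<close> whose initial forms are \<open>x\<close> and \<open>y\<close>. They replace the
  inverse of the coordinate change.
\<close>

definition Y :: cps2 where "Y = (SOME Y. order_ge m (\<Psi> Y) \<and> \<Psi> Y $ m = [:0, 1:])"

lemma Y_props: "order_ge m (\<Psi> Y)" "\<Psi> Y $ m = [:0, 1:]"
  using someI_ex[OF ex_Y] by (auto simp: Y_def)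

lemma \<Psi>_XY: "order_ge (n * i + m * j) (\<Psi> (X ^ i * Y ^ j))" "\<Psi> (X ^ i * Y ^ j) $ (n * i + m * j) = monom 1 j"
proof -
  note * = order_ge_mult[OF order_ge_power(1)[OF X_props(1), of i] order_ge_power(1)[OF Y_props(1), of j]]
  show "order_ge (n * i + m * j) (\<Psi> (X ^ i * Y ^ j))" using *(1) by (simp add: \<Psi>_simps)
  have "[:0, 1:] ^ j = (monom 1 j :: complex poly)" by (simp add: monom_altdef)
  then show "\<Psi> (X ^ i * Y ^ j) $ (n * i + m * j) = monom 1 j"
    using *(2) by (simp add: \<Psi>_simps order_ge_power(2)[OF X_props(1)] order_ge_power(2)[OF Y_props(1)] X_props Y_props)
qed

lemma Y_vanishes: "vanishes_to 1 Y"
proof -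
  have "\<Psi> Y $ 0 = [:cps2_coeff Y 0 0:]" by (simp add: \<Psi>_nth)
  then show ?thesis using Y_props nm by (auto simp: vanishes_to_def order_ge_def)
qed

lemma linear_part:
  assumes "cps2_coeff h 0 0 = 0"
  shows "vanishes_to 2 (h - (cps2_const (cps2_coeff h 1 0) * cps2_x1 + cps2_const (cps2_coeff h 0 1) * cps2_x2))"
  unfolding vanishes_to_def
proof (intro allI impI)
  fix i j :: nat assume "i + j < 2"
  then consider "i = 0" "j = 0" | "i = 1" "j = 0" | "i = 0" "j = 1" by linarith
  then show "cps2_coeff (h - (cps2_const (cps2_coeff h 1 0) * cps2_x1 + cps2_const (cps2_coeff h 0 1) * cps2_x2)) i j = 0"
    by cases (auto simp: cps2_coeff_simps cps2_x_coeff assms)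
qed

text \<open>
  So \<open>X\<close> and \<open>Y\<close> are again local coordinates. The coefficient of \<open>z t\<^sup>m\<close> in \<open>\<Psi> Y\<close> only depends on the
  linear part of \<open>Y\<close>, and this yields the determinant.
\<close>

lemma XY_det: "cps2_coeff X 1 0 * cps2_coeff Y 0 1 - cps2_coeff X 0 1 * cps2_coeff Y 1 0 = 1 / jac"
proof -
  have Y0: "cps2_coeff Y 0 0 = 0" using Y_vanishes by (simp add: vanishes_to_def)
  have "\<Psi> Y $ m = \<Psi> (cps2_const (cps2_coeff Y 1 0) * cps2_x1 + cps2_const (cps2_coeff Y 0 1) * cps2_x2) $ m"
    using \<Psi>_at_m[OF linear_part[OF Y0]] by (simp add: \<Psi>_simps)
  also have "\<dots> = [:cps2_coeff Y 1 0:] * P1 $ m + [:cps2_coeff Y 0 1:] * P2 $ m"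
    by (simp add: \<Psi>_simps \<Psi>_const \<Psi>_x)
  finally have "coeff (\<Psi> Y $ m) 1 = cps2_coeff Y 1 0 * coeff (P1 $ m) 1 + cps2_coeff Y 0 1 * coeff (P2 $ m) 1"
    by simp
  then have "cps2_coeff Y 1 0 * cps2_coeff \<Phi>1 0 1 + cps2_coeff Y 0 1 * cps2_coeff \<Phi>2 0 1 = 1"
    using coeff_wsub_eq[of \<Phi>1 0 1] coeff_wsub_eq[of \<Phi>2 0 1] Y_props by simp
  moreover have Xc: "cps2_coeff X 1 0 = cps2_coeff \<Phi>2 0 1 / jac" "cps2_coeff X 0 1 = - cps2_coeff \<Phi>1 0 1 / jac"
    unfolding X_def cps2_coeff_simps cps2_x_coeff by simp_all
  ultimately have e: "cps2_coeff \<Phi>2 0 1 * cps2_coeff Y 0 1 + cps2_coeff \<Phi>1 0 1 * cps2_coeff Y 1 0 = 1"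
    by (simp add: mult.commute add.commute)
  have "cps2_coeff X 1 0 * cps2_coeff Y 0 1 - cps2_coeff X 0 1 * cps2_coeff Y 1 0
     = (cps2_coeff \<Phi>2 0 1 * cps2_coeff Y 0 1 + cps2_coeff \<Phi>1 0 1 * cps2_coeff Y 1 0) / jac"
    unfolding Xc by (simp add: add_divide_distrib)
  then show ?thesis unfolding e .
qed


inductive_set XY_polys :: "cps2 set" where
  one: "1 \<in> XY_polys"
| add: "p \<in> XY_polys \<Longrightarrow> q \<in> XY_polys \<Longrightarrow> p + q \<in> XY_polys"
| scale: "p \<in> XY_polys \<Longrightarrow> cps2_const c * p \<in> XY_polys"
| mult_X: "p \<in> XY_polys \<Longrightarrow> X * p \<in> XY_polys"
| mult_Y: "p \<in> XY_polys \<Longrightarrow> Y * p \<in> XY_polys"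

lemma XY_polys_sum: "(\<And>i. i \<in> S \<Longrightarrow> g i \<in> XY_polys) \<Longrightarrow> sum g S \<in> XY_polys"
  using XY_polys.scale[OF XY_polys.one, of 0]
  by (induction S rule: infinite_finite_induct) (auto simp: cps2_const_hom intro: XY_polys.add)

definition XY_sum :: "nat \<Rightarrow> (nat \<Rightarrow> nat \<Rightarrow> complex) \<Rightarrow> cps2" where
  "XY_sum N c = (\<Sum>i<N. \<Sum>j<N. cps2_const (c i j) * (X ^ i * Y ^ j))"

lemma XY_vanishes: "vanishes_to (i + j) (X ^ i * Y ^ j)"
  by (intro vanishes_to_mult vanishes_to_power X_vanishes Y_vanishes)

lemma XY_polys_form:
  assumes "p \<in> XY_polys" shows "\<exists>c. vanishes_to N (p - XY_sum N c)"
  using assms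
proof induction
  case one
  define c where "c = (\<lambda>(i::nat) (j::nat). if i = 0 then if j = 0 then 1 else 0 else (0::complex))"
  have t: "cps2_const (c i j) * (X ^ i * Y ^ j) = (if i = 0 then if j = 0 then 1 else 0 else 0)" for i j :: nat
    by (auto simp: c_def cps2_const_hom)
  have "vanishes_to N (1 - XY_sum N c)"
  proof (cases "N = 0")
    case False
    have "(\<Sum>j<N. if i = 0 then if j = 0 then 1 else 0 else (0 :: cps2)) = (if i = 0 then 1 else 0)" for i :: nat
      using False by (cases "i = 0") (simp_all add: sum.delta)
    then have "XY_sum N c = 1" using False unfolding XY_sum_def t by (simp add: sum.delta)
    then show ?thesis by (simp add: vanishes_to_0)
  qed (simp add: vanishes_to_zero)
  then show ?case by blast
next
  case (add p q)
  then obtain c c' where c: "vanishes_to N (p - XY_sum N c)" "vanishes_to N (q - XY_sum N c')" by blast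
  have "XY_sum N (\<lambda>i j. c i j + c' i j) = XY_sum N c + XY_sum N c'"
    by (simp add: XY_sum_def cps2_const_hom ring_distribs sum.distrib)
  then have "p + q - XY_sum N (\<lambda>i j. c i j + c' i j) = (p - XY_sum N c) + (q - XY_sum N c')" by simp
  then show ?case using vanishes_to_add[OF c] by metis
next
  case (scale p a)
  then obtain c where c: "vanishes_to N (p - XY_sum N c)" by blast
  have "XY_sum N (\<lambda>i j. a * c i j) = cps2_const a * XY_sum N c"
    by (simp add: XY_sum_def cps2_const_hom sum_distrib_left mult.assoc)
  then have "cps2_const a * p - XY_sum N (\<lambda>i j. a * c i j) = cps2_const a * (p - XY_sum N c)"
    by (simp add: right_diff_distrib)
  then show ?case using vanishes_to_mult_left[OF c] by metis
next
  case (mult_X p)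
  then obtain c where c: "vanishes_to N (p - XY_sum N c)" by blast
  define c' where "c' = (\<lambda>i j. case i of 0 \<Rightarrow> 0 | Suc i \<Rightarrow> c i j)"
  define r where "r = (\<Sum>j<N. cps2_const (c' N j) * (X ^ N * Y ^ j))"
  have "XY_sum N c' + r = (\<Sum>i<Suc N. \<Sum>j<N. cps2_const (c' i j) * (X ^ i * Y ^ j))"
    by (simp add: XY_sum_def r_def)
  also have "\<dots> = X * XY_sum N c"
    by (subst sum.lessThan_Suc_shift) (simp add: XY_sum_def c'_def cps2_const_hom sum_distrib_left mult_ac)
  finally have "X * p - XY_sum N c' = X * (p - XY_sum N c) + r" by (simp add: algebra_simps)
  moreover have "vanishes_to N r" unfolding r_def
    by (intro vanishes_to_sum vanishes_to_mult_left vanishes_to_mono[OF XY_vanishes]) simp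
  ultimately show ?case using vanishes_to_add[OF vanishes_to_mult_left[OF c]] by metis
next
  case (mult_Y p)
  then obtain c where c: "vanishes_to N (p - XY_sum N c)" by blast
  define c' where "c' = (\<lambda>i j. case j of 0 \<Rightarrow> 0 | Suc j \<Rightarrow> c i j)"
  define r where "r = (\<Sum>i<N. cps2_const (c' i N) * (X ^ i * Y ^ N))"
  have "XY_sum N c' + r = (\<Sum>i<N. \<Sum>j<Suc N. cps2_const (c' i j) * (X ^ i * Y ^ j))"
    by (simp add: XY_sum_def r_def sum.distrib)
  also have "\<dots> = Y * XY_sum N c"
    by (subst sum.lessThan_Suc_shift) (simp add: XY_sum_def c'_def cps2_const_hom sum_distrib_left mult_ac)
  finally have "Y * p - XY_sum N c' = Y * (p - XY_sum N c) + r" by (simp add: algebra_simps)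
  moreover have "vanishes_to N r" unfolding r_def
    by (intro vanishes_to_sum vanishes_to_mult_left vanishes_to_mono[OF XY_vanishes]) simp
  ultimately show ?case using vanishes_to_add[OF vanishes_to_mult_left[OF c]] by metis
qed

lemma x_linear:
  "\<exists>a b. vanishes_to 2 (cps2_x1 - (cps2_const a * X + cps2_const b * Y))"
  "\<exists>a b. vanishes_to 2 (cps2_x2 - (cps2_const a * X + cps2_const b * Y))"
proof -
  have z: "cps2_coeff X 0 0 = 0" "cps2_coeff Y 0 0 = 0"
    using X_vanishes Y_vanishes by (auto simp: vanishes_to_def)
  define x10 x01 y10 y01 where c: "x10 = cps2_coeff X 1 0" "x01 = cps2_coeff X 0 1"
    "y10 = cps2_coeff Y 1 0" "y01 = cps2_coeff Y 0 1"
  have det: "x10 * y01 - x01 * y10 = 1 / jac" using XY_det by (simp add: c)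
  have det': "jac * (x10 * y01) - jac * (x01 * y10) = 1"
    unfolding right_diff_distrib[symmetric] det using jac_nz by simp
  have v: "vanishes_to 2 h" if "cps2_coeff h 0 0 = 0" "cps2_coeff h 1 0 = 0" "cps2_coeff h 0 1 = 0" for h
    using linear_part[OF that(1)] that by (simp add: cps2_const_hom)
  show "\<exists>a b. vanishes_to 2 (cps2_x1 - (cps2_const a * X + cps2_const b * Y))"
    by (rule exI[of _ "jac * y01"], rule exI[of _ "- jac * x01"], rule v)
       (use det' in \<open>unfold cps2_coeff_simps cps2_x_coeff z c[symmetric], auto simp: algebra_simps\<close>)
  show "\<exists>a b. vanishes_to 2 (cps2_x2 - (cps2_const a * X + cps2_const b * Y))"
    by (rule exI[of _ "- jac * y10"], rule exI[of _ "jac * x10"], rule v)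
       (use det' in \<open>unfold cps2_coeff_simps cps2_x_coeff z c[symmetric], auto simp: algebra_simps\<close>)
qed

lemma x_vanishes: "vanishes_to 1 cps2_x1" "vanishes_to 1 cps2_x2"
  by (auto simp: vanishes_to_def cps2_x_coeff)

lemma XY_approx_step:
  assumes x: "vanishes_to 1 x" "\<exists>a b. vanishes_to 2 (x - (cps2_const a * X + cps2_const b * Y))"
    and r: "vanishes_to k r" "\<exists>p\<in>XY_polys. vanishes_to (Suc k) (r - p)"
  shows "\<exists>p\<in>XY_polys. vanishes_to (Suc (Suc k)) (x * r - p)"
proof -
  obtain a b where ab: "vanishes_to 2 (x - (cps2_const a * X + cps2_const b * Y))" using x by blast
  obtain p where p: "p \<in> XY_polys" "vanishes_to (Suc k) (r - p)" using r by blast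
  have "vanishes_to k p"
    using vanishes_to_diff[OF r(1) vanishes_to_mono[OF p(2), of k]] by simp
  then have "vanishes_to (Suc (Suc k)) (x * (r - p) + (x - (cps2_const a * X + cps2_const b * Y)) * p)"
    using vanishes_to_mult[OF x(1) p(2)] vanishes_to_mult[OF ab, of k p] by (intro vanishes_to_add) auto
  moreover have "x * (r - p) + (x - (cps2_const a * X + cps2_const b * Y)) * p
     = x * r - (cps2_const a * (X * p) + cps2_const b * (Y * p))" by (simp add: algebra_simps)
  moreover have "cps2_const a * (X * p) + cps2_const b * (Y * p) \<in> XY_polys"
    by (intro XY_polys.intros p)
  ultimately show ?thesis by metis
qed

lemma XY_approx_monomial: "\<exists>p\<in>XY_polys. vanishes_to (Suc (i + j)) (cps2_x1 ^ i * cps2_x2 ^ j - p)"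
proof (induction i)
  case 0
  show ?case
  proof (induction j)
    case 0
    show ?case by (rule bexI[of _ 1]) (auto simp: vanishes_to_0 XY_polys.one)
  next
    case (Suc j)
    then show ?case
      using XY_approx_step[OF x_vanishes(2) x_linear(2) vanishes_to_power[OF x_vanishes(2), of j]] by simp
  qed
next
  case (Suc i)
  then show ?case
    using XY_approx_step[OF x_vanishes(1) x_linear(1)
      vanishes_to_mult[OF vanishes_to_power[OF x_vanishes(1), of i] vanishes_to_power[OF x_vanishes(2), of j]]]
    by (simp add: mult.assoc)
qed

lemma coeff_monomial: "cps2_coeff (cps2_x1 ^ i * cps2_x2 ^ j) a b = (if a = i \<and> b = j then 1 else 0)"
proof -
  have "fps_of_cps2 (cps2_x1 ^ i * cps2_x2 ^ j) = fps_const (fps_X ^ i) * fps_X ^ j"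
    by (simp add: ring_homoD[OF ring_homo_fps_of_cps2] cps2_x1.rep_eq cps2_x2.rep_eq)
  then show ?thesis by (auto simp: cps2_coeff_def fps_X_power_nth)
qed

text \<open>
  Since \<open>X\<close> and \<open>Y\<close> generate the maximal ideal modulo its square, polynomials in \<open>X\<close> and \<open>Y\<close>
  approximate every element of \<open>\<O>\<^sub>2\<close> to any order.
\<close>

lemma XY_approx: "\<exists>p\<in>XY_polys. vanishes_to N (r - p)"
proof (induction N)
  case 0
  show ?case by (rule bexI[of _ 1]) (auto simp: vanishes_to_zero XY_polys.one)
next
  case (Suc N)
  then obtain p where p: "p \<in> XY_polys" "vanishes_to N (r - p)" by blast
  define h where "h = r - p"
  have "\<exists>q. \<forall>i. q i \<in> XY_polys \<and> vanishes_to (Suc (i + (N - i))) (cps2_x1 ^ i * cps2_x2 ^ (N - i) - q i)"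
    using XY_approx_monomial by (intro choice) blast
  then obtain q where q: "\<And>i. q i \<in> XY_polys"
    "\<And>i. vanishes_to (Suc (i + (N - i))) (cps2_x1 ^ i * cps2_x2 ^ (N - i) - q i)" by blast
  define s where "s = (\<Sum>i\<le>N. cps2_const (cps2_coeff h i (N - i)) * q i)"
  have s: "s \<in> XY_polys" unfolding s_def by (intro XY_polys_sum XY_polys.scale q)
  define t where "t = (\<Sum>i\<le>N. cps2_const (cps2_coeff h i (N - i)) * (cps2_x1 ^ i * cps2_x2 ^ (N - i)))"
  have ct: "cps2_coeff (sum g S) a b = (\<Sum>i\<in>S. cps2_coeff (g i) a b)" for g a b and S :: "nat set"
    by (induction S rule: infinite_finite_induct) (auto simp: cps2_coeff_simps)
  have ht: "vanishes_to (Suc N) (h - t)"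
    unfolding vanishes_to_def
  proof (intro allI impI)
    fix i j assume ij: "i + j < Suc N"
    have "cps2_coeff t i j = (\<Sum>a\<le>N. if a = i then if j = N - i then cps2_coeff h i j else 0 else 0)"
      unfolding t_def ct by (intro sum.cong refl) (auto simp: cps2_coeff_simps coeff_monomial)
    also have "\<dots> = (if i + j = N then cps2_coeff h i j else 0)" using ij by (auto simp: sum.delta)
    also have "\<dots> = cps2_coeff h i j" using p(2) ij by (auto simp: vanishes_to_def h_def)
    finally show "cps2_coeff (h - t) i j = 0" by (simp add: cps2_coeff_simps)
  qed
  have "t - s = (\<Sum>i\<le>N. cps2_const (cps2_coeff h i (N - i)) * (cps2_x1 ^ i * cps2_x2 ^ (N - i) - q i))"
    by (simp add: t_def s_def sum_subtractf right_diff_distrib)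
  moreover have "vanishes_to (Suc N) \<dots>"
  proof (intro vanishes_to_sum vanishes_to_mult_left)
    fix i assume "i \<in> {..N}"
    then show "vanishes_to (Suc N) (cps2_x1 ^ i * cps2_x2 ^ (N - i) - q i)" using q(2)[of i] by simp
  qed
  ultimately have "vanishes_to (Suc N) ((h - t) + (t - s))" using ht vanishes_to_add by metis
  then have "vanishes_to (Suc N) (r - (p + s))" by (simp add: h_def algebra_simps)
  then show ?case using XY_polys.add[OF p(1) s] by blast
qed

text \<open>
  This bounds the weighted order of \<open>f\<close> by its multiplicity. The initial forms \<open>z\<^sup>j t\<^sup>n\<^sup>i\<^sup>+\<^sup>m\<^sup>j\<close> of the monomials
  \<open>X\<^sup>i Y\<^sup>j\<close> are linearly independent, so in an approximation of \<open>h\<close> by a polynomial in \<open>X\<close> and \<open>Y\<close> every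
  monomial has weight above \<open>n m\<close>, and such a monomial has degree above \<open>n\<close> because \<open>n < m\<close>.
\<close>

lemma \<Psi>_reflects_order:
  assumes h: "order_ge (Suc (n * m)) (\<Psi> h)"
  shows "vanishes_to (Suc n) h"
proof -
  define N where "N = Suc m"
  obtain p where p: "p \<in> XY_polys" "vanishes_to N (h - p)" using XY_approx by blast
  obtain c where c: "vanishes_to N (p - XY_sum N c)" using XY_polys_form[OF p(1)] by blast
  have hq: "vanishes_to N (h - XY_sum N c)" using vanishes_to_add[OF p(2) c] by simp
  have "n * N \<ge> Suc (n * m)" using n1 by (simp add: N_def)
  then have "order_ge (Suc (n * m)) (\<Psi> (h - XY_sum N c))" using \<Psi>_order[OF hq] order_ge_mono by blast
  with h have Q: "order_ge (Suc (n * m)) (\<Psi> (XY_sum N c))"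
    unfolding order_ge_def \<Psi>_simps by simp
  have c0: "c i j = 0" if "i < N" "j < N" "n * i + m * j = e" "e \<le> n * m" for i j e
    using that
  proof (induction e arbitrary: i j rule: less_induct)
    case (less e i j)
    have t: "coeff (\<Psi> (cps2_const (c a b) * (X ^ a * Y ^ b)) $ e) j
       = (if a = i then if b = j then c i j else 0 else 0)" if ab: "a < N" "b < N" for a b
    proof -
      have E: "coeff (\<Psi> (cps2_const (c a b) * (X ^ a * Y ^ b)) $ e) j = c a b * coeff (\<Psi> (X ^ a * Y ^ b) $ e) j"
        by (subst \<Psi>_simps(3)) (simp add: \<Psi>_const)
      consider "n * a + m * b < e" | "n * a + m * b = e" | "n * a + m * b > e" by linarith
      then show ?thesis
      proof cases
        case 1
        then have "c a b = 0" using less.IH[OF 1 ab] less.prems by simp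
        then show ?thesis unfolding E using 1 less.prems by auto
      next
        case 2
        show ?thesis
        proof (cases "b = j")
          case True
          then have "n * a + m * j = n * i + m * j" using 2 less.prems(3) by simp
          then have "a = i" using n1 by simp
          then show ?thesis unfolding E using \<Psi>_XY(2)[of a b] 2 True by simp
        qed (use \<Psi>_XY(2)[of a b] 2 E in simp)
      next
        case 3
        then have "\<Psi> (X ^ a * Y ^ b) $ e = 0" using \<Psi>_XY(1)[of a b] by (simp add: order_ge_def)
        then show ?thesis unfolding E using 3 less.prems by auto
      qed
    qed
    have "coeff (\<Psi> (XY_sum N c) $ e) j = (\<Sum>a<N. \<Sum>b<N. coeff (\<Psi> (cps2_const (c a b) * (X ^ a * Y ^ b)) $ e) j)"
      unfolding XY_sum_def \<Psi>_simps(8) fps_sum_nth coeff_sum ..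
    also have "\<dots> = (\<Sum>a<N. \<Sum>b<N. if a = i then if b = j then c i j else 0 else 0)"
      by (intro sum.cong refl t) auto
    also have "\<dots> = (\<Sum>a<N. if a = i then c i j else 0)"
      using less.prems(2) by (intro sum.cong refl) (simp add: sum.delta)
    also have "\<dots> = c i j" using less.prems(1) by (simp add: sum.delta)
    finally show ?case using Q less.prems by (simp add: order_ge_def)
  qed
  have "vanishes_to (Suc n) (XY_sum N c)"
    unfolding XY_sum_def
  proof (intro vanishes_to_sum)
    fix i j assume ij: "i \<in> {..<N}" "j \<in> {..<N}"
    show "vanishes_to (Suc n) (cps2_const (c i j) * (X ^ i * Y ^ j))"
    proof (cases "n * i + m * j \<le> n * m")
      case True
      then have "c i j = 0" using c0[of i j] ij by auto
      then show ?thesis by (simp add: cps2_const_hom vanishes_to_0)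
    next
      case False
      have "n * i \<le> m * i" using nm by (intro mult_le_mono1) simp
      then have "n * m < m * (i + j)" using False unfolding distrib_left by linarith
      then have "m * n < m * (i + j)" by (simp add: mult.commute)
      then have "Suc n \<le> i + j" by simp
      then show ?thesis by (intro vanishes_to_mult_left vanishes_to_mono[OF XY_vanishes])
    qed
  qed
  moreover have "vanishes_to (Suc n) (h - XY_sum N c)"
    by (rule vanishes_to_mono[OF hq]) (use nm in \<open>simp add: N_def\<close>)
  ultimately show ?thesis using vanishes_to_add[of "Suc n" "h - XY_sum N c" "XY_sum N c"] by simp
qed

end

section \<open>Regularised Beta integrals\<close>

lemma additive_monom_eq_0:
  fixes T :: "complex poly \<Rightarrow> complex"
  assumes "\<And>p q. T (p + q) = T p + T q" "\<And>a j. T (monom a j) = 0"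
  shows "T p = 0"
proof -
  have "T 0 = 0" using assms(1)[of 0 0] by simp
  then have "T (sum g S) = (\<Sum>i\<in>S. T (g i))" for g and S :: "nat set"
    by (induction S rule: infinite_finite_induct) (auto simp: assms)
  then have "T (\<Sum>i\<le>degree p. monom (coeff p i) i) = 0" by (simp add: assms)
  then show ?thesis by (simp add: poly_as_sum_of_monoms)
qed

text \<open>
  The integrals of \<open>z\<^sup>j (c (z\<^sup>n - 1))\<^sup>\<sigma>\<^sup>-\<^sup>k dz\<close> over \<open>[0, 1]\<close>, analytically continued in \<open>\<sigma>\<close>. That \<open>\<sigma>\<close> is not
  an integer keeps the Gamma factors finite for all \<open>k\<close>.
\<close>

locale twisted_period =
  fixes n :: nat and \<sigma> c :: complex
  assumes n0: "0 < n" and c0: "c \<noteq> 0" and \<sigma>: "\<sigma> \<notin> \<int>"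
begin

text \<open>
  Up to a factor that depends on \<open>n\<close>, \<open>c\<close> and \<open>\<sigma>\<close> only, this is
  \<open>\<integral>\<^sub>0\<^sup>1 z\<^sup>j (c (z\<^sup>n - 1))\<^sup>\<sigma>\<^sup>-\<^sup>k dz\<close> by the substitution \<open>w = z\<^sup>n\<close>. For \<open>n\<close> dividing \<open>j + 1\<close> the value \<open>0\<close>
  is imposed. This is consistent because multiplication by \<open>z\<^sup>n - 1\<close> and integration by parts respect
  the class of \<open>j + 1\<close> modulo \<open>n\<close>, and it removes the one boundary term at \<open>z = 0\<close>, which belongs to
  the derivative of \<open>(z\<^sup>n - 1)\<^sup>\<sigma>\<^sup>-\<^sup>k\<close> itself.
\<close>

definition beta :: "nat \<Rightarrow> nat \<Rightarrow> complex" where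
  "beta k j = (if n dvd Suc j then 0 else
     inverse (- c) ^ k * Gamma (of_nat (Suc j) / of_nat n) * Gamma (\<sigma> - of_nat k + 1)
       * rGamma (of_nat (Suc j) / of_nat n + \<sigma> - of_nat k + 1))"

definition period :: "nat \<Rightarrow> complex poly \<Rightarrow> complex" where
  "period k p = (\<Sum>j\<le>degree p. coeff p j * beta k j)"

definition base :: "complex poly" where "base = smult c (monom 1 n - 1)"

lemma period_eq: "degree p \<le> N \<Longrightarrow> period k p = (\<Sum>j\<le>N. coeff p j * beta k j)"
  unfolding period_def by (rule sum.mono_neutral_left) (auto simp: coeff_eq_0)

lemma period_add: "period k (p + q) = period k p + period k q"
proof -
  define N where "N = max (degree p) (degree q)"
  have "degree (p + q) \<le> N" by (simp add: N_def degree_add_le_max)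
  then show ?thesis
    by (simp add: period_eq[of _ N] N_def sum.distrib ring_distribs)
qed

lemma period_smult: "period k (smult a p) = a * period k p"
proof -
  have "period k (smult a p) = (\<Sum>j\<le>degree p. coeff (smult a p) j * beta k j)"
    by (rule period_eq) (rule degree_smult_le)
  then show ?thesis by (simp add: period_def sum_distrib_left mult.assoc)
qed

lemma period_0: "period k 0 = 0" by (simp add: period_def)

lemma period_monom: "period k (monom a j) = a * beta k j"
proof -
  have "period k (monom a j) = (\<Sum>i\<le>j. coeff (monom a j) i * beta k i)"
    by (rule period_eq[OF degree_monom_le])
  also have "\<dots> = (\<Sum>i\<le>j. if i = j then a * beta k j else 0)" by (intro sum.cong) auto
  finally show ?thesis by simp
qed

lemma \<sigma>_shift: "\<sigma> - of_nat k \<notin> \<int>"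
proof
  assume "\<sigma> - of_nat k \<in> \<int>"
  then have "(\<sigma> - of_nat k) + of_nat k \<in> \<int>" by (intro Ints_add) auto
  with \<sigma> show False by simp
qed

lemma Gamma_\<sigma>: "Gamma (\<sigma> - of_nat k + 1) = (\<sigma> - of_nat k) * Gamma (\<sigma> - of_nat k)"
proof (rule Gamma_plus1)
  show "\<sigma> - of_nat k \<notin> \<int>\<^sub>\<le>\<^sub>0" using \<sigma>_shift nonpos_Ints_Int by blast
qed

lemma pos_u: "complex_of_nat (Suc j) / of_nat n \<notin> \<int>\<^sub>\<le>\<^sub>0"
proof
  assume "complex_of_nat (Suc j) / of_nat n \<in> \<int>\<^sub>\<le>\<^sub>0"
  then have "complex_of_real (real (Suc j) / real n) \<in> \<int>\<^sub>\<le>\<^sub>0" by simp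
  then have "real (Suc j) / real n \<le> 0"
    by (metis of_real_in_nonpos_Ints_iff nonpos_Ints_nonpos)
  then show False using n0 by (simp add: divide_le_0_iff)
qed

text \<open>
  The integrand on the left is \<open>c (z\<^sup>n - 1)\<close> times \<open>z\<^sup>j (c (z\<^sup>n - 1))\<^sup>\<sigma>\<^sup>-\<^sup>k\<^sup>-\<^sup>1\<close>.
\<close>

lemma beta_shift: "c * (beta (Suc k) (j + n) - beta (Suc k) j) = beta k j"
proof (cases "n dvd Suc j")
  case True
  then have "n dvd Suc (j + n)" by (metis add_Suc dvd_add_triv_right_iff)
  then show ?thesis using True by (simp add: beta_def)
next
  case False
  then have False': "\<not> n dvd Suc (j + n)" by (metis add_Suc dvd_add_triv_right_iff)
  define u where "u = complex_of_nat (Suc j) / of_nat n"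
  define \<tau> where "\<tau> = \<sigma> - of_nat k"
  have u1: "complex_of_nat (Suc (j + n)) / of_nat n = u + 1"
    using n0 by (simp add: u_def field_simps)
  have t1: "\<sigma> - of_nat (Suc k) + 1 = \<tau>" by (simp add: \<tau>_def)
  have t2: "u + \<sigma> - of_nat (Suc k) + 1 = u + \<tau>" "u + 1 + \<sigma> - of_nat (Suc k) + 1 = u + \<tau> + 1" "u + \<sigma> - of_nat k + 1 = u + \<tau> + 1"
    by (simp_all add: \<tau>_def)
  have G: "Gamma (u + 1) = u * Gamma u" unfolding u_def by (rule Gamma_plus1[OF pos_u])
  have r: "rGamma (u + \<tau>) = (u + \<tau>) * rGamma (u + \<tau> + 1)" using rGamma_plus1[of "u + \<tau>"] by simp
  have cc: "c * inverse (- c) ^ Suc k = - (inverse (- c) ^ k)" using c0 by simp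
  have "c * (beta (Suc k) (j + n) - beta (Suc k) j)
     = (c * inverse (- c) ^ Suc k) * (Gamma (u + 1) * Gamma \<tau> * rGamma (u + \<tau> + 1) - Gamma u * Gamma \<tau> * rGamma (u + \<tau>))"
    unfolding beta_def using False False' unfolding u1 u_def[symmetric] t1 t2 by (simp add: algebra_simps)
  also have "\<dots> = inverse (- c) ^ k * Gamma u * (\<tau> * Gamma \<tau>) * rGamma (u + \<tau> + 1)"
    unfolding cc G r by (simp add: algebra_simps)
  also have "\<dots> = beta k j"
    unfolding beta_def u_def[symmetric] t2 using False Gamma_\<sigma>[of k] by (simp add: \<tau>_def)
  finally show ?thesis .
qed

text \<open>
  The integral of the derivative of \<open>z\<^sup>j\<^sup>+\<^sup>1 (c (z\<^sup>n - 1))\<^sup>\<sigma>\<^sup>-\<^sup>k\<close> is zero.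
\<close>

lemma beta_exact: "of_nat (Suc j) * beta k j + (\<sigma> - of_nat k) * c * of_nat n * beta (Suc k) (j + n) = 0"
proof (cases "n dvd Suc j")
  case True
  then have "n dvd Suc (j + n)" by (metis add_Suc dvd_add_triv_right_iff)
  then show ?thesis using True by (simp add: beta_def)
next
  case False
  then have False': "\<not> n dvd Suc (j + n)" by (metis add_Suc dvd_add_triv_right_iff)
  define u where "u = complex_of_nat (Suc j) / of_nat n"
  define \<tau> where "\<tau> = \<sigma> - of_nat k"
  have u1: "complex_of_nat (Suc (j + n)) / of_nat n = u + 1"
    using n0 by (simp add: u_def field_simps)
  have t1: "\<sigma> - of_nat (Suc k) + 1 = \<tau>" by (simp add: \<tau>_def)
  have t2: "u + 1 + \<sigma> - of_nat (Suc k) + 1 = u + \<tau> + 1" "u + \<sigma> - of_nat k + 1 = u + \<tau> + 1"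
    by (simp_all add: \<tau>_def)
  have G: "Gamma (u + 1) = u * Gamma u" unfolding u_def by (rule Gamma_plus1[OF pos_u])
  have cc: "c * inverse (- c) ^ Suc k = - (inverse (- c) ^ k)" using c0 by simp
  have un: "complex_of_nat (Suc j) = of_nat n * u" using n0 by (simp add: u_def)
  have b1: "beta (Suc k) (j + n) = inverse (- c) ^ Suc k * Gamma (u + 1) * Gamma \<tau> * rGamma (u + \<tau> + 1)"
    unfolding beta_def u1 t1 t2 using False' by simp
  have b0: "beta k j = inverse (- c) ^ k * Gamma u * (\<tau> * Gamma \<tau>) * rGamma (u + \<tau> + 1)"
    unfolding beta_def u_def[symmetric] t2 using False Gamma_\<sigma>[of k] by (simp add: \<tau>_def)
  have "\<tau> * c * of_nat n * beta (Suc k) (j + n)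
    = (c * inverse (- c) ^ Suc k) * (of_nat n * \<tau> * Gamma (u + 1) * Gamma \<tau> * rGamma (u + \<tau> + 1))"
    unfolding b1 by (simp add: mult_ac)
  also have "\<dots> = - (of_nat n * u * beta k j)"
    unfolding cc b0 G by (simp add: mult_ac)
  finally show ?thesis unfolding un \<tau>_def[symmetric] by simp
qed

lemma base_monom: "base * monom a j = monom (c * a) (j + n) - monom (c * a) j"
proof -
  have "base * monom a j = smult c ((monom 1 n - 1) * monom a j)" by (simp add: base_def)
  also have "(monom 1 n - 1) * monom a j = monom a (n + j) - monom a j"
    by (simp add: left_diff_distrib mult_monom)
  finally show ?thesis by (simp add: smult_diff_right smult_monom add.commute)
qed

lemma period_diff: "period k (p - q) = period k p - period k q"
  using period_add[of k "p - q" q] by simp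

lemma period_base: "period (Suc k) (base * p) = period k p"
proof -
  define T where "T = (\<lambda>p. period (Suc k) (base * p) - period k p)"
  have "T p = 0"
  proof (rule additive_monom_eq_0)
    show "T (monom a j) = 0" for a j
      unfolding T_def using beta_shift[of k j] by (simp add: base_monom period_diff period_monom) (simp add: algebra_simps)
  qed (simp add: T_def ring_distribs period_add)
  then show ?thesis by (simp add: T_def)
qed

lemma period_exact: "period (Suc k) (base * pderiv p + smult (\<sigma> - of_nat k) (p * pderiv base)) = 0"
proof -
  have db: "pderiv base = monom (c * of_nat n) (n - 1)"
    by (simp add: base_def pderiv_smult pderiv_diff pderiv_monom smult_monom)
  define T where "T = (\<lambda>p. period (Suc k) (base * pderiv p + smult (\<sigma> - of_nat k) (p * pderiv base)))"
  have "T p = 0"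
  proof (rule additive_monom_eq_0)
    fix a j
    show "T (monom a j) = 0"
    proof (cases j)
      case 0
      have "n dvd Suc (n - 1)" using n0 by simp
      then have "beta (Suc k) (n - 1) = 0" by (simp add: beta_def)
      then show ?thesis using 0
        by (simp add: T_def db pderiv_monom period_0 period_add period_smult period_monom mult_monom)
    next
      case (Suc i)
      have e: "Suc i + (n - 1) = i + n" using n0 by simp
      have "period (Suc k) (base * pderiv (monom a j) + smult (\<sigma> - of_nat k) (monom a j * pderiv base))
        = a * (of_nat (Suc i) * beta k i + (\<sigma> - of_nat k) * c * of_nat n * beta (Suc k) (i + n))"
        unfolding db pderiv_monom Suc mult_monom e period_add period_base period_smult period_monom
        by (simp add: algebra_simps)
      then show ?thesis by (simp only: T_def beta_exact mult_zero_right)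
    qed
  qed (simp add: T_def pderiv_add ring_distribs period_add smult_add_right)
  then show ?thesis by (simp add: T_def)
qed

end

section \<open>The residue functional\<close>

definition euler :: "'a::comm_ring_1 fps \<Rightarrow> 'a fps" where "euler G = fps_X * fps_deriv G"

lemma euler_nth: "euler G $ k = of_nat k * G $ k"
  by (cases k) (simp_all add: euler_def)

lemma derivation_euler: "derivation euler"
  by (simp add: derivation_def euler_def algebra_simps)

abbreviation dz :: "complex poly fps \<Rightarrow> complex poly fps" where "dz \<equiv> fps_map pderiv"

lemma derivation_dz: "derivation dz"
  by (rule derivation_fps_map) (simp add: derivation_def pderiv_add pderiv_mult algebra_simps)

lemma euler_dz: "euler (dz G) = dz (euler G)"
  by (rule fps_ext) (simp add: euler_nth pderiv_mult)

lemma gchoose_absorb: "(\<tau> - of_nat r) * (\<tau> gchoose r) = \<tau> * ((\<tau> - 1) gchoose r)" for \<tau> :: complex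
proof -
  have "(\<tau> - of_nat r) * (\<tau> gchoose r) = of_nat (Suc r) * (\<tau> gchoose Suc r)"
    using gbinomial_absorb_comp[of \<tau> r] gbinomial_absorption[of r \<tau>] by (simp add: algebra_simps)
  also have "\<dots> = \<tau> * ((\<tau> - 1) gchoose r)" using gbinomial_absorption[of r \<tau>] by simp
  finally show ?thesis .
qed

text \<open>
  For \<open>\<Psi> f = t\<^sup>n\<^sup>m F\<close> the leading coefficient of \<open>F\<close> is \<open>base = c (z\<^sup>n - 1)\<close>, and \<open>F\<^sup>\<tau>\<close> is expanded
  by the binomial series in \<open>U = F - base\<close>.
\<close>

locale residue = twisted_period +
  fixes F :: "complex poly fps"
  assumes F0: "F $ 0 = base"
begin

definition U :: "complex poly fps" where "U = F - fps_const base"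

lemma U_order: "order_ge (r * 1) (U ^ r)"
  using order_ge_power(1)[of 1 U r] F0 by (simp add: order_ge_def U_def)

text \<open>
  The period of the coefficient of \<open>t\<^sup>e\<close> in \<open>G F\<^sup>\<sigma>\<^sup>-\<^sup>k\<close>. As \<open>U\<^sup>r\<close> is divisible by \<open>t\<^sup>r\<close>, the summation may stop
  at \<open>r = e\<close>.
\<close>

definition res :: "nat \<Rightarrow> nat \<Rightarrow> complex poly fps \<Rightarrow> complex" where
  "res k e G = (\<Sum>r\<le>e. ((\<sigma> - of_nat k) gchoose r) * period (k + r) ((G * U ^ r) $ e))"

lemma GU_0: "e < r \<Longrightarrow> (G * U ^ r) $ e = 0"
  using order_ge_mult(1)[of 0 G r "U ^ r"] U_order[of r] by (simp add: order_ge_def)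

lemma res_eq: "e \<le> N \<Longrightarrow> res k e G = (\<Sum>r\<le>N. ((\<sigma> - of_nat k) gchoose r) * period (k + r) ((G * U ^ r) $ e))"
  unfolding res_def by (rule sum.mono_neutral_left) (auto simp: GU_0 period_0)

lemma res_add: "res k e (G + H) = res k e G + res k e H"
  by (simp add: res_def ring_distribs period_add sum.distrib)

lemma res_diff: "res k e (G - H) = res k e G - res k e H"
  using res_add[of k e "G - H" H] by simp

lemma res_smult: "res k e (fps_const [:a:] * G) = a * res k e G"
proof -
  have "(fps_const [:a:] * G * U ^ r) $ e = smult a ((G * U ^ r) $ e)" for r
    by (simp only: mult.assoc fps_mult_left_const_nth) simp
  then show ?thesis by (simp add: res_def period_smult sum_distrib_left mult.left_commute)
qed

lemma res_shift: "res k (e + d) (fps_X ^ d * G) = res k e G"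
proof -
  have "(fps_X ^ d * G * U ^ r) $ (e + d) = (G * U ^ r) $ e" for r
    by (simp add: mult.assoc fps_X_power_mult_nth)
  then show ?thesis using res_eq[of e "e + d" k G] by (simp add: res_def)
qed

lemma res_below: "order_ge (Suc e) G \<Longrightarrow> res k e G = 0"
  unfolding res_def
proof (intro sum.neutral ballI)
  fix r assume G: "order_ge (Suc e) G"
  have "order_ge (Suc e + r) (G * U ^ r)" using order_ge_mult(1)[OF G U_order[of r]] by simp
  then show "((\<sigma> - of_nat k) gchoose r) * period (k + r) ((G * U ^ r) $ e) = 0"
    by (simp add: order_ge_def period_0)
qed

lemma res_leading: "order_ge e G \<Longrightarrow> res k e G = period k (G $ e)"
proof -
  assume G: "order_ge e G"
  have "((\<sigma> - of_nat k) gchoose r) * period (k + r) ((G * U ^ r) $ e) = (if r = 0 then period k (G $ e) else 0)" for r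
  proof (cases r)
    case (Suc r')
    have "order_ge (e + r) (G * U ^ r)" using order_ge_mult(1)[OF G U_order[of r]] by simp
    then show ?thesis using Suc by (simp add: order_ge_def period_0)
  qed simp
  then show ?thesis by (simp add: res_def)
qed

lemma F_split: "F = fps_const base + U" by (simp add: U_def)

text \<open>
  Raising the exponent of \<open>F\<close> by one; on the binomial series this is Pascal's rule.
\<close>

lemma res_mult_F: "res (Suc k) e (F * G) = res k e G"
proof -
  let ?\<tau> = "\<sigma> - of_nat k"
  let ?p = "\<lambda>r. period (k + r) ((G * U ^ r) $ e)"
  have t: "\<sigma> - of_nat (Suc k) = ?\<tau> - 1" by simp
  have "res (Suc k) e (F * G) = (\<Sum>r\<le>e. ((?\<tau> - 1) gchoose r) * (?p r + ?p (Suc r)))"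
    unfolding res_def t
  proof (intro sum.cong refl arg_cong2[where f = "(*)"])
    fix r
    have "F * G * U ^ r = fps_const base * (G * U ^ r) + G * U ^ Suc r"
      by (subst F_split) (simp add: algebra_simps)
    then show "period (Suc k + r) ((F * G * U ^ r) $ e) = ?p r + ?p (Suc r)"
      by (simp add: period_add period_base)
  qed
  also have "\<dots> = (\<Sum>r\<le>e. ((?\<tau> - 1) gchoose r) * ?p r) + (\<Sum>r\<le>e. ((?\<tau> - 1) gchoose r) * ?p (Suc r))"
    by (simp add: ring_distribs sum.distrib)
  also have "(\<Sum>r\<le>e. ((?\<tau> - 1) gchoose r) * ?p r) = (\<Sum>r\<le>Suc e. ((?\<tau> - 1) gchoose r) * ?p r)"
    using GU_0[of e "Suc e" G] by (simp add: period_0 del: power_Suc)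
  also have "\<dots> = ?p 0 + (\<Sum>r\<le>e. ((?\<tau> - 1) gchoose Suc r) * ?p (Suc r))"
    by (subst sum.atMost_Suc_shift) simp
  also have "\<dots> + (\<Sum>r\<le>e. ((?\<tau> - 1) gchoose r) * ?p (Suc r))
     = ?p 0 + (\<Sum>r\<le>e. (?\<tau> gchoose Suc r) * ?p (Suc r))"
    using gbinomial_Suc_Suc[of "?\<tau> - 1"] by (simp add: sum.distrib[symmetric] ring_distribs add.commute)
  also have "\<dots> = (\<Sum>r\<le>Suc e. (?\<tau> gchoose r) * ?p r)"
    by (subst sum.atMost_Suc_shift) simp
  also have "\<dots> = res k e G" by (rule res_eq[symmetric]) simp
  finally show ?thesis .
qed

text \<open>
  On the left stands the derivative of \<open>G F\<^sup>\<sigma>\<^sup>-\<^sup>k\<close> by the product rule; on the right every term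
  \<open>G U\<^sup>r base\<^sup>\<sigma>\<^sup>-\<^sup>k\<^sup>-\<^sup>r\<close> of the binomial series is differentiated separately.
\<close>

lemma res_derivation:
  assumes d: "derivation d" and dU: "d U $ 0 = 0"
  shows "res k e (d G) + (\<sigma> - of_nat k) * res (Suc k) e (G * d F) =
    (\<Sum>r\<le>e. ((\<sigma> - of_nat k) gchoose r) *
       (period (k + r) (d (G * U ^ r) $ e)
        + (\<sigma> - of_nat k - of_nat r) * period (Suc (k + r)) ((G * U ^ r * d (fps_const base)) $ e)))"
proof -
  note D = derivationD[OF d]
  let ?\<tau> = "\<sigma> - of_nat k"
  have t: "\<sigma> - of_nat (Suc k) = ?\<tau> - 1" by simp
  let ?a = "\<lambda>r. period (k + r) ((d G * U ^ r) $ e)"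
  let ?b = "\<lambda>r. period (Suc (k + r)) ((G * U ^ r * d (fps_const base)) $ e)"
  let ?c = "\<lambda>r. period (Suc (k + r)) ((G * U ^ r * d U) $ e)"
  have cz: "?c e = 0"
  proof -
    have "order_ge (e + 1) (U ^ e * d U)"
      using order_ge_mult(1)[OF U_order[of e], of 1 "d U"] dU by (simp add: order_ge_def)
    then have "order_ge (0 + (e + 1)) (G * (U ^ e * d U))"
      by (rule order_ge_mult(1)[rotated]) (simp add: order_ge_def)
    then show ?thesis by (simp add: order_ge_def period_0 mult.assoc)
  qed
  have Leib: "period (k + r) (d (G * U ^ r) $ e) = ?a r + (case r of 0 \<Rightarrow> 0 | Suc i \<Rightarrow> of_nat r * ?c i)" for r
  proof (cases r)
    case 0
    then show ?thesis by (simp add: D)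
  next
    case (Suc i)
    have "d (G * U ^ r) = d G * U ^ r + of_nat r * (G * U ^ i * d U)"
      unfolding Suc by (subst D(2), subst D(8)) (simp only: mult_ac)
    also have "of_nat r = (fps_const [:of_nat r:] :: complex poly fps)"
      by (simp add: fps_of_nat[symmetric] of_nat_poly)
    finally have "d (G * U ^ r) $ e = (d G * U ^ r) $ e + smult (of_nat r) ((G * U ^ i * d U) $ e)" by simp
    then show ?thesis using Suc by (simp add: period_add period_smult)
  qed
  have "res (Suc k) e (G * d F) = (\<Sum>r\<le>e. ((?\<tau> - 1) gchoose r) * (?b r + ?c r))"
    unfolding res_def t
  proof (intro sum.cong refl arg_cong2[where f = "(*)"])
    fix r
    have "G * d F * U ^ r = G * U ^ r * d (fps_const base) + G * U ^ r * d U"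
      by (subst F_split) (simp add: D algebra_simps)
    then show "period (Suc k + r) ((G * d F * U ^ r) $ e) = ?b r + ?c r" by (simp add: period_add)
  qed
  then have "?\<tau> * res (Suc k) e (G * d F)
      = (\<Sum>r\<le>e. ?\<tau> * ((?\<tau> - 1) gchoose r) * ?b r) + (\<Sum>r\<le>e. ?\<tau> * ((?\<tau> - 1) gchoose r) * ?c r)"
    by (simp add: sum_distrib_left ring_distribs sum.distrib mult.assoc)
  also have "(\<Sum>r\<le>e. ?\<tau> * ((?\<tau> - 1) gchoose r) * ?b r) = (\<Sum>r\<le>e. (?\<tau> gchoose r) * ((?\<tau> - of_nat r) * ?b r))"
    by (intro sum.cong refl) (simp only: gchoose_absorb[symmetric] mult_ac)
  also have "(\<Sum>r\<le>e. ?\<tau> * ((?\<tau> - 1) gchoose r) * ?c r)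
     = (\<Sum>r\<le>e. (?\<tau> gchoose Suc r) * (of_nat (Suc r) * ?c r))"
    by (intro sum.cong refl) (simp only: gbinomial_absorption[symmetric] mult_ac)
  also have "\<dots> = (\<Sum>r\<le>Suc e. (?\<tau> gchoose r) * (case r of 0 \<Rightarrow> 0 | Suc i \<Rightarrow> of_nat r * ?c i))"
    by (subst sum.atMost_Suc_shift) simp
  also have "\<dots> = (\<Sum>r\<le>e. (?\<tau> gchoose r) * (case r of 0 \<Rightarrow> 0 | Suc i \<Rightarrow> of_nat r * ?c i))
       + (?\<tau> gchoose Suc e) * (of_nat (Suc e) * ?c e)"
    by simp
  finally have "?\<tau> * res (Suc k) e (G * d F) =
    (\<Sum>r\<le>e. (?\<tau> gchoose r) * ((?\<tau> - of_nat r) * ?b r)) +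
    ((\<Sum>r\<le>e. (?\<tau> gchoose r) * (case r of 0 \<Rightarrow> 0 | Suc i \<Rightarrow> of_nat r * ?c i))
       + (?\<tau> gchoose Suc e) * (of_nat (Suc e) * ?c e))" .
  moreover have "res k e (d G) = (\<Sum>r\<le>e. (?\<tau> gchoose r) * ?a r)" by (simp add: res_def)
  ultimately have "res k e (d G) + ?\<tau> * res (Suc k) e (G * d F) =
    (\<Sum>r\<le>e. (?\<tau> gchoose r) * ?a r) + ((\<Sum>r\<le>e. (?\<tau> gchoose r) * ((?\<tau> - of_nat r) * ?b r)) +
      (\<Sum>r\<le>e. (?\<tau> gchoose r) * (case r of 0 \<Rightarrow> 0 | Suc i \<Rightarrow> of_nat r * ?c i)))"
    by (simp only: cz mult_zero_right add_0_right)
  also have "\<dots> = (\<Sum>r\<le>e. (?\<tau> gchoose r) * (period (k + r) (d (G * U ^ r) $ e) + (?\<tau> - of_nat r) * ?b r))"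
    unfolding Leib sum.distrib[symmetric] by (intro sum.cong refl) (simp only: ring_distribs add_ac)
  finally show ?thesis .
qed

lemma res_dz: "res k e (dz G) + (\<sigma> - of_nat k) * res (Suc k) e (G * dz F) = 0"
proof -
  have "period (k + r) (dz (G * U ^ r) $ e)
      + (\<sigma> - of_nat k - of_nat r) * period (Suc (k + r)) ((G * U ^ r * dz (fps_const base)) $ e) = 0" for r
  proof -
    have "dz (fps_const base) = fps_const (pderiv base)" by (rule fps_ext) simp
    then show ?thesis
      using period_exact[of "k + r" "(G * U ^ r) $ e"]
      by (simp add: period_add period_base period_smult diff_diff_eq)
  qed
  moreover have "dz U $ 0 = 0" using F0 by (simp add: U_def)
  ultimately show ?thesis unfolding res_derivation[OF derivation_dz \<open>dz U $ 0 = 0\<close>] by simp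
qed

text \<open>
  The Euler field \<open>t d/dt\<close> multiplies the coefficient of \<open>t\<^sup>e\<close> by \<open>e\<close>, and \<open>base\<close> is constant in \<open>t\<close>.
\<close>

lemma res_euler: "res k e (euler G) + (\<sigma> - of_nat k) * res (Suc k) e (G * euler F) = of_nat e * res k e G"
proof -
  have "period (k + r) (euler (G * U ^ r) $ e)
      + (\<sigma> - of_nat k - of_nat r) * period (Suc (k + r)) ((G * U ^ r * euler (fps_const base)) $ e)
      = of_nat e * period (k + r) ((G * U ^ r) $ e)" for r
  proof -
    have "euler (fps_const base) = 0" by (simp add: euler_def)
    moreover have "of_nat e * p = smult (of_nat e) p" for p :: "complex poly"
      by (simp add: of_nat_poly)
    ultimately show ?thesis by (simp add: euler_nth period_smult period_0)
  qed
  moreover have "euler U $ 0 = 0" by (simp add: euler_nth)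
  ultimately show ?thesis unfolding res_derivation[OF derivation_euler \<open>euler U $ 0 = 0\<close>]
    by (simp add: res_def sum_distrib_left mult_ac)
qed

text \<open>
  Stokes' formula for \<open>d(H f\<^sup>\<sigma>\<^sup>-\<^sup>k dK)\<close> with \<open>f = t\<^sup>N F\<close>. The condition on \<open>e\<close> says that the residue is
  taken at total exponent zero of \<open>t\<close>, where \<open>t d/dt\<close> has no contribution.
\<close>

lemma res_stokes:
  assumes e: "of_nat e + (\<sigma> - of_nat k) * of_nat N = 0"
  shows "res (Suc k) (e + N) (fps_X ^ N * F * (euler H * dz K - dz H * euler K)
     + fps_const [:\<sigma> - of_nat k:] * (H * (euler (fps_X ^ N * F) * dz K - dz (fps_X ^ N * F) * euler K))) = 0"
proof -
  note DE = derivationD[OF derivation_euler] and DD = derivationD[OF derivation_dz]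
  define G2 where "G2 = H * dz K"
  define G1 where "G1 = H * euler K"
  let ?t = "fps_const [:\<sigma> - of_nat k:] :: complex poly fps"
  let ?N = "fps_const [:of_nat N:] :: complex poly fps"
  have xN: "euler (fps_X ^ N :: complex poly fps) = ?N * fps_X ^ N" "dz (fps_X ^ N) = 0"
    by (rule fps_ext; simp add: euler_nth fps_X_power_nth of_nat_poly pderiv_1)+
  have "fps_X ^ N * F * (euler H * dz K - dz H * euler K)
     + ?t * (H * (euler (fps_X ^ N * F) * dz K - dz (fps_X ^ N * F) * euler K))
    = fps_X ^ N * (F * (euler G2 - dz G1) + ?t * (?N * (F * G2) + G2 * euler F - G1 * dz F))"
    unfolding G2_def G1_def DE(2) DD(2) xN euler_dz by (simp add: algebra_simps)
  then have "res (Suc k) (e + N) (fps_X ^ N * F * (euler H * dz K - dz H * euler K)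
     + ?t * (H * (euler (fps_X ^ N * F) * dz K - dz (fps_X ^ N * F) * euler K)))
    = res k e (euler G2) - res k e (dz G1)
      + (\<sigma> - of_nat k) * (of_nat N * res k e G2 + res (Suc k) e (G2 * euler F) - res (Suc k) e (G1 * dz F))"
    by (simp only: res_shift res_add res_diff res_smult res_mult_F)
  also have "\<dots> = (res k e (euler G2) + (\<sigma> - of_nat k) * res (Suc k) e (G2 * euler F))
      - (res k e (dz G1) + (\<sigma> - of_nat k) * res (Suc k) e (G1 * dz F))
      + (\<sigma> - of_nat k) * of_nat N * res k e G2"
    by (simp add: algebra_simps)
  also have "\<dots> = (of_nat e + (\<sigma> - of_nat k) * of_nat N) * res k e G2"
    unfolding res_euler res_dz by (simp add: algebra_simps)
  finally show ?thesis using e by simp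
qed

end

section \<open>Restriction to the branch\<close>

lemma submonoid_gen_pair: "x \<in> submonoid_gen {a, b} \<longleftrightarrow> (\<exists>i j. x = a * i + b * j)"
proof
  show "\<exists>i j. x = a * i + b * j" if "x \<in> submonoid_gen {a, b}"
    using that
  proof induction
    case zero
    show ?case by (rule exI[of _ 0], rule exI[of _ 0]) simp
  next
    case (gen x)
    then consider "x = a * 1 + b * 0" | "x = a * 0 + b * 1" by auto
    then show ?case by cases blast+
  next
    case (add x y)
    then obtain i j i' j' where "x = a * i + b * j" "y = a * i' + b * j'" by blast
    then have "x + y = a * (i + i') + b * (j + j')" by (simp add: distrib_left)
    then show ?case by blast
  qed
  have mul: "a * i \<in> submonoid_gen {a, b}" "b * i \<in> submonoid_gen {a, b}" for i
    by (induction i) (auto intro: submonoid_gen.intros)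
  show "x \<in> submonoid_gen {a, b}" if "\<exists>i j. x = a * i + b * j"
    using that mul by (auto intro: submonoid_gen.add)
qed

text \<open>
  Only the multiplicity of \<open>f\<close> and the vanishing of \<open>f\<close> along the branch are recorded. That \<open>n\<close> and \<open>m\<close>
  are coprime will follow from the assumption on the semigroup.
\<close>

locale branch = chart +
  fixes \<phi>2 :: "complex fps" and f :: cps2 and \<gamma> :: curve
  assumes phi: "subdegree \<phi>2 = m" "\<phi>2 $ m = 1"
    and gam: "\<gamma> = (cps2_comp \<Phi>1 (fps_X ^ n, \<phi>2), cps2_comp \<Phi>2 (fps_X ^ n, \<phi>2))"
    and f_gam: "cps2_comp f \<gamma> = 0"
    and f_order: "vanishes_to n f" "\<not> vanishes_to (Suc n) f"
begin

text \<open>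
  In the chart the strict transform of the branch is \<open>t = T\<close>, \<open>z = \<zeta>(T)\<close>, and it meets the
  exceptional divisor at \<open>z = 1\<close>.
\<close>

definition \<zeta> :: "complex fps" where "\<zeta> = fps_shift m \<phi>2"

definition evz :: "complex poly \<Rightarrow> complex fps" where
  "evz p = poly (map_poly fps_const p) \<zeta>"

text \<open>
  Restriction of a series in the chart to the branch.
\<close>

definition Ev :: "complex poly fps \<Rightarrow> complex fps" where
  "Ev G = fps_eval fps_X (fps_map evz G)"

lemma \<zeta>_0: "\<zeta> $ 0 = 1" by (simp add: \<zeta>_def phi)

lemma \<phi>2_eq: "\<phi>2 = \<zeta> * fps_X ^ m"
  unfolding \<zeta>_def by (rule subdegree_decompose[of \<phi>2, unfolded phi])

lemma evz_hom: "ring_homo evz"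
proof -
  have "map_poly fps_const (p * q) = map_poly fps_const p * map_poly fps_const q" for p q :: "complex poly"
    by (rule map_poly_mult_hom) auto
  moreover have "map_poly fps_const (p + q) = map_poly fps_const p + map_poly fps_const q" for p q :: "complex poly"
    by (rule map_poly_add_hom) auto
  ultimately show ?thesis by (simp add: ring_homo_def evz_def)
qed

lemma evz_pCons: "evz (pCons a p) = fps_const a + \<zeta> * evz p"
  by (simp add: evz_def map_poly_pCons)

lemma evz_0 [simp]: "evz 0 = 0" by (simp add: evz_def)

lemma evz_nth_0: "evz p $ 0 = poly p 1"
  by (induction p) (simp_all add: evz_pCons \<zeta>_0)

lemma evz_deriv: "euler (evz p) = evz (pderiv p) * euler \<zeta>"
proof (induction p)
  case 0
  then show ?case by (simp add: euler_def)
next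
  case (pCons a p)
  note D = derivationD[OF derivation_euler]
  have "euler (evz (pCons a p)) = euler \<zeta> * evz p + \<zeta> * euler (evz p)"
    by (simp add: evz_pCons D) (simp add: euler_def)
  also have "\<dots> = (evz p + \<zeta> * evz (pderiv p)) * euler \<zeta>" by (simp add: pCons.IH algebra_simps)
  also have "evz p + \<zeta> * evz (pderiv p) = evz (pderiv (pCons a p))"
    by (simp add: pderiv_pCons ring_homoD[OF evz_hom] evz_pCons)
  finally show ?case .
qed

lemma Ev_hom: "ring_homo Ev"
  unfolding Ev_def by (rule ring_homo_comp[OF ring_homo_fps_eval ring_homo_fps_map[OF evz_hom]]) simp

lemmas Ev_simps = ring_homoD[OF Ev_hom]

lemma Ev_const: "Ev (fps_const p) = evz p"
proof -
  have "fps_map evz (fps_const p) = fps_const (evz p)" by (rule fps_ext) simp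
  then show ?thesis by (simp add: Ev_def)
qed

lemma Ev_pconst: "Ev (fps_const [:a:]) = fps_const a"
  by (simp add: Ev_const evz_pCons)

lemma Ev_nth: "Ev G $ d = (\<Sum>k\<le>d. evz (G $ k) $ (d - k))"
  by (simp add: Ev_def fps_eval_def fps_X_power_mult_right_nth not_less)

lemma Ev_X: "Ev fps_X = fps_X"
proof (rule fps_ext)
  fix d
  have "Ev fps_X $ d = (\<Sum>k\<le>d. if k = 1 then (1::complex fps) $ (d - 1) else 0)"
    unfolding Ev_nth by (intro sum.cong refl) (auto simp: fps_X_nth ring_homoD[OF evz_hom])
  also have "\<dots> = fps_X $ d" by (cases d) (auto simp: fps_X_nth)
  finally show "Ev fps_X $ d = fps_X $ d" .
qed

lemma Ev_order:
  assumes "order_ge k G"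
  shows "order_ge k (Ev G)" "Ev G $ k = poly (G $ k) 1"
proof -
  show "order_ge k (Ev G)" using assms unfolding order_ge_def Ev_nth
    by (intro allI impI sum.neutral) auto
  have "Ev G $ k = (\<Sum>i\<le>k. if i = k then poly (G $ k) 1 else 0)"
    unfolding Ev_nth by (intro sum.cong refl) (use assms in \<open>auto simp: order_ge_def evz_nth_0\<close>)
  then show "Ev G $ k = poly (G $ k) 1" by simp
qed

lemma Ev_euler: "euler (Ev G) = Ev (euler G) + Ev (dz G) * euler \<zeta>"
proof -
  have "fps_map euler (fps_map evz G) = fps_map evz (dz G) * fps_const (euler \<zeta>)"
    by (rule fps_ext) (simp add: evz_deriv)
  moreover have "fps_eval fps_X (fps_map evz (dz G) * fps_const (euler \<zeta>)) = Ev (dz G) * euler \<zeta>"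
    by (simp add: Ev_def fps_eval_mult)
  moreover have "fps_eval fps_X (fps_deriv (fps_map evz G)) * euler fps_X = Ev (euler G)"
    by (simp add: fps_deriv_fps_map[OF evz_hom] euler_def Ev_simps Ev_X mult.commute flip: Ev_def)
  ultimately show ?thesis
    using fps_eval_chain[OF _ _ derivation_euler, of "fps_X" "fps_map evz G"]
    by (simp add: euler_nth Ev_def add.commute)
qed

lemma base_comp_0: "(fps_X ^ n :: complex fps) $ 0 = 0" "\<phi>2 $ 0 = 0"
proof -
  show "(fps_X ^ n :: complex fps) $ 0 = 0" using n1 by (simp add: fps_X_power_nth)
  show "\<phi>2 $ 0 = 0" by (rule nth_less_subdegree_zero) (simp only: phi, use nm in simp)
qed

lemma Ev_wsub: "Ev (wsub h) = cps2_comp h (fps_X ^ n, \<phi>2)"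
proof -
  have e: "Ev (fps_X ^ n) = fps_X ^ n" "Ev (fps_const [:0, 1:] * fps_X ^ m) = \<phi>2"
    by (simp_all add: Ev_simps Ev_X Ev_const evz_pCons \<phi>2_eq[symmetric])
  have "Ev (wsub h) = psubst (\<lambda>x. x) (Ev (fps_X ^ n)) (Ev (fps_const [:0, 1:] * fps_X ^ m)) h"
    unfolding wsub_def
    by (rule psubst_commute[where e = Ev, OF wbase _ _ Ev_hom Ev_pconst]) (simp_all only: base_comp_0 e)
  then show ?thesis unfolding e using cps2_comp_eq_psubst[of "(fps_X ^ n, \<phi>2)" h] base_comp_0 by simp
qed

lemma gam_Ev: "fst \<gamma> = Ev P1" "snd \<gamma> = Ev P2"
  unfolding Ev_wsub gam by (rule fst_conv, rule snd_conv)

lemma Ev_P_0: "Ev P1 $ 0 = 0" "Ev P2 $ 0 = 0"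
  using Ev_order(1)[OF P_order(1)] Ev_order(1)[OF P_order(2)] n1 unfolding order_ge_def by blast+

lemma gam_0: "fst \<gamma> $ 0 = 0" "snd \<gamma> $ 0 = 0"
  unfolding gam_Ev by (rule Ev_P_0)+

text \<open>
  The parameterization of the branch factors through the blow-up chart.
\<close>

lemma Ev_\<Psi>: "Ev (\<Psi> h) = cps2_comp h \<gamma>"
proof -
  have "Ev (\<Psi> h) = psubst (\<lambda>x. x) (Ev P1) (Ev P2) h"
    unfolding \<Psi>_def
    by (rule psubst_commute[where e = Ev, OF P_0 Ev_P_0 Ev_hom Ev_pconst])
  then show ?thesis unfolding cps2_comp_eq_psubst[OF gam_0] gam_Ev .
qed

lemma Ev_\<Psi>f: "Ev (\<Psi> f) = 0" by (simp add: Ev_\<Psi> f_gam)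

section \<open>The value semigroup\<close>

text \<open>
  Elements divisible by \<open>f\<close> have order at least two, hence no linear terms in \<open>x\<close> and \<open>y\<close>. This
  makes the values of \<open>X\<close> and \<open>Y\<close> elements of the semigroup.
\<close>

lemma not_dvd:
  assumes "\<Psi> h $ m \<noteq> 0 \<or> \<Psi> h $ n \<noteq> 0" shows "\<not> f dvd h"
proof
  assume "f dvd h"
  then obtain q where "h = f * q" by blast
  then have "vanishes_to n h" using vanishes_to_mult_right[OF f_order(1)] by simp
  then have v: "vanishes_to 2 h" using n1 by (auto intro: vanishes_to_mono)
  have "\<Psi> h $ n = 0" using \<Psi>_order[OF v] n1 by (simp add: order_ge_def)
  with \<Psi>_at_m[OF v] assms show False by simp
qed

lemma n_in_semigroup: "n \<in> value_semigroup f \<gamma>"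
proof -
  have "subdegree (cps2_comp X \<gamma>) = n"
    unfolding Ev_\<Psi>[symmetric] by (rule order_ge_subdegree) (use X_props Ev_order[OF X_props(1)] in auto)
  moreover have "\<not> f dvd X" by (rule not_dvd) (use X_props in auto)
  ultimately show ?thesis unfolding value_semigroup_def by (metis (mono_tags, lifting) mem_Collect_eq)
qed

lemma m_in_semigroup: "m \<in> value_semigroup f \<gamma>"
proof -
  have "subdegree (cps2_comp Y \<gamma>) = m"
    unfolding Ev_\<Psi>[symmetric] by (rule order_ge_subdegree) (use Y_props Ev_order[OF Y_props(1)] in auto)
  moreover have "\<not> f dvd Y" by (rule not_dvd) (use Y_props in auto)
  ultimately show ?thesis unfolding value_semigroup_def by (metis (mono_tags, lifting) mem_Collect_eq)
qed

text \<open>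
  Below \<open>T\<^sup>m\<close> the parameterization only shows the powers of \<open>x = T\<^sup>n\<close>.
\<close>

lemma small_values:
  assumes "v \<in> value_semigroup f \<gamma>" "v < m" shows "n dvd v"
proof (rule ccontr)
  assume nd: "\<not> n dvd v"
  obtain h where h: "v = subdegree (Ev (\<Psi> h))"
    using assms by (auto simp: value_semigroup_def Ev_\<Psi>)
  have "evz (\<Psi> h $ k) $ (v - k) = 0" if "k \<le> v" for k
  proof -
    have k: "k < m" using that assms by simp
    show ?thesis
    proof (cases "n dvd k")
      case True
      then have "k \<noteq> v" using nd by auto
      then show ?thesis
        using that by (subst graded_low(1)[OF graded_\<Psi> k]) (simp add: evz_pCons)
    qed (simp add: graded_low(2)[OF graded_\<Psi> k])
  qed
  then have "Ev (\<Psi> h) $ v = 0" unfolding Ev_nth by (intro sum.neutral) auto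
  then have "Ev (\<Psi> h) = 0" using h by simp
  then show False using h nd by simp
qed

text \<open>
  \<open>n\<close> is the least positive value and \<open>m\<close> the least value that \<open>n\<close> does not divide.
\<close>

lemma semigroup_generators:
  assumes g: "minimally_generated_by (value_semigroup f \<gamma>) v0 v1"
  shows "v0 = n" "v1 = m" "coprime n m"
proof -
  have v: "1 < v0" "v0 < v1" "coprime v0 v1" "value_semigroup f \<gamma> = submonoid_gen {v0, v1}"
    using g by (auto simp: minimally_generated_by_def)
  have "v0 \<in> value_semigroup f \<gamma>" "v1 \<in> value_semigroup f \<gamma>"
    by (auto simp: v intro: submonoid_gen.gen)
  note mem = this
  obtain i j where ij: "n = v0 * i + v1 * j" using n_in_semigroup v submonoid_gen_pair by metis
  have "v0 \<le> n"
  proof (cases i)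
    case 0
    then have "j \<noteq> 0" using ij n1 by (cases j) auto
    then have "v1 * 1 \<le> v1 * j" by (intro mult_le_mono2) simp
    then have "v1 \<le> n" using ij 0 by simp
    then show ?thesis using v(2) by simp
  qed (use ij in simp)
  moreover have "n \<le> v0"
  proof (cases "v0 < m")
    case True
    then have "n dvd v0" by (rule small_values[OF mem(1)])
    then show ?thesis using v(1) by (simp add: dvd_imp_le)
  qed (use nm in simp)
  ultimately show v0: "v0 = n" by simp
  obtain i j where ij: "m = v0 * i + v1 * j" using m_in_semigroup v submonoid_gen_pair by metis
  then have "j \<noteq> 0" using ndvd v0 by (cases j) auto
  then have "v1 * 1 \<le> v1 * j" by (intro mult_le_mono2) simp
  then have "v1 \<le> m" using ij by linarith
  moreover have "\<not> v1 < m"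
  proof
    assume "v1 < m"
    then have "v0 dvd v1" using small_values[OF mem(2)] v0 by simp
    then have "v0 = 1" using v(3) by (simp add: coprime_absorb_left)
    then show False using v by simp
  qed
  ultimately show v1: "v1 = m" by simp
  show "coprime n m" using v v0 v1 by simp
qed

end

section \<open>Division by the initial form\<close>

text \<open>
  The polynomials in \<open>z\<close> that come from weighted homogeneous polynomials of degree \<open>d\<close> in \<open>x\<close> and \<open>y\<close>.
\<close>

definition graded_part :: "nat \<Rightarrow> nat \<Rightarrow> nat \<Rightarrow> complex poly \<Rightarrow> bool" where
  "graded_part n m d p \<longleftrightarrow> (\<forall>j. coeff p j \<noteq> 0 \<longrightarrow> (\<exists>i. d = n * i + m * j))"

lemma gap_dvd:
  assumes "coprime n (m::nat)" "n * i + m * j = n * i' + m * j'" "j \<le> j'"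
  shows "n dvd j' - j"
proof -
  have "int (n * i + m * j) = int (n * i' + m * j')" using assms(2) by (rule arg_cong)
  then have "int m * int (j' - j) = int n * (int i - int i')"
    using assms(3) by (simp add: of_nat_diff algebra_simps)
  then have "int n dvd int (m * (j' - j))" by simp
  then have "n dvd m * (j' - j)" by (simp only: int_dvd_int_iff)
  then show ?thesis using assms(1) by (simp add: coprime_dvd_mult_right_iff)
qed

text \<open>
  A weighted homogeneous polynomial that vanishes at the point \<open>(1, 1)\<close> is divisible by \<open>y\<^sup>n - x\<^sup>m\<close>.
  By coprimality the exponents of \<open>z\<close> agree modulo \<open>n\<close>, and there are at least two of them; so the
  leading term can be lowered by \<open>n\<close>, with induction on the degree.
\<close>

lemma graded_part_division:
  assumes co: "coprime n m" and n0: "0 < n" and p: "graded_part n m d p" "poly p 1 = 0"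
  shows "\<exists>q. p = (monom 1 n - 1) * q \<and> (\<forall>j. coeff q j \<noteq> 0 \<longrightarrow> (\<exists>i. d = n * m + (n * i + m * j)))"
  using p
proof (induction "degree p" arbitrary: p rule: less_induct)
  case less
  show ?case
  proof (cases "p = 0")
    case True
    then show ?thesis by (intro exI[of _ 0]) simp
  next
    case False
    define D where "D = degree p"
    define a where "a = lead_coeff p"
    have a: "a \<noteq> 0" "coeff p D = a" using False by (auto simp: a_def D_def)
    have "\<exists>j. coeff p j \<noteq> 0 \<and> j < D"
    proof (rule ccontr)
      assume n: "\<nexists>j. coeff p j \<noteq> 0 \<and> j < D"
      have "p = monom a D"
      proof (rule poly_eqI)
        fix j
        consider "j < D" | "j = D" | "j > D" by linarith
        then show "coeff p j = coeff (monom a D) j"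
          by cases (use n a in \<open>auto simp: D_def coeff_eq_0\<close>)
      qed
      then have "poly p 1 = a" by (simp add: poly_monom)
      with less.prems a show False by simp
    qed
    then obtain j where j: "coeff p j \<noteq> 0" "j < D" by blast
    obtain i where i: "d = n * i + m * j" using less.prems j unfolding graded_part_def by blast
    obtain i' where i': "d = n * i' + m * D" using less.prems a unfolding graded_part_def by blast
    have "n dvd D - j" using gap_dvd[OF co, of i j i' D] i i' j by simp
    then have "n \<le> D - j" using j by (simp add: dvd_imp_le)
    then have nD: "n \<le> D" by simp
    then have dD: "d = n * m + (n * i' + m * (D - n))"
    proof -
      have "m * D = m * n + m * (D - n)" using nD by (simp add: distrib_left[symmetric])
      then show ?thesis using i' by (simp add: algebra_simps)
    qed
    define p' where "p' = p - (monom 1 n - 1) * monom a (D - n)"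
    have mm: "(monom 1 n - 1) * monom a (D - n) = monom a D - monom a (D - n)"
      using nD by (simp add: left_diff_distrib mult_monom)
    have c': "coeff p' k = (if k = D then 0 else if k = D - n then coeff p k + a else coeff p k)" for k
      unfolding p'_def mm using a nD n0 by auto
    have g': "graded_part n m d p'"
      unfolding graded_part_def
    proof (intro allI impI)
      fix k assume "coeff p' k \<noteq> 0"
      then consider "k = D - n" | "coeff p k \<noteq> 0" by (auto simp: c' split: if_splits)
      then show "\<exists>i. d = n * i + m * k"
      proof cases
        case 1
        then show ?thesis using dD by (intro exI[of _ "m + i'"]) (simp add: algebra_simps)
      next
        case 2
        then show ?thesis using less.prems unfolding graded_part_def by blast
      qed
    qed
    have z': "poly p' 1 = 0" using less.prems by (simp add: p'_def poly_monom)
    obtain q' where q': "p' = (monom 1 n - 1) * q'" "\<forall>j. coeff q' j \<noteq> 0 \<longrightarrow> (\<exists>i. d = n * m + (n * i + m * j))"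
    proof (cases "p' = 0")
      case True
      then show thesis using that[of 0] by simp
    next
      case False
      have "degree p' < degree p"
      proof (rule ccontr)
        assume "\<not> degree p' < degree p"
        then have "coeff p' (degree p') = 0"
          using n0 nD by (auto simp: c' D_def not_less coeff_eq_0)
        then show False using False by simp
      qed
      then show thesis using less.hyps g' z' that by blast
    qed
    have "p = (monom 1 n - 1) * (q' + monom a (D - n))"
      using q'(1) by (simp add: p'_def distrib_left algebra_simps)
    moreover have "\<exists>i. d = n * m + (n * i + m * j)" if "coeff (q' + monom a (D - n)) j \<noteq> 0" for j
    proof (cases "j = D - n")
      case True
      then show ?thesis using dD by blast
    qed (use that q'(2) in auto)
    ultimately show ?thesis by blast
  qed
qed

context chart begin

text \<open>
  Every weighted homogeneous polynomial is the initial form of a polynomial in \<open>X\<close> and \<open>Y\<close>.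
\<close>

lemma realize:
  assumes "\<And>j. coeff q j \<noteq> 0 \<Longrightarrow> \<exists>i. e = n * i + m * j"
  shows "\<exists>h. order_ge e (\<Psi> h) \<and> \<Psi> h $ e = q"
proof -
  have "\<exists>i. \<forall>j. coeff q j \<noteq> 0 \<longrightarrow> e = n * i j + m * j"
    using assms by (intro choice) blast
  then obtain i where i: "\<And>j. coeff q j \<noteq> 0 \<Longrightarrow> e = n * i j + m * j" by blast
  define h where "h = (\<Sum>j\<le>degree q. cps2_const (coeff q j) * (X ^ i j * Y ^ j))"
  have t: "order_ge e (\<Psi> (cps2_const (coeff q j) * (X ^ i j * Y ^ j)))"
    "\<Psi> (cps2_const (coeff q j) * (X ^ i j * Y ^ j)) $ e = monom (coeff q j) j" for j
  proof -
    have E: "\<Psi> (cps2_const (coeff q j) * (X ^ i j * Y ^ j)) $ d = smult (coeff q j) (\<Psi> (X ^ i j * Y ^ j) $ d)" for d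
      by (subst \<Psi>_simps(3)) (simp add: \<Psi>_const)
    show "order_ge e (\<Psi> (cps2_const (coeff q j) * (X ^ i j * Y ^ j)))"
      using i[of j] \<Psi>_XY(1)[of "i j" j] unfolding order_ge_def E by (cases "coeff q j = 0") auto
    show "\<Psi> (cps2_const (coeff q j) * (X ^ i j * Y ^ j)) $ e = monom (coeff q j) j"
      using i[of j] \<Psi>_XY(2)[of "i j" j] unfolding E by (cases "coeff q j = 0") (auto simp: smult_monom)
  qed
  have "order_ge e (\<Psi> h)"
    using t(1) unfolding h_def \<Psi>_simps(8) order_ge_def fps_sum_nth by simp
  moreover have "\<Psi> h $ e = q"
    unfolding h_def \<Psi>_simps(8) fps_sum_nth t(2) by (rule poly_as_sum_of_monoms)
  ultimately show ?thesis by blast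
qed

lemma \<Psi>_chain:
  "euler (\<Psi> h) = \<Psi> (pd1 h) * euler P1 + \<Psi> (pd2 h) * euler P2"
  "dz (\<Psi> h) = \<Psi> (pd1 h) * dz P1 + \<Psi> (pd2 h) * dz P2"
proof -
  show "euler (\<Psi> h) = \<Psi> (pd1 h) * euler P1 + \<Psi> (pd2 h) * euler P2"
    unfolding \<Psi>_def
    by (rule psubst_chain[OF ring_homo_pconst P_0 _ _ derivation_euler]) (simp_all add: euler_nth, simp add: euler_def)
  show "dz (\<Psi> h) = \<Psi> (pd1 h) * dz P1 + \<Psi> (pd2 h) * dz P2"
    unfolding \<Psi>_def
    by (rule psubst_chain[OF ring_homo_pconst P_0 _ _ derivation_dz])
       (simp_all only: fps_map_nth P_0 pderiv_0, simp add: fps_eq_iff pderiv_pCons)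
qed

lemma wsub_chain:
  "euler (wsub h) = wsub (pd1 h) * euler (fps_X ^ n) + wsub (pd2 h) * euler (fps_const [:0, 1:] * fps_X ^ m)"
  "dz (wsub h) = wsub (pd1 h) * dz (fps_X ^ n) + wsub (pd2 h) * dz (fps_const [:0, 1:] * fps_X ^ m)"
proof -
  show "euler (wsub h) = wsub (pd1 h) * euler (fps_X ^ n) + wsub (pd2 h) * euler (fps_const [:0, 1:] * fps_X ^ m)"
    unfolding wsub_def
    by (rule psubst_chain[OF ring_homo_pconst wbase _ _ derivation_euler]) (simp_all add: euler_nth, simp add: euler_def)
  show "dz (wsub h) = wsub (pd1 h) * dz (fps_X ^ n) + wsub (pd2 h) * dz (fps_const [:0, 1:] * fps_X ^ m)"
    unfolding wsub_def
    by (rule psubst_chain[OF ring_homo_pconst wbase _ _ derivation_dz])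
       (simp_all only: fps_map_nth wbase pderiv_0, simp add: fps_eq_iff pderiv_pCons)
qed

text \<open>
  \<open>dx\<^sub>1 \<and> dx\<^sub>2\<close> is \<open>J (dt / t) \<and> dz\<close> in the chart.
\<close>

definition J :: "complex poly fps" where "J = euler P1 * dz P2 - dz P1 * euler P2"

lemma \<Psi>_J:
  "\<Psi> (pd1 h) * J = euler (\<Psi> h) * dz P2 - dz (\<Psi> h) * euler P2"
  "\<Psi> (pd2 h) * J = - (euler (\<Psi> h) * dz P1 - dz (\<Psi> h) * euler P1)"
  unfolding \<Psi>_chain J_def by (simp_all add: algebra_simps)

lemma J_leading: "order_ge (n + m) J" "J $ (n + m) = [:of_nat n * jac:]"
proof -
  define D where "D = wsub (pd1 \<Phi>1 * pd2 \<Phi>2 - pd2 \<Phi>1 * pd1 \<Phi>2)"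
  have x: "euler (fps_X ^ n :: complex poly fps) = of_nat n * fps_X ^ n" "dz (fps_X ^ n) = 0"
    by (rule fps_ext; simp add: euler_nth fps_X_power_nth fps_of_nat[symmetric] pderiv_1)+
  have y: "dz (fps_const [:0, 1:] * fps_X ^ m) = fps_X ^ m"
    by (rule fps_ext) (simp add: fps_X_power_nth pderiv_pCons)
  have "J = of_nat n * (D * fps_X ^ (n + m))"
    unfolding J_def D_def wsub_chain x y ring_homoD[OF wsub_hom] power_add by (simp add: algebra_simps)
  also have "of_nat n = (fps_const [:of_nat n:] :: complex poly fps)"
    by (simp add: fps_of_nat[symmetric] of_nat_poly)
  finally have J: "J = fps_const [:of_nat n:] * (D * fps_X ^ (n + m))" .
  have JN: "J $ d = smult (of_nat n) (if d < n + m then 0 else D $ (d - (n + m)))" for d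
    unfolding J by (simp add: fps_X_power_mult_right_nth)
  have "coeff (D $ 0) 0 = jac"
    using coeff_wsub_eq[of "pd1 \<Phi>1 * pd2 \<Phi>2 - pd2 \<Phi>1 * pd1 \<Phi>2" 0 0]
    by (simp add: D_def cps2_coeff_simps cps2_coeff_mult pd1_coeff pd2_coeff jac_def)
  moreover have "D $ 0 = [:coeff (D $ 0) 0:]" unfolding D_def by (rule graded_low(1)[OF graded_wsub]) (use nm in simp)
  ultimately have "D $ 0 = [:jac:]" by simp
  then show "order_ge (n + m) J" "J $ (n + m) = [:of_nat n * jac:]"
    by (auto simp: JN order_ge_def)
qed

end

locale coprime_branch = branch + assumes co: "coprime n m"
begin

lemma graded_part_\<Psi>: "graded_part n m d (\<Psi> h $ d)"
  using graded_\<Psi>[of h] by (simp add: graded_def graded_part_def)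

text \<open>
  The initial form vanishes at \<open>z = 1\<close>, so it is divisible by \<open>z\<^sup>n - 1\<close> and has weight at least \<open>n m\<close>;
  the multiplicity of \<open>f\<close> bounds the weight from above.
\<close>

lemma \<Psi>f_leading: "\<exists>c. c \<noteq> 0 \<and> order_ge (n * m) (\<Psi> f) \<and> \<Psi> f $ (n * m) = smult c (monom 1 n - 1)"
proof -
  have "\<not> order_ge (Suc (n * m)) (\<Psi> f)" using \<Psi>_reflects_order f_order(2) by blast
  then have ex: "\<exists>d. \<Psi> f $ d \<noteq> 0 \<and> d \<le> n * m" by (auto simp: order_ge_def less_Suc_eq_le)
  define d where "d = (LEAST d. \<Psi> f $ d \<noteq> 0)"
  obtain d' where d': "\<Psi> f $ d' \<noteq> 0" "d' \<le> n * m" using ex by blast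
  have d: "\<Psi> f $ d \<noteq> 0" "d \<le> n * m" "order_ge d (\<Psi> f)"
    using LeastI[of "\<lambda>d. \<Psi> f $ d \<noteq> 0" d'] Least_le[of "\<lambda>d. \<Psi> f $ d \<noteq> 0" d'] d' not_less_Least
    unfolding d_def order_ge_def by (blast, linarith, blast)
  have "poly (\<Psi> f $ d) 1 = 0" using Ev_order(2)[OF d(3)] by (simp add: Ev_\<Psi>f)
  then obtain q where q: "\<Psi> f $ d = (monom 1 n - 1) * q"
    "\<And>j. coeff q j \<noteq> 0 \<Longrightarrow> \<exists>i. d = n * m + (n * i + m * j)"
    using graded_part_division[OF co _ graded_part_\<Psi>] n1 by (metis less_trans zero_less_one)
  have j: "d = n * m \<and> j = 0" if nz: "coeff q j \<noteq> 0" for j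
  proof -
    obtain i where "d = n * m + (n * i + m * j)" using q(2)[OF nz] by blast
    then show ?thesis using d(2) nm n1 by auto
  qed
  have "q \<noteq> 0" using d(1) q(1) by auto
  then have dn: "d = n * m" using j[of "degree q"] by simp
  have qq: "q = [:coeff q 0:]"
    using j by (intro poly_eqI) (auto simp: coeff_pCons split: nat.splits)
  then have "coeff q 0 \<noteq> 0" using \<open>q \<noteq> 0\<close> by (metis pCons_0_0)
  moreover have "\<Psi> f $ (n * m) = smult (coeff q 0) (monom 1 n - 1)"
    using q(1) dn by (subst (asm) qq) simp
  ultimately show ?thesis using d(3) dn by blast
qed

text \<open>
  As long as the weighted order of \<open>g\<close> is below its value along the branch, the initial form of \<open>g\<close>
  vanishes at \<open>z = 1\<close> and can be cancelled by a multiple of \<open>f\<close>.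
\<close>

lemma reduce_order:
  assumes g: "order_ge e (Ev (\<Psi> g))" and d: "d \<le> e"
  shows "\<exists>q. order_ge d (\<Psi> (g - q * f))"
  using d
proof (induction d)
  case 0
  show ?case by (simp add: order_ge_def)
next
  case (Suc d)
  then obtain q where q: "order_ge d (\<Psi> (g - q * f))" by auto
  obtain c where c: "c \<noteq> 0" "order_ge (n * m) (\<Psi> f)" "\<Psi> f $ (n * m) = smult c (monom 1 n - 1)"
    using \<Psi>f_leading by blast
  have Ev: "Ev (\<Psi> (g - q * f)) = Ev (\<Psi> g)" by (simp add: \<Psi>_simps Ev_simps Ev_\<Psi>f)
  have "poly (\<Psi> (g - q * f) $ d) 1 = 0"
    using Ev_order(2)[OF q] g Suc.prems unfolding Ev by (simp add: order_ge_def)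
  then obtain r where r: "\<Psi> (g - q * f) $ d = (monom 1 n - 1) * r"
    "\<And>j. coeff r j \<noteq> 0 \<Longrightarrow> \<exists>i. d = n * m + (n * i + m * j)"
    using graded_part_division[OF co _ graded_part_\<Psi>] n1 by (metis less_trans zero_less_one)
  show ?case
  proof (cases "r = 0")
    case True
    then show ?thesis using q r(1) by (intro exI[of _ q]) (auto simp: order_ge_def less_Suc_eq)
  next
    case False
    then have dn: "n * m \<le> d" using r(2)[of "degree r"] by auto
    have "\<exists>h. order_ge (d - n * m) (\<Psi> h) \<and> \<Psi> h $ (d - n * m) = r"
      by (rule realize) (use r(2) in fastforce)
    then obtain h where h: "order_ge (d - n * m) (\<Psi> h)" "\<Psi> h $ (d - n * m) = r" by blast
    have hf: "order_ge d (\<Psi> h * \<Psi> f)" "(\<Psi> h * \<Psi> f) $ d = r * smult c (monom 1 n - 1)"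
      using order_ge_mult[OF h(1) c(2)] h c dn by auto
    define q' where "q' = q + cps2_const (inverse c) * h"
    have P: "\<Psi> (g - q' * f) $ k = \<Psi> (g - q * f) $ k - smult (inverse c) ((\<Psi> h * \<Psi> f) $ k)" for k
      by (simp add: q'_def \<Psi>_simps \<Psi>_const algebra_simps)
    have "order_ge (Suc d) (\<Psi> (g - q' * f))"
      unfolding order_ge_def P
    proof (intro allI impI)
      fix k assume "k < Suc d"
      then consider "k < d" | "k = d" by linarith
      then show "\<Psi> (g - q * f) $ k - smult (inverse c) ((\<Psi> h * \<Psi> f) $ k) = 0"
        using q hf r(1) c(1) by cases (auto simp: order_ge_def mult.commute)
    qed
    then show ?thesis by blast
  qed
qed

text \<open>
  For such \<open>i0\<close> and \<open>j0\<close> there is only one monomial of weight \<open>e\<close>, by coprimality.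
\<close>

lemma reduce:
  assumes g: "order_ge e (Ev (\<Psi> g))" "Ev (\<Psi> g) $ e \<noteq> 0"
    and e: "e = n * i0 + m * j0" "i0 < m" "j0 < n"
  shows "\<exists>q c. c \<noteq> 0 \<and> order_ge e (\<Psi> (g - q * f)) \<and> \<Psi> (g - q * f) $ e = monom c j0"
proof -
  obtain q where q: "order_ge e (\<Psi> (g - q * f))" using reduce_order[OF g(1)] by blast
  let ?p = "\<Psi> (g - q * f) $ e"
  have Ev: "Ev (\<Psi> (g - q * f)) = Ev (\<Psi> g)" by (simp add: \<Psi>_simps Ev_simps Ev_\<Psi>f)
  have j: "j = j0" if j: "coeff ?p j \<noteq> 0" for j
  proof -
    obtain i where i: "e = n * i + m * j" using j graded_part_\<Psi> unfolding graded_part_def by blast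
    show ?thesis
    proof (rule linorder_cases[of j j0])
      assume lt: "j < j0"
      then have "n dvd j0 - j" using gap_dvd[OF co, of i j i0 j0] i e by simp
      then have "n \<le> j0 - j" using lt by (simp add: dvd_imp_le)
      then show ?thesis using e(3) by simp
    next
      assume lt: "j0 < j"
      then have "n dvd j - j0" using gap_dvd[OF co, of i0 j0 i j] i e by simp
      then have "n \<le> j - j0" using lt by (simp add: dvd_imp_le)
      then have "n + j0 \<le> j" using lt by linarith
      then have "m * (n + j0) \<le> m * j" by (rule mult_le_mono2)
      then have "m * n + m * j0 \<le> n * i0 + m * j0" using i e(1) unfolding distrib_left by linarith
      then have "n * m \<le> n * i0" by (simp add: mult.commute)
      then show ?thesis using e(2) n1 by simp
    qed
  qed
  have p: "?p = monom (coeff ?p j0) j0" using j by (intro poly_eqI) auto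
  moreover have "coeff ?p j0 \<noteq> 0"
  proof
    assume "coeff ?p j0 = 0"
    then have "?p = 0" using p by simp
    then show False using Ev_order(2)[OF q] g(2) unfolding Ev by simp
  qed
  ultimately show ?thesis using q by metis
qed

end

section \<open>Specialisation of the Bernstein equation\<close>

lemma fract_deriv_derivation:
  assumes "d = pd1 \<or> d = pd2"
  shows "derivation (fract_deriv d)" "fract_deriv d (to_fract x) = to_fract (d x)"
    "d (cps2_const s) = 0"
proof -
  have mult: "d (x * y) = x * d y + d x * y" for x y using assms pd_mult by auto
  have add: "d (x + y) = d x + d y" for x y using assms pd_add by auto
  have "derivation d" by (simp add: derivation_def mult add add.commute)
  note D = derivationD[OF this]
  note FD = fract_deriv_Fract[of d, OF mult]
  show "fract_deriv d (to_fract x) = to_fract (d x)"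
    unfolding to_fract_def by (subst FD) (simp_all add: D)
  show "d (cps2_const s) = 0"
    using assms unfolding cps2_eq_iff by (auto simp: pd1_coeff pd2_coeff cps2_coeff_simps)
  have "fract_deriv d (p + q) = fract_deriv d p + fract_deriv d q" for p q
  proof -
    obtain a b where p: "p = Fract a b" "b \<noteq> 0" by (cases p)
    obtain a' b' where q: "q = Fract a' b'" "b' \<noteq> 0" by (cases q)
    show ?thesis using p q by (simp add: FD eq_fract D algebra_simps)
  qed
  moreover have "fract_deriv d (p * q) = fract_deriv d p * q + p * fract_deriv d q" for p q
  proof -
    obtain a b where p: "p = Fract a b" "b \<noteq> 0" by (cases p)
    obtain a' b' where q: "q = Fract a' b'" "b' \<noteq> 0" by (cases q)
    show ?thesis using p q by (simp add: FD eq_fract D algebra_simps)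
  qed
  ultimately show "derivation (fract_deriv d)" by (simp add: derivation_def)
qed

text \<open>
  Substituting a number for \<open>s\<close> commutes with the action on \<open>u f\<^sup>s\<close>, since constants are killed by
  the partial derivatives.
\<close>

lemma poly_twisted_deriv:
  assumes d: "d = pd1 \<or> d = pd2"
  shows "poly (twisted_deriv d f u) (to_fract (cps2_const s)) =
    fract_deriv d (poly u (to_fract (cps2_const s)))
      + to_fract (cps2_const s) * (to_fract (d f) / to_fract f) * poly u (to_fract (cps2_const s))"
proof -
  note fd = fract_deriv_derivation[OF d]
  note D = derivationD[OF fd(1)]
  have "poly (map_poly (fract_deriv d) u) (to_fract (cps2_const s)) = fract_deriv d (poly u (to_fract (cps2_const s)))"
    by (induction u) (simp_all add: map_poly_pCons D fd(2,3) to_fract_hom)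
  then show ?thesis by (simp add: twisted_deriv_def)
qed

lemma ring_homo_to_fract: "ring_homo (to_fract :: cps2 \<Rightarrow> _)"
  by (simp add: ring_homo_def to_fract_hom)

lemma poly_map_hom: "ring_homo e \<Longrightarrow> poly (map_poly e p) (e x) = e (poly p x)"
  by (induction p) (simp_all add: map_poly_pCons ring_homoD)

text \<open>
  The set \<open>I\<close> stands for a subspace of \<open>u f\<^sup>s\<close> with a fixed number \<open>s\<close> that is stable under the
  differential operators and contains \<open>f\<^sup>s\<^sup>+\<^sup>1\<close>; by the functional equation it contains \<open>b(s) f\<^sup>s\<close>.
\<close>

lemma specialised_ideal:
  assumes b: "b \<in> bernstein_ideal f"
    and I: "to_fract f \<in> I" "\<And>x y. x \<in> I \<Longrightarrow> y \<in> I \<Longrightarrow> x + y \<in> I" "\<And>g x. x \<in> I \<Longrightarrow> to_fract g * x \<in> I"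
      "\<And>d x. d = pd1 \<or> d = pd2 \<Longrightarrow> x \<in> I \<Longrightarrow>
         fract_deriv d x + to_fract (cps2_const s) * (to_fract (d f) / to_fract f) * x \<in> I"
  shows "to_fract (cps2_const (poly b s)) \<in> I"
proof -
  let ?S = "to_fract (cps2_const s)"
  obtain P where P: "diffop_act f P [:to_fract f:] = map_poly (\<lambda>c. to_fract (cps2_const c)) b"
    using b by (auto simp: bernstein_ideal_def)
  have it: "poly ((twisted_deriv d f ^^ a) u) ?S \<in> I" if d: "d = pd1 \<or> d = pd2" and u: "poly u ?S \<in> I" for d a u
  proof (induction a)
    case (Suc a)
    show ?case unfolding funpow.simps o_apply poly_twisted_deriv[OF d] by (rule I(4)[OF d Suc])
  qed (simp add: u)
  have "0 \<in> I" using I(3)[OF I(1), of 0] by (simp add: to_fract_hom)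
  then have sum: "sum g S \<in> I" if "\<And>x. x \<in> S \<Longrightarrow> g x \<in> I" for g and S :: "(nat \<times> nat) set"
    using that by (induction S rule: infinite_finite_induct) (auto intro: I)
  have "poly (diffop_act f P [:to_fract f:]) ?S \<in> I"
    unfolding diffop_act_def poly_sum
  proof (intro sum)
    fix x assume "x \<in> Poly_Mapping.keys P"
    obtain a b where x: "x = (a, b)" by force
    have "poly ((twisted_deriv pd1 f ^^ a) ((twisted_deriv pd2 f ^^ b) [:to_fract f:])) ?S \<in> I"
      by (intro it) (auto intro: I)
    then show "poly (case x of (a, b) \<Rightarrow> map_poly to_fract (Poly_Mapping.lookup P (a, b)) *
        (twisted_deriv pd1 f ^^ a) ((twisted_deriv pd2 f ^^ b) [:to_fract f:])) ?S \<in> I"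
      by (simp add: x poly_map_hom[OF ring_homo_to_fract] I(3))
  qed
  then show ?thesis
    unfolding P using poly_map_hom[OF ring_homo_comp[OF ring_homo_to_fract ring_homo_cps2_const], of b s] by simp
qed

lemma to_fract_inj: "to_fract a = to_fract b \<Longrightarrow> a = (b :: cps2)"
  by (simp add: to_fract_def eq_fract)

lemma to_fract_nz: "a \<noteq> 0 \<Longrightarrow> to_fract a \<noteq> (0 :: cps2 fract)"
  using to_fract_inj[of a 0] by (auto simp: to_fract_hom)

lemma cps2_const_unit: "c \<noteq> 0 \<Longrightarrow> cps2_const (inverse c) * cps2_const c = 1"
  by (simp flip: cps2_const_hom)

text \<open>
  The derivative of \<open>g f\<^sup>s\<^sup>-\<^sup>k\<close>, written with denominator \<open>f\<^sup>k\<^sup>+\<^sup>1\<close>.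
\<close>

lemma fract_quotient_twisted:
  fixes w :: "cps2 fract"
  assumes d: "d = pd1 \<or> d = pd2" and f: "f \<noteq> 0" and w: "w * to_fract f ^ k = to_fract g"
  shows "(fract_deriv d w + to_fract (cps2_const s) * (to_fract (d f) / to_fract f) * w) * to_fract f ^ Suc k
     = to_fract (f * d g + cps2_const (s - of_nat k) * (g * d f))"
proof -
  note fd = fract_deriv_derivation[OF d]
  note D = derivationD[OF fd(1)]
  have tf: "to_fract f \<noteq> 0" by (rule to_fract_nz[OF f])
  have pw: "fract_deriv d (to_fract f ^ k) * to_fract f = of_nat k * to_fract f ^ k * to_fract (d f)"
  proof (cases k)
    case 0
    then show ?thesis by (simp add: D)
  next
    case (Suc i)
    show ?thesis unfolding Suc D(8) fd(2) by (simp only: power_Suc mult_ac)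
  qed
  have "fract_deriv d w * to_fract f ^ k + w * fract_deriv d (to_fract f ^ k) = to_fract (d g)"
    using arg_cong[OF w, of "fract_deriv d"] by (simp add: D fd)
  then have "(fract_deriv d w * to_fract f ^ k + w * fract_deriv d (to_fract f ^ k)) * to_fract f = to_fract (d g) * to_fract f"
    by simp
  then have 1: "fract_deriv d w * to_fract f ^ Suc k + of_nat k * (w * to_fract f ^ k) * to_fract (d f) = to_fract f * to_fract (d g)"
    using pw by (simp add: algebra_simps)
  have h: "to_fract (cps2_const (s - of_nat k)) = to_fract (cps2_const s) - of_nat k"
  proof -
    note H = ring_homoD[OF ring_homo_comp[OF ring_homo_to_fract ring_homo_cps2_const]]
    have "to_fract (cps2_const (of_nat k)) = of_nat k" by (induction k) (simp_all add: H)
    then show ?thesis by (simp add: H)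
  qed
  have "(fract_deriv d w + to_fract (cps2_const s) * (to_fract (d f) / to_fract f) * w) * to_fract f ^ Suc k
    = fract_deriv d w * to_fract f ^ Suc k + to_fract (cps2_const s) * to_fract (d f) * (w * to_fract f ^ k)"
    using tf by (simp add: field_simps)
  also have "\<dots> = to_fract f * to_fract (d g) - of_nat k * to_fract g * to_fract (d f) + to_fract (cps2_const s) * to_fract (d f) * to_fract g"
    using 1 unfolding w by (simp add: algebra_simps)
  also have "\<dots> = to_fract (f * d g + cps2_const (s - of_nat k) * (g * d f))"
    unfolding to_fract_hom h by (simp add: algebra_simps)
  finally show ?thesis .
qed

text \<open>
  At \<open>s = - 1\<close> the differential operators map \<open>f\<^sup>s\<^sup>+\<^sup>1 = 1\<close> into \<open>\<O>\<^sub>2\<close>, which does not contain \<open>1 / f\<close>.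
\<close>

lemma bernstein_root_minus_1:
  assumes b: "b \<in> bernstein_ideal f" and f: "irreducible f"
  shows "poly b (- 1) = 0"
proof (rule ccontr)
  assume nz: "poly b (- 1) \<noteq> 0"
  have f0: "f \<noteq> 0" using f by auto
  define I where "I = {to_fract (f * g) |g. True}"
  have "to_fract (cps2_const (poly b (- 1))) \<in> I"
  proof (rule specialised_ideal[OF b])
    show "to_fract f \<in> I" unfolding I_def by (rule CollectI, rule exI[of _ 1]) simp
  next
    fix x y assume "x \<in> I" "y \<in> I"
    then obtain g h where "x = to_fract (f * g)" "y = to_fract (f * h)" by (auto simp: I_def)
    then have "x + y = to_fract (f * (g + h))" by (simp add: to_fract_hom distrib_left)
    then show "x + y \<in> I" unfolding I_def by blast
  next
    fix g x assume "x \<in> I"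
    then obtain h where "x = to_fract (f * h)" by (auto simp: I_def)
    then have "to_fract g * x = to_fract (f * (g * h))" by (simp add: to_fract_hom)
    then show "to_fract g * x \<in> I" unfolding I_def by blast
  next
    fix d x assume d: "d = pd1 \<or> d = pd2" and "x \<in> I"
    then obtain h where h: "x = to_fract (f * h)" by (auto simp: I_def)
    have dm: "d (f * h) = f * d h + d f * h" using d pd_mult by auto
    have fd: "fract_deriv d x = to_fract (f * d h + d f * h)"
      unfolding h fract_deriv_derivation(2)[OF d] dm ..
    have m1: "to_fract (cps2_const (- 1)) = - 1"
      using ring_homoD[OF ring_homo_comp[OF ring_homo_to_fract ring_homo_cps2_const]] by simp
    have "fract_deriv d x + to_fract (cps2_const (- 1)) * (to_fract (d f) / to_fract f) * x = to_fract (f * d h)"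
      unfolding fd unfolding m1 h to_fract_hom using to_fract_nz[OF f0] by simp
    then show "fract_deriv d x + to_fract (cps2_const (- 1)) * (to_fract (d f) / to_fract f) * x \<in> I"
      unfolding I_def by blast
  qed
  then obtain g where "to_fract (cps2_const (poly b (- 1))) = to_fract (f * g)" by (auto simp: I_def)
  then have "cps2_const (poly b (- 1)) = f * g" by (rule to_fract_inj)
  then have "1 = f * (g * cps2_const (inverse (poly b (- 1))))"
    using cps2_const_unit[OF nz] by (simp add: mult_ac)
  then have "f dvd 1" by (rule dvdI)
  with f show False by (simp add: irreducible_def)
qed

section \<open>The Bernstein root of a differential form\<close>

lemma of_real_not_Ints:
  assumes "0 < x" "x < 1" shows "complex_of_real x \<notin> \<int>"
proof
  assume "complex_of_real x \<in> \<int>"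
  then obtain i where "complex_of_real x = of_int i" by (auto elim: Ints_cases)
  then have "x = of_int i" by (metis of_real_eq_iff of_real_of_int_eq)
  then show False using assms by simp
qed

context coprime_branch begin

text \<open>
  Restricted to the branch, where \<open>df\<close> vanishes on tangent vectors, the coefficient of \<open>df \<and> \<omega>\<close> is the
  pull-back of \<open>\<omega>\<close> times \<open>- df/dz\<close>. The order of \<open>df/dz\<close> is \<open>n m\<close>, as \<open>z\<^sup>n - 1\<close> has a simple zero at
  \<open>z = 1\<close>, and \<open>J\<close> has order \<open>n + m\<close>.
\<close>

lemma value_wedge:
  assumes w: "form_pullback \<gamma> (A, B) \<noteq> 0" and l: "l = subdegree (form_pullback \<gamma> (A, B)) + 1"
  defines "g \<equiv> B * pd1 f - A * pd2 f"
  shows "Ev (\<Psi> g) \<noteq> 0" "subdegree (Ev (\<Psi> g)) + (n + m) = n * m + l"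
proof -
  define w where "w = form_pullback \<gamma> (A, B)"
  define \<alpha> where "\<alpha> = \<Psi> A * euler P1 + \<Psi> B * euler P2"
  define \<beta> where "\<beta> = \<Psi> A * dz P1 + \<Psi> B * dz P2"
  have pull: "fps_X * w = Ev \<alpha> + Ev \<beta> * euler \<zeta>"
  proof -
    have "fps_X * w = Ev (\<Psi> A) * euler (Ev P1) + Ev (\<Psi> B) * euler (Ev P2)"
      by (simp add: w_def form_pullback_def gam_Ev Ev_\<Psi> euler_def algebra_simps)
    also have "\<dots> = Ev \<alpha> + Ev \<beta> * euler \<zeta>"
      unfolding Ev_euler \<alpha>_def \<beta>_def Ev_simps by (simp add: algebra_simps)
    finally show ?thesis .
  qed
  have "\<Psi> g * J = \<Psi> B * (\<Psi> (pd1 f) * J) - \<Psi> A * (\<Psi> (pd2 f) * J)"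
    by (simp add: g_def \<Psi>_simps algebra_simps)
  also have "\<dots> = euler (\<Psi> f) * \<beta> - dz (\<Psi> f) * \<alpha>"
    unfolding \<Psi>_J \<alpha>_def \<beta>_def by (simp add: algebra_simps)
  finally have "Ev (\<Psi> g) * Ev J = Ev (euler (\<Psi> f)) * Ev \<beta> - Ev (dz (\<Psi> f)) * Ev \<alpha>"
    by (simp flip: Ev_simps)
  also have "Ev (euler (\<Psi> f)) = - (Ev (dz (\<Psi> f)) * euler \<zeta>)"
    using Ev_euler[of "\<Psi> f"] by (simp add: Ev_\<Psi>f euler_def eq_neg_iff_add_eq_0)
  also have "- (Ev (dz (\<Psi> f)) * euler \<zeta>) * Ev \<beta> - Ev (dz (\<Psi> f)) * Ev \<alpha> = - (Ev (dz (\<Psi> f)) * (fps_X * w))"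
    unfolding pull by (simp add: algebra_simps)
  finally have eq: "Ev (\<Psi> g) * Ev J = - (Ev (dz (\<Psi> f)) * (fps_X * w))" .
  obtain c where c: "c \<noteq> 0" "order_ge (n * m) (\<Psi> f)" "\<Psi> f $ (n * m) = smult c (monom 1 n - 1)"
    using \<Psi>f_leading by blast
  have "order_ge (n * m) (dz (\<Psi> f))" using c(2) by (simp add: order_ge_def)
  note o = Ev_order[OF this]
  have "poly (dz (\<Psi> f) $ (n * m)) 1 = c * of_nat n"
    by (simp add: c(3) pderiv_smult pderiv_diff pderiv_monom poly_monom)
  then have nz: "Ev (dz (\<Psi> f)) $ (n * m) \<noteq> 0" using o(2) c(1) n1 by simp
  then have s1: "subdegree (Ev (dz (\<Psi> f))) = n * m" "Ev (dz (\<Psi> f)) \<noteq> 0"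
    using order_ge_subdegree[OF o(1)] by auto
  have "Ev J $ (n + m) \<noteq> 0" using Ev_order(2)[OF J_leading(1)] J_leading(2) jac_nz n1 by simp
  then have s2: "subdegree (Ev J) = n + m" "Ev J \<noteq> 0"
    using order_ge_subdegree[OF Ev_order(1)[OF J_leading(1)]] by auto
  have w0: "w \<noteq> 0" using w by (simp add: w_def)
  have rhs: "Ev (dz (\<Psi> f)) * (fps_X * w) \<noteq> 0" using s1 w0 by simp
  then show g0: "Ev (\<Psi> g) \<noteq> 0" using eq by auto
  have "subdegree (Ev (\<Psi> g) * Ev J) = subdegree (Ev (\<Psi> g)) + (n + m)"
    using g0 s2 by simp
  moreover have "subdegree (- (Ev (dz (\<Psi> f)) * (fps_X * w))) = n * m + (1 + subdegree w)"
    using s1 w0 by (simp only: subdegree_uminus) simp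
  ultimately show "subdegree (Ev (\<Psi> g)) + (n + m) = n * m + l" unfolding eq l w_def by simp
qed

text \<open>
  The main argument. The functionals \<open>\<Lambda>\<^sub>k\<close> are residues of \<open>h f\<^sup>\<sigma>\<^sup>-\<^sup>k dx\<^sub>1 \<and> dx\<^sub>2\<close>; if \<open>\<sigma>\<close> is not a root,
  then \<open>\<Lambda>\<^sub>0 = 0\<close>, and this contradicts the value of the form \<open>A dx\<^sub>1 + B dx\<^sub>2\<close>.
\<close>

lemma bernstein_root:
  assumes form: "form_pullback \<gamma> (A, B) \<noteq> 0" "l = subdegree (form_pullback \<gamma> (A, B)) + 1"
    and ab: "n * m + l = n * a + m * b" "0 < a" "a < m" "0 < b" "b < n"
    and bern: "p \<in> bernstein_ideal f"
  shows "poly p (- (of_nat l / of_nat (n * m))) = 0"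
proof (rule ccontr)
  assume pnz: "poly p (- (of_nat l / of_nat (n * m))) \<noteq> 0"
  define \<sigma> :: complex where "\<sigma> = - (of_nat l / of_nat (n * m))"
  have N0: "0 < n * m" using n1 nm by simp
  have lN: "l < n * m"
  proof -
    have "n * a \<le> n * (m - 1)" using ab(3) by (intro mult_le_mono2) simp
    moreover have "m * b \<le> m * (n - 1)" using ab(5) by (intro mult_le_mono2) simp
    moreover have "n * (m - 1) = n * m - n" "m * (n - 1) = n * m - m"
      by (simp_all add: diff_mult_distrib2 mult.commute)
    ultimately show ?thesis using ab(1) N0 n1 nm by linarith
  qed
  have l0: "0 < l" using form(2) by simp
  have \<sigma>_eq: "\<sigma> = - complex_of_real (real l / real (n * m))" by (simp add: \<sigma>_def)
  have \<sigma>Z: "\<sigma> \<notin> \<int>"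
  proof -
    have "real l < real (n * m)" using lN by (simp only: of_nat_less_iff)
    then have "complex_of_real (real l / real (n * m)) \<notin> \<int>"
      using l0 by (intro of_real_not_Ints) (simp_all add: divide_less_eq)
    then show ?thesis unfolding \<sigma>_eq minus_in_Ints_iff .
  qed
  have \<sigma>N: "\<sigma> * of_nat (n * m) = - of_nat l" using N0 by (simp add: \<sigma>_def)
  have f0: "f \<noteq> 0" using f_order(2) by (auto simp: vanishes_to_0)
  obtain c where c: "c \<noteq> 0" "order_ge (n * m) (\<Psi> f)" "\<Psi> f $ (n * m) = smult c (monom 1 n - 1)"
    using \<Psi>f_leading by blast
  define F where "F = fps_shift (n * m) (\<Psi> f)"
  have \<Psi>f: "\<Psi> f = fps_X ^ (n * m) * F"
    by (rule fps_ext) (use c(2) in \<open>auto simp: F_def fps_X_power_mult_nth order_ge_def\<close>)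
  interpret tp: twisted_period n \<sigma> c
    by unfold_locales (use n1 c(1) \<sigma>Z in auto)
  interpret R: residue n \<sigma> c F
    by unfold_locales (simp add: F_def tp.base_def c(3))
  \<comment> \<open>\<open>f\<^sup>\<sigma>\<^sup>-\<^sup>k\<close> contributes \<open>t\<close> to the exponent \<open>n m (\<sigma> - k) = - (l + n m k)\<close>\<close>
  define \<Lambda> where "\<Lambda> = (\<lambda>k g. R.res k (l + n * m * k) (\<Psi> g * J))"
  have \<Lambda>_f: "\<Lambda> (Suc k) (f * g) = \<Lambda> k g" for k g
  proof -
    have "\<Psi> (f * g) * J = fps_X ^ (n * m) * (F * (\<Psi> g * J))" by (simp add: \<Psi>_simps \<Psi>f mult_ac)
    moreover have "l + n * m * Suc k = (l + n * m * k) + n * m" by simp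
    ultimately show ?thesis unfolding \<Lambda>_def by (simp only: R.res_shift R.res_mult_F)
  qed
  have \<Lambda>_add: "\<Lambda> k (g + h) = \<Lambda> k g + \<Lambda> k h" for k g h
    by (simp add: \<Lambda>_def \<Psi>_simps ring_distribs R.res_add)
  have \<Lambda>_const: "\<Lambda> k (cps2_const s * g) = s * \<Lambda> k g" for k s g
    by (simp add: \<Lambda>_def \<Psi>_simps \<Psi>_const mult.assoc R.res_smult)
  have \<Lambda>_diff: "\<Lambda> k (g - h) = \<Lambda> k g - \<Lambda> k h" for k g h
    using \<Lambda>_add[of k "g - h" h] by simp
  have \<Lambda>_0: "\<Lambda> 0 (f * g) = 0" for g
  proof -
    have "order_ge (n * m) (\<Psi> (f * g) * J)"
      using order_ge_mult(1)[OF c(2), of 0 "\<Psi> g * J"] by (simp add: \<Psi>_simps mult.assoc order_ge_def)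
    then have "order_ge (Suc (l + n * m * 0)) (\<Psi> (f * g) * J)" by (rule order_ge_mono) (use lN in simp)
    then show ?thesis unfolding \<Lambda>_def by (rule R.res_below)
  qed
  have stokes: "\<Lambda> (Suc k) (f * d h + cps2_const (\<sigma> - of_nat k) * (h * d f)) = 0" if d: "d = pd1 \<or> d = pd2" for k d h
  proof -
    have e: "of_nat (l + n * m * k) + (\<sigma> - of_nat k) * of_nat (n * m) = 0"
    proof -
      have "of_nat (l + n * m * k) + (\<sigma> - of_nat k) * of_nat (n * m) = of_nat l + \<sigma> * of_nat (n * m)"
        by (simp add: algebra_simps)
      then show ?thesis unfolding \<sigma>N by simp
    qed
    note S = R.res_stokes[OF e, of "\<Psi> h", folded \<Psi>f]
    have E: "l + n * m * Suc k = (l + n * m * k) + n * m" by simp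
    from d show ?thesis
    proof
      assume d: "d = pd1"
      have "\<Psi> (f * d h + cps2_const (\<sigma> - of_nat k) * (h * d f)) * J
        = \<Psi> f * (\<Psi> (d h) * J) + fps_const [:\<sigma> - of_nat k:] * (\<Psi> h * (\<Psi> (d f) * J))"
        unfolding \<Psi>_simps \<Psi>_const by (simp only: distrib_right mult.assoc)
      then show ?thesis unfolding \<Lambda>_def E d \<Psi>_J by (simp only: S)
    next
      assume d: "d = pd2"
      have "\<Psi> (f * d h + cps2_const (\<sigma> - of_nat k) * (h * d f)) * J
        = \<Psi> f * (\<Psi> (d h) * J) + fps_const [:\<sigma> - of_nat k:] * (\<Psi> h * (\<Psi> (d f) * J))"
        unfolding \<Psi>_simps \<Psi>_const by (simp only: distrib_right mult.assoc)
      also have "\<dots> = fps_const [:- 1:] * (\<Psi> f * (euler (\<Psi> h) * dz P1 - dz (\<Psi> h) * euler P1)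
         + fps_const [:\<sigma> - of_nat k:] * (\<Psi> h * (euler (\<Psi> f) * dz P1 - dz (\<Psi> f) * euler P1)))"
      proof -
        have "fps_const [:- 1:] = (- 1 :: complex poly fps)" by (rule fps_ext) (simp add: one_pCons)
        then show ?thesis unfolding d \<Psi>_J by (simp only: mult_minus_left mult_minus_right minus_add_distrib mult_1_left)
      qed
      finally show ?thesis unfolding \<Lambda>_def E by (simp only: R.res_smult S mult_zero_right)
    qed
  qed
  \<comment> \<open>elements \<open>(g / f\<^sup>k) f\<^sup>\<sigma>\<close> all of whose multiples have residue zero\<close>
  define I where "I = {w. \<exists>k g. w * to_fract f ^ k = to_fract g \<and> (\<forall>h. \<Lambda> k (h * g) = 0)}"
  have "to_fract (cps2_const (poly p \<sigma>)) \<in> I"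
  proof (rule specialised_ideal[OF bern])
    show "to_fract f \<in> I"
      unfolding I_def by (rule CollectI, rule exI[of _ 0], rule exI[of _ f]) (simp add: \<Lambda>_0 mult.commute[of _ f])
  next
    fix x y assume "x \<in> I" "y \<in> I"
    then obtain k g k' g' where x: "x * to_fract f ^ k = to_fract g" "\<And>h. \<Lambda> k (h * g) = 0"
      and y: "y * to_fract f ^ k' = to_fract g'" "\<And>h. \<Lambda> k' (h * g') = 0"
      unfolding I_def by blast
    have up: "\<Lambda> (k + i) (f ^ i * h) = \<Lambda> k h" for k i h
    proof (induction i)
      case (Suc i)
      have "\<Lambda> (k + Suc i) (f ^ Suc i * h) = \<Lambda> (Suc (k + i)) (f * (f ^ i * h))" by (simp add: mult.assoc)
      then show ?case using \<Lambda>_f Suc by metis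
    qed simp
    have "(x + y) * to_fract f ^ (k + k') = (x * to_fract f ^ k) * to_fract f ^ k' + (y * to_fract f ^ k') * to_fract f ^ k"
      by (simp add: algebra_simps power_add)
    also have "\<dots> = to_fract (f ^ k' * g + f ^ k * g')"
      unfolding x(1) y(1) by (simp add: ring_homoD[OF ring_homo_to_fract] mult.commute)
    finally have 1: "(x + y) * to_fract f ^ (k + k') = to_fract (f ^ k' * g + f ^ k * g')" .
    have 2: "\<Lambda> (k + k') (h * (f ^ k' * g + f ^ k * g')) = 0" for h
    proof -
      have "h * (f ^ k' * g + f ^ k * g') = f ^ k' * (h * g) + f ^ k * (h * g')" by (simp add: algebra_simps)
      then have "\<Lambda> (k + k') (h * (f ^ k' * g + f ^ k * g')) = \<Lambda> (k + k') (f ^ k' * (h * g)) + \<Lambda> (k' + k) (f ^ k * (h * g'))"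
        by (simp add: \<Lambda>_add add.commute)
      then show ?thesis by (simp add: up x y)
    qed
    show "x + y \<in> I" unfolding I_def using 1 2 by blast
  next
    fix q x assume "x \<in> I"
    then obtain k g where x: "x * to_fract f ^ k = to_fract g" "\<And>h. \<Lambda> k (h * g) = 0"
      unfolding I_def by blast
    have "(to_fract q * x) * to_fract f ^ k = to_fract (q * g)" by (simp add: mult.assoc x to_fract_hom)
    moreover have "\<Lambda> k (h * (q * g)) = 0" for h using x(2)[of "h * q"] by (simp add: mult.assoc)
    ultimately show "to_fract q * x \<in> I" unfolding I_def by blast
  next
    fix d x assume d: "d = pd1 \<or> d = pd2" and "x \<in> I"
    then obtain k g where x: "x * to_fract f ^ k = to_fract g" "\<And>h. \<Lambda> k (h * g) = 0"
      unfolding I_def by blast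
    have "\<Lambda> (Suc k) (h * (f * d g + cps2_const (\<sigma> - of_nat k) * (g * d f))) = 0" for h
    proof -
      have "d (h * g) = h * d g + d h * g" using d pd_mult by auto
      then have "h * (f * d g + cps2_const (\<sigma> - of_nat k) * (g * d f))
         = (f * d (h * g) + cps2_const (\<sigma> - of_nat k) * ((h * g) * d f)) - f * (d h * g)"
        by (simp add: algebra_simps)
      then show ?thesis by (simp only: \<Lambda>_diff stokes[OF d] \<Lambda>_f x(2) diff_zero)
    qed
    then show "fract_deriv d x + to_fract (cps2_const \<sigma>) * (to_fract (d f) / to_fract f) * x \<in> I"
      unfolding I_def using fract_quotient_twisted[OF d f0 x(1)] by blast
  qed
  then obtain k g where kg: "to_fract (cps2_const (poly p \<sigma>)) * to_fract f ^ k = to_fract g" "\<And>h. \<Lambda> k (h * g) = 0"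
    unfolding I_def by blast
  have "to_fract (cps2_const (poly p \<sigma>) * f ^ k) = to_fract g"
    using kg(1) by (simp add: ring_homoD[OF ring_homo_to_fract])
  then have g: "g = cps2_const (poly p \<sigma>) * f ^ k" by (metis to_fract_inj)
  \<comment> \<open>this uses that \<open>p\<close> does not vanish at \<open>\<sigma>\<close>\<close>
  have \<Lambda>z: "\<Lambda> 0 h = 0" for h
  proof -
    have up: "\<Lambda> i (h * f ^ i) = \<Lambda> 0 h" for i
    proof (induction i)
      case (Suc i)
      have "\<Lambda> (Suc i) (h * f ^ Suc i) = \<Lambda> (Suc i) (f * (h * f ^ i))" by (simp add: mult_ac)
      then show ?case using \<Lambda>_f Suc by metis
    qed simp
    have "poly p \<sigma> * \<Lambda> 0 h = \<Lambda> k (h * g)"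
      unfolding g mult.left_commute[of h] \<Lambda>_const up ..
    then show ?thesis using kg(2) pnz by (simp add: \<sigma>_def)
  qed
  have \<Lambda>1f: "\<Lambda> 1 (f * h) = 0" for h using \<Lambda>_f[of 0 h] \<Lambda>z by simp
  \<comment> \<open>the coefficient of \<open>df \<and> \<omega>\<close>\<close>
  define G where "G = B * pd1 f - A * pd2 f"
  have \<sigma>0: "\<sigma> \<noteq> 0" using \<sigma>Z by auto
  have \<Lambda>d: "\<Lambda> 1 (h * d f) = 0" if d: "d = pd1 \<or> d = pd2" for d h
  proof -
    have "\<Lambda> 1 (f * d h) + \<sigma> * \<Lambda> 1 (h * d f) = 0" using stokes[OF d, of 0 h] by (simp add: \<Lambda>_add \<Lambda>_const)
    then show ?thesis using \<Lambda>1f \<sigma>0 by simp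
  qed
  have \<Lambda>G: "\<Lambda> 1 G = 0" unfolding G_def \<Lambda>_diff using \<Lambda>d[of pd1 B] \<Lambda>d[of pd2 A] by simp
  note V = value_wedge[OF form, folded G_def]
  define e where "e = n * (a - 1) + m * (b - 1)"
  have en: "e + (n + m) = n * m + l"
  proof -
    have "n * (a - 1) + n = n * a" using ab(2) by (cases a) simp_all
    moreover have "m * (b - 1) + m = m * b" using ab(4) by (cases b) simp_all
    ultimately show ?thesis unfolding e_def using ab(1) by linarith
  qed
  then have "subdegree (Ev (\<Psi> G)) = e" using V(2) by linarith
  then have Ge: "order_ge e (Ev (\<Psi> G))" "Ev (\<Psi> G) $ e \<noteq> 0"
    using subdegree_order_ge[OF V(1)] by auto
  obtain q c' where q: "c' \<noteq> 0" "order_ge e (\<Psi> (G - q * f))" "\<Psi> (G - q * f) $ e = monom c' (b - 1)"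
    using reduce[OF Ge e_def] ab by (metis diff_le_self le_less_trans)
  have "\<Lambda> 1 (G - q * f) = 0" using \<Lambda>1f[of q] \<Lambda>G unfolding \<Lambda>_diff mult.commute[of q] by simp
  moreover have "\<Lambda> 1 (G - q * f) = tp.period 1 (monom c' (b - 1) * [:of_nat n * jac:])"
  proof -
    \<comment> \<open>the residue is taken exactly at the order of \<open>\<Psi> (G - q * f) * J\<close>\<close>
    have E: "l + n * m * 1 = e + (n + m)" using en by simp
    have "R.res 1 (e + (n + m)) (\<Psi> (G - q * f) * J) = tp.period 1 ((\<Psi> (G - q * f) * J) $ (e + (n + m)))"
      by (rule R.res_leading[OF order_ge_mult(1)[OF q(2) J_leading(1)]])
    then show ?thesis unfolding \<Lambda>_def E order_ge_mult(2)[OF q(2) J_leading(1)] q(3) J_leading(2) .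
  qed
  moreover have "monom c' (b - 1) * [:of_nat n * jac:] = smult (of_nat n * jac) (monom c' (b - 1))"
    by simp
  ultimately have "of_nat n * jac * (c' * tp.beta 1 (b - 1)) = 0"
    by (simp only: tp.period_smult tp.period_monom)
  then have "tp.beta 1 (b - 1) = 0" using q(1) jac_nz n1 by simp
  moreover have "tp.beta 1 (b - 1) \<noteq> 0"
  proof -
    have sb: "Suc (b - 1) = b" using ab by simp
    have nd: "\<not> n dvd b" using ab by (auto dest: dvd_imp_le)
    have u: "complex_of_nat b / of_nat n \<notin> \<int>\<^sub>\<le>\<^sub>0" using tp.pos_u[of "b - 1"] unfolding sb .
    \<comment> \<open>the argument of the last Gamma factor; it lies strictly between \<open>0\<close> and \<open>1\<close>\<close>
    have bn: "complex_of_nat b / of_nat n + \<sigma> = complex_of_real (1 - real a / real m)"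
    proof -
      have "real (n * m + l) = real (n * a + m * b)" using ab(1) by (rule arg_cong)
      then have "real n * real m + real l = real n * real a + real m * real b" by simp
      then have "real l = real n * real a + real m * real b - real n * real m" by simp
      then have "real b / real n - real l / real (n * m) = 1 - real a / real m"
        using n1 nm by (simp add: diff_divide_distrib add_divide_distrib)
      then have "complex_of_real (real b / real n - real l / real (n * m)) = complex_of_real (1 - real a / real m)"
        by simp
      then show ?thesis by (simp add: \<sigma>_def)
    qed
    have r: "complex_of_real (1 - real a / real m) \<notin> \<int>"
      using ab by (intro of_real_not_Ints) (auto simp: divide_less_eq)
    have "Gamma (complex_of_nat b / of_nat n) \<noteq> 0" using u by (simp add: Gamma_eq_zero_iff)
    moreover have "Gamma (\<sigma> - of_nat 1 + 1) \<noteq> 0"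
      using \<sigma>Z nonpos_Ints_Int by (auto simp: Gamma_eq_zero_iff)
    moreover have "rGamma (complex_of_nat b / of_nat n + \<sigma> - of_nat 1 + 1) \<noteq> 0"
    proof -
      have "complex_of_nat b / of_nat n + \<sigma> - of_nat 1 + 1 = complex_of_real (1 - real a / real m)" using bn by simp
      then show ?thesis using r nonpos_Ints_Int unfolding rGamma_eq_zero_iff by metis
    qed
    ultimately show ?thesis unfolding tp.beta_def sb using nd c(1) by simp
  qed
  ultimately show False by simp
qed

end

section \<open>Gaps of the semigroup and the theorem\<close>

lemma vanishes_to_cps2_mult:
  assumes "f \<noteq> 0" shows "vanishes_to (cps2_mult f) f" "\<not> vanishes_to (Suc (cps2_mult f)) f"
proof -
  let ?P = "\<lambda>n. \<exists>i j. i + j = n \<and> cps2_coeff f i j \<noteq> 0"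
  have "\<exists>i j. cps2_coeff f i j \<noteq> 0" using assms by (auto simp: cps2_eq_iff cps2_coeff_simps)
  then have "\<exists>n. ?P n" by blast
  then have "?P (cps2_mult f)" unfolding cps2_mult_def by (rule LeastI_ex)
  then obtain i j where "i + j = cps2_mult f" "cps2_coeff f i j \<noteq> 0" by blast
  then show "\<not> vanishes_to (Suc (cps2_mult f)) f" unfolding vanishes_to_def by (metis lessI)
  show "vanishes_to (cps2_mult f) f"
    unfolding vanishes_to_def cps2_mult_def using not_less_Least[of _ ?P] by blast
qed

text \<open>
  Take \<open>b\<close> with \<open>m b = l\<close> modulo \<open>n\<close>. If \<open>b = 0\<close> or \<open>a \<ge> m\<close>, then \<open>l\<close> would lie in the semigroup.
\<close>

lemma gap_representation:
  assumes co: "coprime n m" and n: "1 < n" and m: "0 < m" and l: "0 < l"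
    and gap: "\<nexists>i j. l = n * i + m * j"
  shows "\<exists>a b. n * m + l = n * a + m * b \<and> 0 < a \<and> a < m \<and> 0 < b \<and> b < (n::nat)"
proof -
  obtain x y where xy: "m * x = n * y + gcd m n" using bezout_nat[of m n] m by auto
  then have xy: "m * x = n * y + 1" using co by (simp add: coprime_iff_gcd_eq_1 gcd.commute)
  define b where "b = (x * l) mod n"
  have bn: "b < n" using n by (simp add: b_def)
  have mb: "(m * b) mod n = l mod n"
  proof -
    have "(m * b) mod n = (m * (x * l)) mod n" by (simp add: b_def mod_mult_right_eq)
    also have "m * (x * l) = n * (y * l) + l" using xy by (simp add: mult.assoc[symmetric] distrib_right)
    also have "(n * (y * l) + l) mod n = l mod n" by simp
    finally show ?thesis .
  qed
  have b0: "0 < b"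
  proof (rule ccontr)
    assume "\<not> 0 < b"
    then have "n dvd l" using mb by (simp add: dvd_eq_mod_eq_0)
    then obtain i where "l = n * i + m * 0" by auto
    with gap show False by blast
  qed
  have lt: "m * b < n * m + l"
  proof -
    have "m * b \<le> m * n" by (rule mult_le_mono2) (use bn in simp)
    also have "\<dots> < n * m + l" using l by simp
    finally show ?thesis .
  qed
  have "(n * m + l) mod n = (m * b) mod n" using mb by simp
  then have "n dvd (n * m + l) - m * b" using lt mod_eq_dvd_iff_nat[of "m * b" "n * m + l" n] by simp
  then obtain a where a: "(n * m + l) - m * b = n * a" by blast
  then have eq: "n * m + l = n * a + m * b" using lt by simp
  have a0: "0 < a" using a lt by (cases a) auto
  have am: "a < m"
  proof (rule ccontr)
    assume "\<not> a < m"
    then have "n * a = n * m + n * (a - m)" by (simp add: distrib_left[symmetric])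
    then have "l = n * (a - m) + m * b" using eq by simp
    with gap show False by blast
  qed
  show ?thesis using eq a0 am b0 bn by blast
qed

theorem theorem4p1:
  fixes f :: cps2 and \<gamma> :: curve and v0 v1 :: nat
  assumes "plane_branch f"
    and "branch_param f \<gamma>"
    and "minimally_generated_by (value_semigroup f \<gamma>) v0 v1"
  shows "\<forall>l \<in> form_values f \<gamma> - value_semigroup f \<gamma>.
           - (of_nat l / of_nat (v0 * v1)) \<in> bernstein_roots f"
proof
  fix l assume l: "l \<in> form_values f \<gamma> - value_semigroup f \<gamma>"
  have irr: "irreducible f" using assms(1) by (simp add: plane_branch_def)
  then have f0: "f \<noteq> 0" by auto
  define n where "n = cps2_mult f"
  obtain \<Phi>1 \<Phi>2 m \<phi> where \<Phi>: "coordinate_change \<Phi>1 \<Phi>2" "normal_param n m \<phi>"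
    "\<gamma> = (cps2_comp \<Phi>1 \<phi>, cps2_comp \<Phi>2 \<phi>)" "cps2_comp f \<gamma> = 0"
    using assms(2) unfolding branch_param_def n_def by blast
  have \<phi>: "1 < n" "n < m" "\<not> n dvd m" "fst \<phi> = fps_X ^ n" "subdegree (snd \<phi>) = m" "snd \<phi> $ m = 1"
    using \<Phi>(2) by (auto simp: normal_param_def)
  have pair: "\<phi> = (fps_X ^ n, snd \<phi>)" using \<phi>(4) by (metis prod.collapse)
  interpret br: branch n m \<Phi>1 \<Phi>2 "snd \<phi>" f \<gamma>
  proof
    show "\<gamma> = (cps2_comp \<Phi>1 (fps_X ^ n, snd \<phi>), cps2_comp \<Phi>2 (fps_X ^ n, snd \<phi>))"
      using \<Phi>(3) pair by simp
  qed (use \<Phi> \<phi> vanishes_to_cps2_mult[OF f0] in \<open>auto simp: n_def\<close>)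
  note gen = br.semigroup_generators[OF assms(3)]
  interpret cb: coprime_branch n m \<Phi>1 \<Phi>2 "snd \<phi>" f \<gamma>
    by unfold_locales (rule gen(3))
  obtain A B where AB: "form_pullback \<gamma> (A, B) \<noteq> 0" "l = subdegree (form_pullback \<gamma> (A, B)) + 1"
    using l unfolding form_values_def by (auto simp: split_paired_all) 
  have "l \<notin> submonoid_gen {n, m}"
    using l assms(3) gen by (simp add: minimally_generated_by_def)
  then have "\<nexists>i j. l = n * i + m * j" by (simp add: submonoid_gen_pair)
  then have "\<exists>a b. n * m + l = n * a + m * b \<and> 0 < a \<and> a < m \<and> 0 < b \<and> b < n"
    by (intro gap_representation[OF gen(3) \<phi>(1)]) (use \<phi>(2) AB(2) in auto)
  then obtain a b where ab: "n * m + l = n * a + m * b" "0 < a" "a < m" "0 < b" "b < n"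
    by blast
  define z :: complex where "z = - (of_nat l / of_nat (n * m))"
  define bf where "bf = bernstein_poly f"
  have bf: "bernstein_ideal f = {q. bf dvd q}"
    using theI'[OF bernstein_poly_unique[of f]] unfolding bf_def bernstein_poly_def by blast
  then have mem: "bf \<in> bernstein_ideal f" by simp
  have "poly bf (- 1) = 0" by (rule bernstein_root_minus_1[OF mem irr])
  then have "[:1, 1:] dvd bf" using poly_eq_0_iff_dvd[of bf "- 1"] by simp
  then have fac: "bf = [:1, 1:] * reduced_bernstein_poly f"
    unfolding reduced_bernstein_poly_def bf_def[symmetric] by (simp only: dvd_mult_div_cancel)
  have "poly bf z = 0" unfolding z_def by (rule cb.bernstein_root[OF AB ab mem])
  then have "poly [:1, 1:] z * poly (reduced_bernstein_poly f) z = 0" using fac by (metis poly_mult)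
  then have "(1 + z) * poly (reduced_bernstein_poly f) z = 0" by simp
  moreover have "1 + z \<noteq> 0"
  proof
    assume "1 + z = 0"
    then have "complex_of_nat l / of_nat (n * m) = 1" by (simp add: z_def)
    then have "complex_of_nat l = of_nat (n * m)" using \<phi>(1,2) by (simp add: divide_eq_1_iff)
    then have "l = n * m" by (metis of_nat_eq_iff)
    then have "l = n * m + m * 0" by simp
    then show False using \<open>\<nexists>i j. l = n * i + m * j\<close> by blast
  qed
  ultimately have "poly (reduced_bernstein_poly f) z = 0" by simp
  then show "- (of_nat l / of_nat (v0 * v1)) \<in> bernstein_roots f"
    unfolding bernstein_roots_def gen(1,2) z_def mem_Collect_eq .
qed

end
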